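(* Let $1<p<\infty$ and $1\le q\le p$. Suppose that $(X,d,\mu)$ is a doubling metric measure space that carries a weak $(1,L^{p,q})$-Poincaré inequality. Then the Lipschitz functions are dense in $N^{1,L^{p,q}}(X,\mu)$.
   Context: Setting: $(X,d)$ is a complete metric space endowed with a nontrivial Borel regular measure $\mu$ that is finite and nonzero on nonempty bounded open sets. Lorentz norm: for a $\mu$-measurable $f:X\to[-\infty,\infty]$ let $\mu_{[f]}(t)=\mu(\{x\in X:|f(x)|>t\})$, $t\ge0$, and $f^*(t)=\inf\{v\ge 0:\mu_{[f]}(v)\le t\}$, $t\ge0$. For $1<p<\infty$, $1\le q<\infty$ put $\|f\|_{L^{p,q}(X,\mu)}=\left(\int_0^\infty (t^{1/p}f^*(t))^q\,\frac{dt}{t}\right)^{1/q}$; $L^{p,q}(X,\mu)$ is the set of $\mu$-measurable $f$ with $\|f\|_{L^{p,q}(X,\mu)}<\infty$. Modulus: a curve in $X$ is rectifiable if it has finite length; a rectifiable curve $\gamma$ is parametrized by arc length on $[0,\ell(\gamma)]$, and $\int_\gamma\rho=\int_0^{\ell(\gamma)}\rho(\gamma(s))\,ds$ for Borel $\rho\ge0$. $\Gamma_{\rm rect}$ is the family of all nonconstant rectifiable curves. For $\Gamma\subset\Gamma_{\rm rect}$, $F(\Gamma)$ is the family of Borel $\rho:X\to[0,\infty]$ with $\int_\gamma\rho\ge1$ for every $\gamma\in\Gamma$, and $\mathrm{Mod}_{p,q}(\Gamma)=\inf_{\rho\in F(\Gamma)}\|\rho\|_{L^{p,q}(X,\mu)}^p$.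 A property holds for $p,q$-almost every curve if it holds on all curves of $\Gamma_{\rm rect}$ outside a family of zero $\mathrm{Mod}_{p,q}$. Upper gradients: a Borel $g:X\to[0,\infty]$ is an upper gradient of a Borel $u:X\to[-\infty,\infty]$ if for every rectifiable curve $\gamma$ one has $|u(\gamma(0))-u(\gamma(\ell(\gamma)))|\le\int_\gamma g$ whenever both $u(\gamma(0)),u(\gamma(\ell(\gamma)))$ are finite, and $\int_\gamma g=\infty$ otherwise; it is a $p,q$-weak upper gradient of $u$ if this holds for $p,q$-almost every $\gamma\in\Gamma_{\rm rect}$. Newtonian space (for $1\le q\le p$): $\widetilde N^{1,L^{p,q}}(X,\mu)$ is the space of Borel functions $u\in L^{p,q}(X,\mu)$ having a $p,q$-weak upper gradient in $L^{p,q}(X,\mu)$, with $\|u\|_{N^{1,L^{p,q}}}=(\|u\|_{L^{p,q}}^{q}+\inf_g\|g\|_{L^{p,q}}^{q})^{1/q}$, the infimum over all $p,q$-weak upper gradients $g\in L^{p,q}(X,\mu)$ of $u$. $N^{1,L^{p,q}}(X,\mu)$ is the quotient by $u\sim v\iff\|u-v\|_{N^{1,L^{p,q}}}=0$. Density is with respect to $\|\cdot\|_{N^{1,L^{p,q}}}$. Doubling: there is $C\ge1$ with $\mu(2B)\le C\mu(B)$ for every ball $B=B(x,r)$, where $\lambda B(x,r)=B(x,\lambda r)$ and $B(x,r)$ is the open ball. Weak $(1,L^{p,q})$-Poincaré inequality: there exist constants $C>0$ and $\sigma\ge1$ such that for all balls $B$ with radius $r$, all $\mu$-measurable functions $u$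 on $X$ and all upper gradients $g$ of $u$, $$\frac1{\mu(B)}\int_B|u-u_B|\,d\mu\le Cr\,\frac{1}{\mu(\sigma B)^{1/p}}\,\|g\chi_{\sigma B}\|_{L^{p,q}(X,\mu)},$$ where $u_B=\frac1{\mu(B)}\int_Bu\,d\mu$ whenever $u$ is locally $\mu$-integrable. *)

theory Defs
  imports "HOL-Analysis.Analysis"
begin

section \<open>The metric measure space\<close>

text \<open>
  The measure is represented by a measure space \<open>M\<close> over the whole type whose sigma-algebra
  consists of the \<open>\<mu>\<close>-measurable sets; it contains the Borel sets and is complete.
  The associated outer measure, defined on all subsets, is \<^const>\<open>outer_measure_of\<close> \<open>M\<close>,
  and Borel regularity is a condition on the latter.  A function is \<open>\<mu>\<close>-measurable iff it is
  in \<open>borel_measurable M\<close>, and Borel iff it is in \<open>borel_measurable borel\<close>.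
\<close>

definition borel_regular_measure :: "'a::topological_space measure \<Rightarrow> bool" where
  "borel_regular_measure M \<longleftrightarrow>
     space M = UNIV \<and> sets borel \<subseteq> sets M \<and> complete_measure M \<and>
     (\<forall>A. \<exists>B\<in>sets borel. A \<subseteq> B \<and> emeasure M B = outer_measure_of M A)"

definition metric_measure_space :: "'a::complete_space measure \<Rightarrow> bool" where
  "metric_measure_space M \<longleftrightarrow>
     borel_regular_measure M \<and> emeasure M UNIV \<noteq> 0 \<and>
     (\<forall>U. open U \<and> bounded U \<and> U \<noteq> {} \<longrightarrow> 0 < emeasure M U \<and> emeasure M U < \<infinity>)"

definition doubling_measure :: "'a::metric_space measure \<Rightarrow> bool" where
  "doubling_measure M \<longleftrightarrow>
     (\<exists>C\<ge>1. \<forall>x. \<forall>r>0. emeasure M (ball x (2 * r)) \<le> ennreal C * emeasure M (ball x r))"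


section \<open>Lorentz norms\<close>

text \<open>Real powers on \<open>[0,\<infinity>]\<close>, used only for exponents \<open>a > 0\<close>.\<close>

definition ennpowr :: "ennreal \<Rightarrow> real \<Rightarrow> ennreal" where
  "ennpowr x a = (if x = \<infinity> then \<infinity> else ennreal (enn2real x powr a))"

definition distribution_fun :: "'a measure \<Rightarrow> ('a \<Rightarrow> ereal) \<Rightarrow> real \<Rightarrow> ennreal" where
  "distribution_fun M f t = emeasure M {x \<in> space M. \<bar>f x\<bar> > ereal t}"

definition rearrangement :: "'a measure \<Rightarrow> ('a \<Rightarrow> ereal) \<Rightarrow> real \<Rightarrow> ennreal" where
  "rearrangement M f t = Inf {ennreal v |v. 0 \<le> v \<and> distribution_fun M f v \<le> ennreal t}"

definition lorentz_norm :: "'a measure \<Rightarrow> real \<Rightarrow> real \<Rightarrow> ('a \<Rightarrow> ereal) \<Rightarrow> ennreal" where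
  "lorentz_norm M p q f =
     ennpowr (\<integral>\<^sup>+t\<in>{0<..}. ennpowr (ennreal (t powr (1 / p)) * rearrangement M f t) q
                             * ennreal (1 / t) \<partial>lborel) (1 / q)"

definition lorentz_space :: "'a measure \<Rightarrow> real \<Rightarrow> real \<Rightarrow> ('a \<Rightarrow> ereal) set" where
  "lorentz_space M p q = {f \<in> borel_measurable M. lorentz_norm M p q f < \<infinity>}"


section \<open>Rectifiable curves and modulus\<close>

text \<open>
  Curves are given by continuous maps on \<open>[0,1]\<close> (the library's \<^const>\<open>path\<close>), not necessarily
  parametrized by arc length.
\<close>

definition curve_length_on :: "(real \<Rightarrow> 'a::metric_space) \<Rightarrow> real \<Rightarrow> real \<Rightarrow> ennreal" where
  "curve_length_on \<gamma> a b =
     (SUP ts \<in> {ts. sorted ts \<and> set ts \<subseteq> {a..b}}.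
        \<Sum>i<length ts - 1. ennreal (dist (\<gamma> (ts ! i)) (\<gamma> (ts ! Suc i))))"

abbreviation curve_length :: "(real \<Rightarrow> 'a::metric_space) \<Rightarrow> ennreal" where
  "curve_length \<gamma> \<equiv> curve_length_on \<gamma> 0 1"

definition rectifiable :: "(real \<Rightarrow> 'a::metric_space) \<Rightarrow> bool" where
  "rectifiable \<gamma> \<longleftrightarrow> path \<gamma> \<and> curve_length \<gamma> < \<infinity>"

definition Gamma_rect :: "(real \<Rightarrow> 'a::metric_space) set" where
  "Gamma_rect = {\<gamma>. rectifiable \<gamma> \<and> \<not> \<gamma> constant_on {0..1}}"

text \<open>
  For rectifiable \<open>\<gamma>\<close> and \<open>0 \<le> s \<le> \<ell>(\<gamma>)\<close> there is \<open>t\<close> such that \<open>\<gamma>\<close> restricted to \<open>[0,t]\<close> has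
  length \<open>s\<close>, and \<open>\<gamma> t\<close> does not depend on the choice of \<open>t\<close>.
\<close>

definition arc_length_param :: "(real \<Rightarrow> 'a::metric_space) \<Rightarrow> real \<Rightarrow> 'a" where
  "arc_length_param \<gamma> s = \<gamma> (SOME t. t \<in> {0..1} \<and> curve_length_on \<gamma> 0 t = ennreal s)"

definition curve_integral :: "(real \<Rightarrow> 'a::metric_space) \<Rightarrow> ('a \<Rightarrow> ennreal) \<Rightarrow> ennreal" where
  "curve_integral \<gamma> \<rho> =
     (\<integral>\<^sup>+s\<in>{0..enn2real (curve_length \<gamma>)}. \<rho> (arc_length_param \<gamma> s) \<partial>lborel)"

definition admissible :: "(real \<Rightarrow> 'a::metric_space) set \<Rightarrow> ('a \<Rightarrow> ennreal) set" where
  "admissible \<Gamma> = {\<rho> \<in> borel_measurable borel. \<forall>\<gamma>\<in>\<Gamma>. curve_integral \<gamma> \<rho> \<ge> 1}"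

definition Mod :: "'a::metric_space measure \<Rightarrow> real \<Rightarrow> real \<Rightarrow> (real \<Rightarrow> 'a) set \<Rightarrow> ennreal" where
  "Mod M p q \<Gamma> =
     (INF \<rho> \<in> admissible \<Gamma>. ennpowr (lorentz_norm M p q (\<lambda>x. enn2ereal (\<rho> x))) p)"

definition almost_every_curve ::
    "'a::metric_space measure \<Rightarrow> real \<Rightarrow> real \<Rightarrow> ((real \<Rightarrow> 'a) \<Rightarrow> bool) \<Rightarrow> bool" where
  "almost_every_curve M p q P \<longleftrightarrow>
     (\<exists>\<Gamma>\<subseteq>Gamma_rect. Mod M p q \<Gamma> = 0 \<and> (\<forall>\<gamma>\<in>Gamma_rect - \<Gamma>. P \<gamma>))"


section \<open>Upper gradients\<close>

definition upper_gradient_on_curve ::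
    "('a::metric_space \<Rightarrow> ereal) \<Rightarrow> ('a \<Rightarrow> ennreal) \<Rightarrow> (real \<Rightarrow> 'a) \<Rightarrow> bool" where
  "upper_gradient_on_curve u g \<gamma> \<longleftrightarrow>
     (if \<bar>u (pathstart \<gamma>)\<bar> \<noteq> \<infinity> \<and> \<bar>u (pathfinish \<gamma>)\<bar> \<noteq> \<infinity>
      then e2ennreal \<bar>u (pathstart \<gamma>) - u (pathfinish \<gamma>)\<bar> \<le> curve_integral \<gamma> g
      else curve_integral \<gamma> g = \<infinity>)"

text \<open>
  Measurability of \<open>u\<close> is required where these notions are used: \<open>u\<close> is Borel in the Newtonian
  space and \<open>\<mu>\<close>-measurable in the Poincare inequality.
\<close>

definition upper_gradient :: "('a::metric_space \<Rightarrow> ereal) \<Rightarrow> ('a \<Rightarrow> ennreal) \<Rightarrow> bool" where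
  "upper_gradient u g \<longleftrightarrow>
     g \<in> borel_measurable borel \<and> (\<forall>\<gamma>. rectifiable \<gamma> \<longrightarrow> upper_gradient_on_curve u g \<gamma>)"

definition weak_upper_gradient ::
    "'a::metric_space measure \<Rightarrow> real \<Rightarrow> real \<Rightarrow> ('a \<Rightarrow> ereal) \<Rightarrow> ('a \<Rightarrow> ennreal) \<Rightarrow> bool" where
  "weak_upper_gradient M p q u g \<longleftrightarrow>
     g \<in> borel_measurable borel \<and> almost_every_curve M p q (upper_gradient_on_curve u g)"

definition weak_upper_gradients ::
    "'a::metric_space measure \<Rightarrow> real \<Rightarrow> real \<Rightarrow> ('a \<Rightarrow> ereal) \<Rightarrow> ('a \<Rightarrow> ennreal) set" where
  "weak_upper_gradients M p q u =
     {g. weak_upper_gradient M p q u g \<and> (\<lambda>x. enn2ereal (g x)) \<in> lorentz_space M p q}"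


section \<open>Newtonian Lorentz spaces\<close>

definition newtonian_tilde ::
    "'a::metric_space measure \<Rightarrow> real \<Rightarrow> real \<Rightarrow> ('a \<Rightarrow> ereal) set" where
  "newtonian_tilde M p q =
     {u \<in> borel_measurable borel. u \<in> lorentz_space M p q \<and> weak_upper_gradients M p q u \<noteq> {}}"

definition newtonian_norm ::
    "'a::metric_space measure \<Rightarrow> real \<Rightarrow> real \<Rightarrow> ('a \<Rightarrow> ereal) \<Rightarrow> ennreal" where
  "newtonian_norm M p q u =
     ennpowr (ennpowr (lorentz_norm M p q u) q
              + (INF g \<in> weak_upper_gradients M p q u.
                   ennpowr (lorentz_norm M p q (\<lambda>x. enn2ereal (g x))) q)) (1 / q)"

text \<open>
  In \<^typ>\<open>ereal\<close> one has \<open>\<infinity> - \<infinity> = \<infinity>\<close>.  The convention does not matter: for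
  \<open>u\<close> in \<^const>\<open>newtonian_tilde\<close> the set where \<open>\<bar>u\<bar> = \<infinity>\<close> has measure zero and is avoided by
  almost every curve.
\<close>

definition newtonian_rel ::
    "'a::metric_space measure \<Rightarrow> real \<Rightarrow> real \<Rightarrow> (('a \<Rightarrow> ereal) \<times> ('a \<Rightarrow> ereal)) set" where
  "newtonian_rel M p q =
     {(u, v). u \<in> newtonian_tilde M p q \<and> v \<in> newtonian_tilde M p q \<and>
              newtonian_norm M p q (\<lambda>x. u x - v x) = 0}"

definition newtonian_space ::
    "'a::metric_space measure \<Rightarrow> real \<Rightarrow> real \<Rightarrow> ('a \<Rightarrow> ereal) set set" where
  "newtonian_space M p q = newtonian_tilde M p q // newtonian_rel M p q"


section \<open>Poincare inequality\<close>

definition locally_integrable :: "'a::metric_space measure \<Rightarrow> ('a \<Rightarrow> ereal) \<Rightarrow> bool" where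
  "locally_integrable M u \<longleftrightarrow>
     u \<in> borel_measurable M \<and> (\<forall>x. \<exists>r>0. (\<integral>\<^sup>+y\<in>ball x r. e2ennreal \<bar>u y\<bar> \<partial>M) < \<infinity>)"

definition mean_value :: "'a measure \<Rightarrow> ('a \<Rightarrow> ereal) \<Rightarrow> 'a set \<Rightarrow> real" where
  "mean_value M u B = (LINT y:B|M. real_of_ereal (u y)) / measure M B"

text \<open>
  The mean value of \<open>u\<close> only makes sense for locally integrable \<open>u\<close>, so the inequality is
  required for those.
\<close>

definition weak_poincare :: "'a::metric_space measure \<Rightarrow> real \<Rightarrow> real \<Rightarrow> bool" where
  "weak_poincare M p q \<longleftrightarrow>
     (\<exists>C>0. \<exists>\<sigma>\<ge>1. \<forall>x. \<forall>r>0. \<forall>u g.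
        locally_integrable M u \<and> upper_gradient u g \<longrightarrow>
        (\<integral>\<^sup>+y\<in>ball x r. e2ennreal \<bar>u y - ereal (mean_value M u (ball x r))\<bar> \<partial>M)
            / emeasure M (ball x r)
        \<le> ennreal (C * r)
            * (lorentz_norm M p q (\<lambda>y. enn2ereal (g y * indicator (ball x (\<sigma> * r)) y))
               / ennpowr (emeasure M (ball x (\<sigma> * r))) (1 / p)))"

end

theory Submission
  imports Defs
begin

text \<open>
  The proof truncates \<open>u\<close> at height \<open>\<lambda> / 2\<close>, throws away the points at which the Lorentz maximal
  function of an upper gradient exceeds \<open>\<lambda>\<close>, observes that the truncation is Lipschitz with a
  constant comparable to \<open>\<lambda>\<close> on almost all of what is left, extends it to a bounded Lipschitz function \<open>f\<close>,
  and lets \<open>\<lambda>\<close> tend to infinity.  The weak upper gradient \<open>g\<close> of \<open>u\<close> is first turned into a genuine upper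
  gradient of the truncation by adding \<open>\<lambda> \<rho>\<close>, where \<open>\<rho>\<close> is admissible for the exceptional curves and as
  small in norm as desired (\<open>upper_gradient_truncate\<close>).

  The norm is handled through the identity
  \<open>\<parallel>f\<parallel>\<^sup>q = p \<integral> s powr (q - 1) * \<mu>(\<bar>f\<bar> > s) powr (q / p) ds\<close> (\<open>lorentz_norm_eq\<close>).  Since
  \<open>q / p \<le> 1\<close>, the power of \<open>\<mu>\<close> is subadditive, and Hoelder's inequality for finite sums turns
  it into a weak type estimate: if \<open>B\<^sub>i\<close> are disjoint sets and the
  integral for \<open>g\<close> restricted to \<open>B\<^sub>i\<close> is at least \<open>\<lambda> powr q * \<mu>(B\<^sub>i) powr (q / p)\<close> for each \<open>i\<close>, then
  \<open>\<lambda> powr q * (\<Sum> \<mu>(B\<^sub>i)) powr (q / p)\<close> is at most twice the integral for \<open>g\<close> taken over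
  \<open>s > \<lambda> / 2\<close> only (\<open>weak_type_disjoint\<close>).  That tail vanishes as \<open>\<lambda> \<rightarrow> \<infinity>\<close>.  With a Vitali
  selection and doubling, the bad points lie in an open set \<open>W\<close> with
  \<open>\<lambda> powr q * \<mu>(W) powr (q / p) \<rightarrow> 0\<close> (\<open>bad_balls_cover\<close>).

  The Poincare inequality bounds the mean oscillation of the truncation on every ball of radius
  \<open>r \<le> 4\<close> centred off \<open>W\<close> by a multiple of \<open>\<lambda> r\<close>.  Averages over dyadic balls then converge to a Lipschitz
  function on the complement of \<open>W\<close>, and a covering of that complement by balls of radius
  \<open>1 / 2 ^ j\<close> shows that the limit coincides almost everywhere with the truncation; Lebesgue's
  differentiation theorem is replaced by the linear decay of the oscillation
  (\<open>lipschitz_on_small_oscillation_set\<close>).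

  So \<open>u\<close> and \<open>f\<close> differ only on a set \<open>E\<close> with \<open>\<lambda> powr q * \<mu>(E) powr (q / p) \<rightarrow> 0\<close>, and \<open>f\<close> is
  \<open>L\<close>-Lipschitz with \<open>L\<close> proportional to \<open>\<lambda>\<close>.  The last point is that \<open>(g + L) \<chi>\<^sub>E\<close> is a weak
  upper gradient of \<open>u - f\<close>.  Along a curve on which \<open>g\<close> is integrable, follow \<open>u - f\<close> from one
  endpoint up to its first zero and from its last zero to the other endpoint: on both pieces
  \<open>u - f\<close> is nonzero, and what happens in between does not contribute to the difference of the
  endpoint values (\<open>nn_integral_increment_bound_off_zeros\<close>).  This requires integrals over
  subcurves, hence the continuity of the length function.  The estimates for \<open>E\<close> then make both
  \<open>\<parallel>u - f\<parallel>\<close> and \<open>\<parallel>(g + L) \<chi>\<^sub>E\<parallel>\<close> small.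
\<close>

section \<open>The Lorentz norm as an integral of the distribution function\<close>

lemma ennpowr_ennreal: "0 \<le> x \<Longrightarrow> ennpowr (ennreal x) a = ennreal (x powr a)"
  by (simp add: ennpowr_def)

lemma ennpowr_top [simp]: "ennpowr top a = top"
  by (simp add: ennpowr_def)

lemma ennpowr_0 [simp]: "ennpowr 0 a = 0"
  by (simp add: ennpowr_def)

lemma ennpowr_mono:
  assumes "0 < a" "x \<le> y" shows "ennpowr x a \<le> ennpowr y a"
proof (cases "y = \<infinity>")
  case False
  then have "x \<noteq> \<infinity>" using assms by (auto simp: top_unique)
  then show ?thesis using False assms
    by (auto simp: ennpowr_def intro!: ennreal_leI powr_mono2 enn2real_mono simp: top.not_eq_extremum)
qed simp

lemma ennpowr_ennpowr: "ennpowr (ennpowr x a) b = ennpowr x (a * b)"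
  by (simp add: ennpowr_def powr_powr)

lemma ennpowr_1 [simp]: "ennpowr x 1 = x"
  by (cases x) (auto simp: ennpowr_def)

lemma ennpowr_eq_0_iff [simp]: "ennpowr x a = 0 \<longleftrightarrow> x = 0"
  by (cases x) (auto simp: ennpowr_def)

lemma ennpowr_less_top_iff [simp]: "ennpowr x a < top \<longleftrightarrow> x < top"
  by (cases x) (auto simp: ennpowr_def)

lemma ennpowr_strict_mono:
  assumes "0 < a" "x < y" shows "ennpowr x a < ennpowr y a"
proof (rule ccontr)
  assume "\<not> ?thesis"
  then have "ennpowr (ennpowr y a) (1/a) \<le> ennpowr (ennpowr x a) (1/a)"
    using assms by (intro ennpowr_mono[of "1/a"]) (auto simp: not_less)
  then have "y \<le> x" using assms by (simp add: ennpowr_ennpowr)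
  then show False using assms by simp
qed

lemma ennpowr_mult: "ennpowr (x * y) a = ennpowr x a * ennpowr y a"
proof (cases "x = \<infinity> \<or> y = \<infinity>")
  case True
  then show ?thesis
    by (cases "x = 0 \<or> y = 0") (auto simp: ennreal_top_mult ennreal_mult_top)
next
  case False
  then show ?thesis
    by (cases x; cases y) (auto simp: ennpowr_ennreal powr_mult simp flip: ennreal_mult)
qed

text \<open>
  Normalizing to \<open>x + y = 1\<close>, each summand is at most its power \<open>a \<le> 1\<close>.
\<close>

lemma powr_add_le:
  fixes x y :: real assumes "0 < a" "a \<le> 1" "0 \<le> x" "0 \<le> y"
  shows "(x + y) powr a \<le> x powr a + y powr a"
proof (cases "x + y = 0")
  case False
  then have s: "0 < x + y" using assms by linarith
  have *: "z / (x + y) \<le> (z / (x + y)) powr a" if "0 \<le> z" "z \<le> x + y" for z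
    using powr_mono'[of a 1 "z / (x+y)"] assms that s by (simp add: divide_simps split: if_splits)
  have "1 = x / (x + y) + y / (x + y)" using s by (simp flip: add_divide_distrib)
  also have "\<dots> \<le> (x / (x + y)) powr a + (y / (x + y)) powr a"
    using assms by (intro add_mono *) auto
  also have "\<dots> = (x powr a + y powr a) / (x + y) powr a"
    using assms by (simp add: powr_divide add_divide_distrib)
  finally have "1 \<le> (x powr a + y powr a) / (x + y) powr a" .
  then show ?thesis using s by (subst (asm) pos_le_divide_eq) auto
qed (use assms in simp)

lemma ennpowr_add_le:
  assumes "0 < a" "a \<le> 1"
  shows "ennpowr (x + y) a \<le> ennpowr x a + ennpowr y a"
proof (cases "x = \<infinity> \<or> y = \<infinity>")
  case False
  then show ?thesis using assms
    by (cases x; cases y) (auto simp: ennpowr_ennreal powr_add_le ennreal_leI simp flip: ennreal_plus)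
qed auto

lemma measurable_ennpowr [measurable]: "(\<lambda>x. ennpowr x a) \<in> borel_measurable borel"
  unfolding ennpowr_def by measurable

text \<open>
  Superlevel sets of a monotone function are intervals.
\<close>

lemma borel_measurable_antimono_ennreal:
  fixes D :: "real \<Rightarrow> ennreal"
  assumes "\<And>s t. s \<le> t \<Longrightarrow> D t \<le> D s"
  shows "D \<in> borel_measurable borel"
proof (rule borel_measurableI_greater)
  fix y
  have "is_interval {s. y < D s}"
    unfolding is_interval_1 using assms by (auto intro: less_le_trans)
  then show "{s \<in> space borel. y < D s} \<in> sets borel"
    by (simp add: real_interval_borel_measurable)
qed

lemma nn_integral_powr_Icc:
  assumes "0 < a" "0 \<le> r"
  shows "(\<integral>\<^sup>+s\<in>{0..r}. ennreal (a * s powr (a - 1)) \<partial>lborel) = ennreal (r powr a)"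
proof -
  have "((\<lambda>s. s powr (a - 1)) has_integral (r powr (a - 1 + 1) / (a - 1 + 1))) {0..r}"
    using assms by (intro has_integral_powr_from_0) auto
  then have "((\<lambda>s. a * s powr (a - 1)) has_integral (a * (r powr a / a))) {0..r}"
    by (intro has_integral_mult_right) simp
  then have "((\<lambda>s. a * s powr (a - 1)) has_integral (r powr a)) {0..r}"
    using assms by simp
  then have "integral\<^sup>N lborel (\<lambda>s. indicator {0..r} s * (a * s powr (a - 1))) = r powr a"
    using assms by (intro nn_integral_has_integral_lebesgue) auto
  moreover have "(\<lambda>s. ennreal (indicator {0..r} s * (a * s powr (a - 1)))) =
     (\<lambda>s. ennreal (a * s powr (a - 1)) * indicator {0..r} s)"
    by (auto simp: fun_eq_iff indicator_def)
  ultimately show ?thesis by simp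
qed

text \<open>
  The layer cake formula for a single value; it is applied both to the rearrangement and to the
  distribution function.
\<close>

lemma ennpowr_eq_nn_integral:
  assumes "0 < a"
  shows "ennpowr x a = (\<integral>\<^sup>+s. ennreal (a * s powr (a - 1)) * indicator {s. 0 < s \<and> ennreal s < x} s \<partial>lborel)"
proof (cases x)
  case (real r)
  have "(\<integral>\<^sup>+s. ennreal (a * s powr (a - 1)) * indicator {s. 0 < s \<and> ennreal s < x} s \<partial>lborel)
      = (\<integral>\<^sup>+s\<in>{0..r}. ennreal (a * s powr (a - 1)) \<partial>lborel)"
  proof (rule nn_integral_cong_AE)
    have "AE s in lborel. s \<noteq> 0 \<and> s \<noteq> r"
      using AE_lborel_singleton by auto
    then show "AE s in lborel. ennreal (a * s powr (a - 1)) * indicator {s. 0 < s \<and> ennreal s < x} s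
      = ennreal (a * s powr (a - 1)) * indicator {0..r} s"
      by eventually_elim (use real in \<open>auto simp: indicator_def ennreal_less_iff\<close>)
  qed
  then show ?thesis using nn_integral_powr_Icc[OF assms, of r] real by (simp add: ennpowr_ennreal)
next
  case top
  have "ennreal (real n) \<le> (\<integral>\<^sup>+s. ennreal (a * s powr (a - 1)) * indicator {s. 0 < s \<and> ennreal s < x} s \<partial>lborel)"
    (is "_ \<le> ?I") for n
  proof -
    have "ennreal (real n) = (\<integral>\<^sup>+s\<in>{0..real n powr (1/a)}. ennreal (a * s powr (a - 1)) \<partial>lborel)"
      using assms by (subst nn_integral_powr_Icc) (auto simp: powr_powr)
    also have "\<dots> \<le> ?I"
    proof (rule nn_integral_mono_AE)
      show "AE s in lborel. ennreal (a * s powr (a - 1)) * indicator {0..real n powr (1/a)} s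
         \<le> ennreal (a * s powr (a - 1)) * indicator {s. 0 < s \<and> ennreal s < x} s"
        using AE_lborel_singleton[of 0]
        by eventually_elim (use top in \<open>auto simp: indicator_def\<close>)
    qed
    finally show ?thesis .
  qed
  then have "?I = \<infinity>"
    by (metis ennreal_Ex_less_of_nat ennreal_of_nat_eq_real_of_nat infinity_ennreal_def leD top.not_eq_extremum)
  then show ?thesis using top by simp
qed

lemma distribution_fun_antimono:
  assumes "f \<in> borel_measurable M" "s \<le> t"
  shows "distribution_fun M f t \<le> distribution_fun M f s"
proof -
  have [measurable]: "f \<in> borel_measurable M" by fact
  have "(ereal s < z)" if "ereal t < z" for z
    using that assms by (meson ereal_less_eq(3) le_less_trans)
  then show ?thesis
    unfolding distribution_fun_def by (intro emeasure_mono) auto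
qed

lemma distribution_fun_measurable:
  assumes "f \<in> borel_measurable M"
  shows "distribution_fun M f \<in> borel_measurable borel"
  by (rule borel_measurable_antimono_ennreal) (rule distribution_fun_antimono[OF assms])

text \<open>
  The rearrangement is the generalized inverse of the distribution function.  The strict form
  needs the right continuity of the distribution function, that is, continuity of the measure from
  below along \<open>{\<bar>f\<bar> > s + 1 / n}\<close>.
\<close>

lemma less_rearrangement_iff:
  assumes [measurable]: "f \<in> borel_measurable M" and "0 \<le> s" "0 \<le> t"
  shows "ennreal s < rearrangement M f t \<longleftrightarrow> ennreal t < distribution_fun M f s"
proof
  assume "ennreal s < rearrangement M f t"
  show "ennreal t < distribution_fun M f s"
  proof (rule ccontr)
    assume "\<not> ?thesis"
    then have "rearrangement M f t \<le> ennreal s"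
      unfolding rearrangement_def using assms by (intro Inf_lower) auto
    then show False using \<open>ennreal s < _\<close> by simp
  qed
next
  assume t: "ennreal t < distribution_fun M f s"
  define A where "A n = {x \<in> space M. \<bar>f x\<bar> > ereal (s + 1 / real (Suc n))}" for n
  have "(\<Union>n. A n) = {x \<in> space M. \<bar>f x\<bar> > ereal s}"
  proof safe
    fix x n assume "x \<in> A n"
    then have "ereal (s + 1 / real (Suc n)) < \<bar>f x\<bar>" and "x \<in> space M" by (auto simp: A_def)
    then show "ereal s < \<bar>f x\<bar>" "x \<in> space M"
      by (auto elim!: le_less_trans[rotated])
  next
    fix x assume x: "x \<in> space M" "ereal s < \<bar>f x\<bar>"
    then obtain r where r: "ereal s < ereal r" "ereal r < \<bar>f x\<bar>" using ereal_dense2 by blast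
    then obtain n where "1 / real (Suc n) < r - s" using nat_approx_posE[of "r - s"]
      by (metis diff_gt_0_iff_gt less_ereal.simps(1))
    then have "ereal (s + 1 / real (Suc n)) < ereal r" by simp
    also have "\<dots> < \<bar>f x\<bar>" by (rule r)
    finally have "x \<in> A n" using x unfolding A_def by blast
    then show "x \<in> (\<Union>n. A n)" by auto
  qed
  moreover have "(SUP n. emeasure M (A n)) = emeasure M (\<Union>n. A n)"
  proof (rule SUP_emeasure_incseq)
    show "range A \<subseteq> sets M" unfolding A_def by auto
    show "incseq A"
    proof (intro incseq_SucI subsetI)
      fix n x assume "x \<in> A n"
      moreover have "ereal (s + 1 / real (Suc (Suc n))) \<le> ereal (s + 1 / real (Suc n))"
        by (simp add: field_simps)
      ultimately show "x \<in> A (Suc n)" unfolding A_def using le_less_trans by blast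
    qed
  qed
  ultimately have "distribution_fun M f s = (SUP n. emeasure M (A n))"
    by (simp add: distribution_fun_def)
  with t obtain n where "ennreal t < emeasure M (A n)" by (auto simp: less_SUP_iff)
  then have n: "ennreal t < distribution_fun M f (s + 1 / real (Suc n))"
    by (simp add: A_def distribution_fun_def)
  have "ennreal s < ennreal (s + 1 / real (Suc n))" using assms by (simp add: ennreal_less_iff)
  also have "\<dots> \<le> rearrangement M f t"
    unfolding rearrangement_def
  proof (rule Inf_greatest, safe)
    fix v assume "0 \<le> v" "distribution_fun M f v \<le> ennreal t"
    then have "\<not> v \<le> s + 1 / real (Suc n)"
      using n distribution_fun_antimono[OF assms(1), of v "s + 1 / real (Suc n)"] by fastforce
    then show "ennreal (s + 1 / real (Suc n)) \<le> ennreal v" by (simp add: ennreal_leI)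
  qed
  finally show "ennreal s < rearrangement M f t" .
qed

text \<open>
  For \<open>a = 0\<close> this is the \<open>q\<close>-th power of the Lorentz norm up to the factor \<open>p\<close>.  The lower limit
  \<open>a\<close> isolates the contribution of large values, which is what becomes small.
\<close>

definition lorentz_tail :: "'a measure \<Rightarrow> real \<Rightarrow> real \<Rightarrow> real \<Rightarrow> ('a \<Rightarrow> ereal) \<Rightarrow> ennreal" where
  "lorentz_tail M p q a f =
     (\<integral>\<^sup>+s\<in>{a<..}. ennreal (s powr (q - 1)) * ennpowr (distribution_fun M f s) (q / p) \<partial>lborel)"

text \<open>
  Both sides are integrals over the region \<open>{(t, s). t < \<mu>(\<bar>f\<bar> > s)}\<close>, which is also
  \<open>{(t, s). s < f\<^sup>*(t)}\<close>, of the density \<open>t powr (q / p - 1) * q * s powr (q - 1)\<close>; Tonelli's theorem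
  exchanges the order of integration.
\<close>

theorem lorentz_norm_eq:
  assumes f [measurable]: "f \<in> borel_measurable M" and p: "0 < p" and q: "0 < q"
  shows "lorentz_norm M p q f = ennpowr (ennreal p * lorentz_tail M p q 0 f) (1 / q)"
proof -
  define D where "D = distribution_fun M f"
  have [measurable]: "D \<in> borel_measurable borel" unfolding D_def using f by (rule distribution_fun_measurable)
  define \<theta> where "\<theta> = q / p"
  have \<theta>: "0 < \<theta>" using p q by (simp add: \<theta>_def)
  define k where "k t s = ennreal (t powr (\<theta> - 1)) * ennreal (q * s powr (q - 1))
     * indicator {z. 0 < snd z \<and> 0 < fst z \<and> ennreal (fst z) < D (snd z)} (t, s)" for t s
  have [measurable]: "(\<lambda>z. k (fst z) (snd z)) \<in> borel_measurable (lborel \<Otimes>\<^sub>M lborel)"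
    unfolding k_def by measurable
  have "(\<integral>\<^sup>+t\<in>{0<..}. ennpowr (ennreal (t powr (1 / p)) * rearrangement M f t) q
                             * ennreal (1 / t) \<partial>lborel) = (\<integral>\<^sup>+t. \<integral>\<^sup>+s. k t s \<partial>lborel \<partial>lborel)"
  proof (rule nn_integral_cong)
    fix t :: real
    show "ennpowr (ennreal (t powr (1 / p)) * rearrangement M f t) q * ennreal (1 / t) * indicator {0<..} t
        = (\<integral>\<^sup>+s. k t s \<partial>lborel)"
    proof (cases "0 < t")
      case True
      have "ennpowr (ennreal (t powr (1 / p))) q * ennreal (1 / t) = ennreal (t powr (\<theta> - 1))"
        using True by (simp add: ennpowr_ennreal powr_powr \<theta>_def powr_diff flip: ennreal_mult)
      then have "ennpowr (ennreal (t powr (1 / p)) * rearrangement M f t) q * ennreal (1 / t)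
        = ennreal (t powr (\<theta> - 1)) * ennpowr (rearrangement M f t) q"
        unfolding ennpowr_mult by (metis mult.assoc mult.commute)
      also have "\<dots> = (\<integral>\<^sup>+s. ennreal (t powr (\<theta> - 1)) * (ennreal (q * s powr (q - 1))
           * indicator {s. 0 < s \<and> ennreal s < rearrangement M f t} s) \<partial>lborel)"
        by (subst ennpowr_eq_nn_integral[OF q], subst nn_integral_cmult) auto
      also have "\<dots> = (\<integral>\<^sup>+s. k t s \<partial>lborel)"
        using True by (intro nn_integral_cong) (auto simp: k_def indicator_def less_rearrangement_iff D_def mult_ac)
      finally show ?thesis using True by simp
    qed (simp add: k_def)
  qed
  also have "\<dots> = (\<integral>\<^sup>+s. \<integral>\<^sup>+t. k t s \<partial>lborel \<partial>lborel)"
    by (rule lborel_pair.Fubini'[symmetric]) (simp add: case_prod_beta')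
  also have "\<dots> = (\<integral>\<^sup>+s. ennreal p * (ennreal (s powr (q - 1)) * ennpowr (D s) (q / p) * indicator {0<..} s) \<partial>lborel)"
  proof (rule nn_integral_cong)
    fix s :: real
    show "(\<integral>\<^sup>+t. k t s \<partial>lborel) = ennreal p * (ennreal (s powr (q - 1)) * ennpowr (D s) (q / p) * indicator {0<..} s)"
    proof (cases "0 < s")
      case True
      have "(\<integral>\<^sup>+t. k t s \<partial>lborel) = (\<integral>\<^sup>+t. ennreal (p * s powr (q - 1)) * (ennreal (\<theta> * t powr (\<theta> - 1))
           * indicator {t. 0 < t \<and> ennreal t < D s} t) \<partial>lborel)"
        using True p q
        by (intro nn_integral_cong) (auto simp: k_def indicator_def \<theta>_def mult_ac simp flip: ennreal_mult)
      also have "\<dots> = ennreal (p * s powr (q - 1)) * ennpowr (D s) \<theta>"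
        by (subst ennpowr_eq_nn_integral[OF \<theta>], subst nn_integral_cmult) auto
      finally show ?thesis using True p by (simp add: \<theta>_def ennreal_mult mult.assoc)
    qed (simp add: k_def)
  qed
  also have "\<dots> = ennreal p * lorentz_tail M p q 0 f"
    unfolding lorentz_tail_def D_def[symmetric] by (rule nn_integral_cmult) measurable
  finally show ?thesis unfolding lorentz_norm_def by simp
qed

section \<open>Tails of the Lorentz integral and the weak type inequality\<close>

text \<open>
  Hoelder's inequality with exponents \<open>1 / t\<close> and \<open>1 / (1 - t)\<close>, obtained from Young's
  inequality for the normalized sequences so that \<open>t = 1\<close> is included.
\<close>

lemma sum_powr_Holder:
  fixes x a :: "'i \<Rightarrow> real"
  assumes t: "0 < t" "t \<le> 1" and F: "finite F" and x: "\<And>i. i \<in> F \<Longrightarrow> 0 \<le> x i" and a: "\<And>i. i \<in> F \<Longrightarrow> 0 < a i"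
  shows "(\<Sum>i\<in>F. x i powr t * a i powr (1 - t)) \<le> (\<Sum>i\<in>F. x i) powr t * (\<Sum>i\<in>F. a i) powr (1 - t)"
proof (cases "(\<Sum>i\<in>F. x i) = 0 \<or> F = {}")
  case True
  then show ?thesis using x F t by (auto simp: sum_nonneg_eq_0_iff)
next
  case False
  define X A where "X = (\<Sum>i\<in>F. x i)" and "A = (\<Sum>i\<in>F. a i)"
  have X: "0 < X" using False x by (auto simp: X_def less_le sum_nonneg)
  have A: "0 < A" using False a F by (auto simp: A_def intro: sum_pos)
  have "(x i / X) powr t * (a i / A) powr (1 - t) \<le> t * (x i / X) + (1 - t) * (a i / A)" if "i \<in> F" for i
  proof (cases "x i = 0")
    case False
    then have "0 < x i" using x[OF that] by simp
    then show ?thesis using X A a[OF that] t by (intro Youngs_inequality_0) auto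
  qed (use X A a[OF that] t in auto)
  then have "(\<Sum>i\<in>F. (x i / X) powr t * (a i / A) powr (1 - t)) \<le> (\<Sum>i\<in>F. t * (x i / X) + (1 - t) * (a i / A))"
    by (rule sum_mono)
  also have "\<dots> = t * (X / X) + (1 - t) * (A / A)"
    unfolding sum.distrib sum_distrib_left[symmetric] sum_divide_distrib[symmetric] X_def A_def by simp
  also have "\<dots> = 1" using X A by simp
  also have "(\<Sum>i\<in>F. (x i / X) powr t * (a i / A) powr (1 - t)) = (\<Sum>i\<in>F. x i powr t * a i powr (1 - t)) / (X powr t * A powr (1 - t))"
    unfolding sum_divide_distrib using X A x a by (intro sum.cong) (auto simp: powr_divide less_imp_le)
  finally show ?thesis using X A by (simp add: pos_divide_le_eq X_def A_def)
qed

locale lorentz =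
  fixes M :: "'a measure" and p q :: real
  assumes p: "0 < p" and q: "1 \<le> q" and qp: "q \<le> p"
begin

abbreviation tail :: "real \<Rightarrow> ('a \<Rightarrow> ereal) \<Rightarrow> ennreal" where
  "tail \<equiv> lorentz_tail M p q"

lemma lorentz_tail_antimono:
  "a \<le> b \<Longrightarrow> tail b f \<le> tail a f"
  unfolding lorentz_tail_def by (intro nn_integral_mono) (auto simp: indicator_def)

lemma lorentz_integrand_measurable:
  assumes "f \<in> borel_measurable M"
  shows "(\<lambda>s. ennreal (s powr (q - 1)) * ennpowr (distribution_fun M f s) (q / p)) \<in> borel_measurable borel"
proof -
  have [measurable]: "distribution_fun M f \<in> borel_measurable borel"
    using assms by (rule distribution_fun_measurable)
  show ?thesis by measurable
qed

lemma lorentz_tail_scale: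
  assumes f: "f \<in> borel_measurable M" and c: "0 < c" and a: "0 \<le> a"
  shows "(\<integral>\<^sup>+s\<in>{c * a<..}. ennreal (s powr (q - 1)) * ennpowr (distribution_fun M f (s / c)) (q / p) \<partial>lborel)
    = ennreal (c powr q) * tail a f"
proof -
  note [measurable] = distribution_fun_measurable[OF f]
  have "(\<integral>\<^sup>+s\<in>{c * a<..}. ennreal (s powr (q - 1)) * ennpowr (distribution_fun M f (s / c)) (q / p) \<partial>lborel)
    = c * (\<integral>\<^sup>+s. ennreal ((0 + c * s) powr (q - 1)) * ennpowr (distribution_fun M f ((0 + c * s) / c)) (q / p)
        * indicator {c * a<..} (0 + c * s) \<partial>lborel)"
    using c by (subst nn_integral_real_affine[where c = c and t = 0]) auto
  also have "\<dots> = c * (\<integral>\<^sup>+s. ennreal (c powr (q - 1)) * (ennreal (s powr (q - 1)) * ennpowr (distribution_fun M f s) (q / p)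
        * indicator {a<..} s) \<partial>lborel)"
  proof (rule arg_cong[where f = "\<lambda>x. ennreal c * x"], rule nn_integral_cong)
    fix s show "ennreal ((0 + c * s) powr (q - 1)) * ennpowr (distribution_fun M f ((0 + c * s) / c)) (q / p)
        * indicator {c * a<..} (0 + c * s) = ennreal (c powr (q - 1)) * (ennreal (s powr (q - 1)) * ennpowr (distribution_fun M f s) (q / p)
        * indicator {a<..} s)"
      using c a by (cases "a < s") (simp_all add: powr_mult ennreal_mult mult.assoc)
  qed
  also have "\<dots> = c * (ennreal (c powr (q - 1)) * tail a f)"
    unfolding lorentz_tail_def by (subst nn_integral_cmult) (auto intro: lorentz_integrand_measurable f)
  also have "\<dots> = ennreal (c * c powr (q - 1)) * tail a f"
    using c by (simp add: ennreal_mult mult.assoc)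
  also have "c * c powr (q - 1) = c powr q" using c by (simp add: powr_diff)
  finally show ?thesis .
qed

lemma lorentz_tail_cmult_le:
  assumes "h \<in> borel_measurable M" "0 < c" "0 \<le> a"
    and "\<And>s. c * a < s \<Longrightarrow> distribution_fun M f s \<le> distribution_fun M h (s / c)"
  shows "tail (c * a) f \<le> ennreal (c powr q) * tail a h"
  unfolding lorentz_tail_scale[OF assms(1-3), symmetric]
  unfolding lorentz_tail_def using assms(4) p q
  by (intro nn_integral_mono) (auto simp: indicator_def intro!: mult_left_mono ennpowr_mono)

text \<open>
  The quasi-triangle inequality, in a form that keeps track of the lower limit of integration; it
  uses \<open>q \<le> p\<close> through the subadditivity of the power \<open>q / p\<close>.
\<close>

lemma lorentz_tail_add_le:
  assumes f1: "f1 \<in> borel_measurable M" and f2: "f2 \<in> borel_measurable M" and a: "0 \<le> a"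
    and D: "\<And>s. 2 * a < s \<Longrightarrow> distribution_fun M f s \<le> distribution_fun M f1 (s / 2) + distribution_fun M f2 (s / 2)"
  shows "tail (2 * a) f \<le> ennreal (2 powr q) * (tail a f1 + tail a f2)"
proof -
  note [measurable] = distribution_fun_measurable[OF f1] distribution_fun_measurable[OF f2]
  have "tail (2 * a) f \<le>
    (\<integral>\<^sup>+s. (ennreal (s powr (q - 1)) * ennpowr (distribution_fun M f1 (s / 2)) (q / p)) * indicator {2 * a<..} s
       + (ennreal (s powr (q - 1)) * ennpowr (distribution_fun M f2 (s / 2)) (q / p)) * indicator {2 * a<..} s \<partial>lborel)"
    unfolding lorentz_tail_def
  proof (rule nn_integral_mono)
    fix s
    show "ennreal (s powr (q - 1)) * ennpowr (distribution_fun M f s) (q / p) * indicator {2 * a<..} s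
      \<le> (ennreal (s powr (q - 1)) * ennpowr (distribution_fun M f1 (s / 2)) (q / p)) * indicator {2 * a<..} s
       + (ennreal (s powr (q - 1)) * ennpowr (distribution_fun M f2 (s / 2)) (q / p)) * indicator {2 * a<..} s"
    proof (cases "2 * a < s")
      case True
      have "ennpowr (distribution_fun M f s) (q / p)
          \<le> ennpowr (distribution_fun M f1 (s / 2) + distribution_fun M f2 (s / 2)) (q / p)"
        using D[OF True] p q by (intro ennpowr_mono) auto
      also have "\<dots> \<le> ennpowr (distribution_fun M f1 (s / 2)) (q / p) + ennpowr (distribution_fun M f2 (s / 2)) (q / p)"
        using p q qp by (intro ennpowr_add_le) auto
      finally show ?thesis using True by (simp add: mult_left_mono flip: distrib_left)
    qed auto
  qed
  also have "\<dots> = ennreal (2 powr q) * (tail a f1 + tail a f2)"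
    unfolding distrib_left
    unfolding lorentz_tail_scale[OF f1 zero_less_numeral a, symmetric] lorentz_tail_scale[OF f2 zero_less_numeral a, symmetric]
    by (rule nn_integral_add) measurable
  finally show ?thesis .
qed

lemma distribution_fun_add_le:
  assumes [measurable]: "f1 \<in> borel_measurable M" "f2 \<in> borel_measurable M"
    and le: "AE x in M. \<bar>f x\<bar> \<le> \<bar>f1 x\<bar> + \<bar>f2 x\<bar>"
  shows "distribution_fun M f s \<le> distribution_fun M f1 (s / 2) + distribution_fun M f2 (s / 2)"
proof -
  let ?A = "\<lambda>f s. {x \<in> space M. ereal s < \<bar>f x\<bar>}"
  have "emeasure M (?A f s) \<le> emeasure M (?A f1 (s / 2) \<union> ?A f2 (s / 2))"
  proof (rule emeasure_mono_AE)
    show "AE x in M. x \<in> ?A f s \<longrightarrow> x \<in> ?A f1 (s / 2) \<union> ?A f2 (s / 2)"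
      using le
    proof eventually_elim
      fix x assume le: "\<bar>f x\<bar> \<le> \<bar>f1 x\<bar> + \<bar>f2 x\<bar>"
      have "\<bar>f1 x\<bar> + \<bar>f2 x\<bar> \<le> ereal s" if "\<bar>f1 x\<bar> \<le> ereal (s / 2)" "\<bar>f2 x\<bar> \<le> ereal (s / 2)"
        using add_mono[OF that] by simp
      then show "x \<in> ?A f s \<longrightarrow> x \<in> ?A f1 (s / 2) \<union> ?A f2 (s / 2)"
        using le by fastforce
    qed
  qed measurable
  also have "\<dots> \<le> emeasure M (?A f1 (s / 2)) + emeasure M (?A f2 (s / 2))"
    by (rule emeasure_subadditive) measurable
  finally show ?thesis unfolding distribution_fun_def .
qed

text \<open>
  By monotone convergence.  In the final estimate, what is small about \<open>u\<close> and \<open>g\<close> comes from here.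
\<close>

lemma lorentz_tail_eventually_small:
  assumes f: "f \<in> borel_measurable M" and fin: "tail 0 f < \<infinity>" and e: "0 < e"
  shows "\<exists>a0. \<forall>a\<ge>a0. tail a f < e"
proof -
  define F where "F s = ennreal (s powr (q - 1)) * ennpowr (distribution_fun M f s) (q / p)" for s
  have [measurable]: "F \<in> borel_measurable borel"
    unfolding F_def by (rule lorentz_integrand_measurable[OF f])
  have "(INF n. \<integral>\<^sup>+s. F s * indicator {real n<..} s \<partial>lborel) = (\<integral>\<^sup>+s. (INF n. F s * indicator {real n<..} s) \<partial>lborel)"
  proof (rule nn_integral_monotone_convergence_INF_AE[symmetric])
    show "(\<integral>\<^sup>+ s. F s * indicator {real 0<..} s \<partial>lborel) < \<infinity>"
      using fin by (simp add: lorentz_tail_def F_def)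
  qed (auto simp: indicator_def)
  also have "(\<lambda>s. INF n. F s * indicator {real n<..} s) = (\<lambda>s. 0)"
  proof
    fix s
    obtain n where "s \<le> real n" using real_arch_simple by blast
    then have "(INF n. F s * indicator {real n<..} s) \<le> 0" by (intro INF_lower2[of n]) auto
    then show "(INF n. F s * indicator {real n<..} s) = 0" by simp
  qed
  finally have "(INF n. tail (real n) f) < e"
    using e by (simp add: lorentz_tail_def F_def)
  then obtain n where "tail (real n) f < e" by (auto simp: INF_less_iff)
  then show ?thesis
    by (intro exI[of _ "real n"]) (auto intro: le_less_trans[OF lorentz_tail_antimono])
qed

text \<open>
  Chebyshev's inequality.  Integrating only over \<open>l / 2 < s \<le> l\<close> bounds the distribution function at
  \<open>l\<close> by the tail from \<open>l / 2\<close> on, rather than by the full integral.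
\<close>

lemma distribution_fun_le_lorentz_tail:
  assumes f: "f \<in> borel_measurable M" and l: "0 < l"
  shows "ennreal (l powr q) * ennpowr (distribution_fun M f l) (q / p) \<le> ennreal (2 powr q) * tail (l / 2) f"
proof -
  have "ennreal ((l / 2) powr q) * ennpowr (distribution_fun M f l) (q / p)
     = (\<integral>\<^sup>+s. ennreal ((l / 2) powr (q - 1)) * ennpowr (distribution_fun M f l) (q / p) * indicator {l / 2<..l} s \<partial>lborel)"
  proof -
    have "ennreal ((l / 2) powr q) = ennreal ((l / 2) powr (q - 1)) * ennreal (l / 2)"
      using l by (simp add: powr_diff flip: ennreal_mult)
    moreover have "emeasure lborel {l / 2<..l} = ennreal (l / 2)" using l by simp
    ultimately show ?thesis by (subst nn_integral_cmult_indicator) (simp_all only: mult_ac, simp)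
  qed
  also have "\<dots> \<le> tail (l / 2) f"
    unfolding lorentz_tail_def using l p q
    by (intro nn_integral_mono)
       (auto simp: indicator_def intro!: mult_mono ennpowr_mono ennreal_leI powr_mono2 distribution_fun_antimono[OF f])
  finally have "ennreal (2 powr q) * (ennreal ((l / 2) powr q) * ennpowr (distribution_fun M f l) (q / p))
     \<le> ennreal (2 powr q) * tail (l / 2) f"
    by (rule mult_left_mono) simp
  moreover have "2 powr q * (l / 2) powr q = l powr q" using l by (simp flip: powr_mult)
  ultimately show ?thesis by (simp add: mult.assoc[symmetric] flip: ennreal_mult)
qed

text \<open>
  Used for functions that vanish outside a set of measure \<open>m\<close>: values below \<open>l\<close> contribute at most
  as much as the constant \<open>l\<close> on that set.
\<close>

lemma lorentz_tail_split:
  assumes f: "f \<in> borel_measurable M" and l: "0 \<le> l"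
    and m: "\<And>s. 0 < s \<Longrightarrow> distribution_fun M f s \<le> m"
  shows "tail 0 f \<le> ennreal (l powr q / q) * ennpowr m (q / p) + tail l f"
proof -
  define F where "F s = ennreal (s powr (q - 1)) * ennpowr (distribution_fun M f s) (q / p)" for s
  have [measurable]: "F \<in> borel_measurable borel"
    unfolding F_def by (rule lorentz_integrand_measurable[OF f])
  have "tail 0 f \<le> (\<integral>\<^sup>+s. (ennreal (1 / q) * ennpowr m (q / p)) * (ennreal (q * s powr (q - 1)) * indicator {0..l} s)
     + F s * indicator {l<..} s \<partial>lborel)"
    unfolding lorentz_tail_def F_def[symmetric]
  proof (intro nn_integral_mono)
    fix s :: real
    have "F s \<le> (ennreal (1 / q) * ennpowr m (q / p)) * ennreal (q * s powr (q - 1))" if "0 < s" "s \<le> l"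
    proof -
      have "F s \<le> ennreal (s powr (q - 1)) * ennpowr m (q / p)"
        unfolding F_def using that p q by (intro mult_left_mono ennpowr_mono m) auto
      also have "\<dots> = (ennreal (1 / q) * ennpowr m (q / p)) * ennreal (q * s powr (q - 1))"
      proof -
        have "ennreal (s powr (q - 1)) = ennreal (1 / q) * ennreal (q * s powr (q - 1))"
          using q by (simp flip: ennreal_mult)
        then show ?thesis by (simp only: mult_ac)
      qed
      finally show ?thesis .
    qed
    then show "F s * indicator {0<..} s \<le> (ennreal (1 / q) * ennpowr m (q / p)) * (ennreal (q * s powr (q - 1)) * indicator {0..l} s)
     + F s * indicator {l<..} s"
      by (auto simp: indicator_def)
  qed
  also have "\<dots> = (ennreal (1 / q) * ennpowr m (q / p)) * ennreal (l powr q) + tail l f"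
    unfolding lorentz_tail_def F_def[symmetric]
    using l q by (subst nn_integral_add) (auto simp: nn_integral_cmult nn_integral_powr_Icc)
  also have "(ennreal (1 / q) * ennpowr m (q / p)) * ennreal (l powr q) = ennreal (l powr q / q) * ennpowr m (q / p)"
    using q by (simp add: mult.assoc[symmetric] mult.commute flip: ennreal_mult)
  finally show ?thesis .
qed

text \<open>
  This replaces the weak type inequality for the maximal function.  Write \<open>\<theta> = q / p\<close>,
  \<open>a\<^sub>i = \<mu>(B\<^sub>i)\<close>, and \<open>d\<^sub>i(s)\<close> for the measure of the part of \<open>B\<^sub>i\<close> where \<open>\<bar>f\<bar> > s\<close>.  Values of \<open>f\<close> below
  \<open>l / 2\<close> account for at most half of the assumed lower bound \<open>l powr q * a\<^sub>i powr \<theta>\<close>, so the other half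
  is carried by \<open>s > l / 2\<close>.  Multiplying by \<open>a\<^sub>i powr (1 - \<theta>)\<close> makes the left-hand sides additive, and
  Hoelder's inequality bounds the sum of the integrands \<open>d\<^sub>i(s) powr \<theta> * a\<^sub>i powr (1 - \<theta>)\<close> by
  \<open>(\<Sum> d\<^sub>i(s)) powr \<theta> * (\<Sum> a\<^sub>i) powr (1 - \<theta>)\<close>; disjointness gives \<open>\<Sum> d\<^sub>i(s) \<le> \<mu>(\<bar>f\<bar> > s)\<close>.
\<close>

lemma weak_type_disjoint:
  assumes f [measurable]: "f \<in> borel_measurable M" and F: "finite F" and disj: "disjoint_family_on B F"
    and B [measurable]: "\<And>i. i \<in> F \<Longrightarrow> B i \<in> sets M"
    and pos: "\<And>i. i \<in> F \<Longrightarrow> 0 < emeasure M (B i)" and fin: "\<And>i. i \<in> F \<Longrightarrow> emeasure M (B i) < \<infinity>"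
    and l: "0 < l"
    and bad: "\<And>i. i \<in> F \<Longrightarrow> ennreal (l powr q) * ennpowr (emeasure M (B i)) (q / p)
       \<le> tail 0 (\<lambda>x. if x \<in> B i then f x else 0)"
  shows "ennreal (l powr q) * ennpowr (\<Sum>i\<in>F. emeasure M (B i)) (q / p) \<le> 2 * tail (l / 2) f"
proof (cases "F = {}")
  case False
  define h where "h i x = (if x \<in> B i then f x else 0)" for i x
  have h [measurable]: "h i \<in> borel_measurable M" if "i \<in> F" for i
    using B[OF that] f unfolding h_def by (intro measurable_If_set) auto
  define \<alpha> where "\<alpha> i = measure M (B i)" for i
  have \<alpha>: "emeasure M (B i) = ennreal (\<alpha> i)" "0 < \<alpha> i" if "i \<in> F" for i
  proof -
    show "emeasure M (B i) = ennreal (\<alpha> i)"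
      using fin[OF that] unfolding \<alpha>_def by (intro emeasure_eq_ennreal_measure) auto
    then show "0 < \<alpha> i" using pos[OF that] by simp
  qed
  define d where "d i s = enn2real (distribution_fun M (h i) s)" for i s
  have Dle: "distribution_fun M (h i) s \<le> emeasure M (B i)" if "i \<in> F" "0 \<le> s" for i s
    unfolding distribution_fun_def using B[OF that(1)] that by (intro emeasure_mono) (auto simp: h_def)
  have d: "distribution_fun M (h i) s = ennreal (d i s)" if "i \<in> F" "0 \<le> s" for i s
    using Dle[OF that] fin[OF that(1)] unfolding d_def by (metis ennreal_enn2real infinity_ennreal_def le_less_trans)
  have d0: "0 \<le> d i s" for i s unfolding d_def by simp
  define \<theta> where "\<theta> = q / p"
  have \<theta>: "0 < \<theta>" "\<theta> \<le> 1" using p q qp by (auto simp: \<theta>_def)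
  define A where "A = (\<Sum>i\<in>F. \<alpha> i)"
  have A: "0 < A" unfolding A_def using F False \<alpha> by (intro sum_pos) auto
  have sum_B: "(\<Sum>i\<in>F. emeasure M (B i)) = ennreal A"
    unfolding A_def by (subst sum_ennreal[symmetric]) (auto simp: \<alpha> less_imp_le)
  have single: "ennreal (l powr q / 2 * \<alpha> i) \<le>
      (\<integral>\<^sup>+s. ennreal (s powr (q - 1)) * (ennpowr (distribution_fun M (h i) s) \<theta> * ennreal (\<alpha> i powr (1 - \<theta>))) * indicator {l / 2<..} s \<partial>lborel)"
    if i: "i \<in> F" for i
  proof -
    \<comment> \<open>Half of the assumed lower bound for the energy on \<open>B i\<close>.\<close>
    define c where "c = l powr q / 2 * \<alpha> i powr \<theta>"
    have "(l / 2) powr q / q \<le> l powr q / 2"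
    proof -
      have "(l / 2) powr q / q \<le> (l / 2) powr q / 1" using q by (intro divide_left_mono) auto
      also have "\<dots> = l powr q / 2 powr q" using l by (simp add: powr_divide)
      also have "\<dots> \<le> l powr q / 2" using powr_mono[OF q, of 2] by (intro divide_left_mono) auto
      finally show ?thesis .
    qed
    then have "(l / 2) powr q / q * \<alpha> i powr \<theta> \<le> c"
      unfolding c_def by (rule mult_right_mono) simp
    moreover have "ennreal ((l / 2) powr q / q) * ennpowr (emeasure M (B i)) (q / p)
        = ennreal ((l / 2) powr q / q * \<alpha> i powr \<theta>)"
      unfolding \<alpha>(1)[OF i] \<theta>_def[symmetric] using \<alpha>(2)[OF i] q
      by (subst ennpowr_ennreal, simp, subst ennreal_mult) auto
    ultimately have "ennreal ((l / 2) powr q / q) * ennpowr (emeasure M (B i)) (q / p) \<le> ennreal c"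
      by (simp add: ennreal_leI)
    moreover have "ennreal (l powr q) * ennpowr (emeasure M (B i)) (q / p) = ennreal c + ennreal c"
      using \<alpha>[OF i] by (simp add: c_def ennpowr_ennreal \<theta>_def[symmetric] flip: ennreal_mult ennreal_plus)
    moreover have "tail 0 (h i) \<le>
         ennreal ((l / 2) powr q / q) * ennpowr (emeasure M (B i)) (q / p) + tail (l / 2) (h i)"
      using l i by (intro lorentz_tail_split h Dle) auto
    ultimately have "ennreal c + ennreal c \<le> ennreal c + tail (l / 2) (h i)"
      using bad[OF i] unfolding h_def[symmetric] by (metis add_right_mono order_trans)
    then have "ennreal c \<le> tail (l / 2) (h i)" by simp
    then have "ennreal c * ennreal (\<alpha> i powr (1 - \<theta>)) \<le> tail (l / 2) (h i) * ennreal (\<alpha> i powr (1 - \<theta>))"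
      by (rule mult_right_mono) simp
    moreover have "c * \<alpha> i powr (1 - \<theta>) = l powr q / 2 * \<alpha> i"
      using \<alpha>[OF i] by (simp add: c_def powr_diff)
    moreover have "tail (l / 2) (h i) * ennreal (\<alpha> i powr (1 - \<theta>)) =
      (\<integral>\<^sup>+s. ennreal (s powr (q - 1)) * (ennpowr (distribution_fun M (h i) s) \<theta> * ennreal (\<alpha> i powr (1 - \<theta>))) * indicator {l / 2<..} s \<partial>lborel)"
      unfolding lorentz_tail_def \<theta>_def[symmetric]
      using distribution_fun_measurable[OF h[OF i]]
      by (subst nn_integral_multc[symmetric]) (auto simp: mult_ac intro!: nn_integral_cong)
    moreover have "0 \<le> c" by (simp add: c_def)
    ultimately show ?thesis by (simp add: ennreal_mult[symmetric])
  qed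
  have DiM [measurable]: "distribution_fun M (h i) \<in> borel_measurable borel" if "i \<in> F" for i
    by (rule distribution_fun_measurable[OF h[OF that]])
  have DfM [measurable]: "distribution_fun M f \<in> borel_measurable borel" by (rule distribution_fun_measurable[OF f])
  have "ennreal (l powr q / 2 * A) = (\<Sum>i\<in>F. ennreal (l powr q / 2 * \<alpha> i))"
    unfolding A_def sum_distrib_left by (subst sum_ennreal) (auto simp: \<alpha>_def)
  also have "\<dots> \<le> (\<Sum>i\<in>F. \<integral>\<^sup>+s. ennreal (s powr (q - 1)) * (ennpowr (distribution_fun M (h i) s) \<theta> * ennreal (\<alpha> i powr (1 - \<theta>))) * indicator {l / 2<..} s \<partial>lborel)"
    by (rule sum_mono) (rule single)
  also have "\<dots> = (\<integral>\<^sup>+s. (\<Sum>i\<in>F. ennreal (s powr (q - 1)) * (ennpowr (distribution_fun M (h i) s) \<theta> * ennreal (\<alpha> i powr (1 - \<theta>))) * indicator {l / 2<..} s) \<partial>lborel)"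
    by (rule nn_integral_sum[symmetric]) measurable
  also have "\<dots> \<le> (\<integral>\<^sup>+s. ennreal (A powr (1 - \<theta>)) * (ennreal (s powr (q - 1)) * ennpowr (distribution_fun M f s) \<theta> * indicator {l / 2<..} s) \<partial>lborel)"
  proof (rule nn_integral_mono)
    fix s :: real
    show "(\<Sum>i\<in>F. ennreal (s powr (q - 1)) * (ennpowr (distribution_fun M (h i) s) \<theta> * ennreal (\<alpha> i powr (1 - \<theta>))) * indicator {l / 2<..} s)
      \<le> ennreal (A powr (1 - \<theta>)) * (ennreal (s powr (q - 1)) * ennpowr (distribution_fun M f s) \<theta> * indicator {l / 2<..} s)"
    proof (cases "l / 2 < s")
      case True
      then have s: "0 \<le> s" using l by simp
      have "(\<Sum>i\<in>F. distribution_fun M (h i) s) = (\<Sum>i\<in>F. emeasure M ({x \<in> space M. \<bar>f x\<bar> > ereal s} \<inter> B i))"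
      proof (rule sum.cong[OF refl])
        fix i assume i: "i \<in> F"
        have "{x \<in> space M. ereal s < \<bar>h i x\<bar>} = {x \<in> space M. \<bar>f x\<bar> > ereal s} \<inter> B i"
          using s by (auto simp: h_def split: if_splits)
        then show "distribution_fun M (h i) s = emeasure M ({x \<in> space M. \<bar>f x\<bar> > ereal s} \<inter> B i)"
          unfolding distribution_fun_def by simp
      qed
      also have "\<dots> = emeasure M (\<Union>i\<in>F. {x \<in> space M. \<bar>f x\<bar> > ereal s} \<inter> B i)"
        using F B disj by (intro sum_emeasure) (auto simp: disjoint_family_on_def)
      also have "\<dots> \<le> distribution_fun M f s"
        unfolding distribution_fun_def by (intro emeasure_mono) auto
      finally have sumD: "(\<Sum>i\<in>F. distribution_fun M (h i) s) \<le> distribution_fun M f s" .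
      have "(\<Sum>i\<in>F. ennpowr (distribution_fun M (h i) s) \<theta> * ennreal (\<alpha> i powr (1 - \<theta>)))
        = ennreal (\<Sum>i\<in>F. d i s powr \<theta> * \<alpha> i powr (1 - \<theta>))"
        using s d0 by (subst sum_ennreal[symmetric]) (auto simp: d ennpowr_ennreal ennreal_mult intro!: sum.cong)
      also have "\<dots> \<le> ennreal ((\<Sum>i\<in>F. d i s) powr \<theta> * A powr (1 - \<theta>))"
        unfolding A_def using \<theta> F d0 \<alpha> by (intro ennreal_leI sum_powr_Holder) auto
      also have "\<dots> = ennpowr (\<Sum>i\<in>F. distribution_fun M (h i) s) \<theta> * ennreal (A powr (1 - \<theta>))"
        using s d0 by (simp add: d sum_ennreal ennpowr_ennreal sum_nonneg ennreal_mult)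
      also have "\<dots> \<le> ennpowr (distribution_fun M f s) \<theta> * ennreal (A powr (1 - \<theta>))"
        by (intro mult_right_mono ennpowr_mono sumD \<theta>) auto
      finally have "ennreal (s powr (q - 1)) * (\<Sum>i\<in>F. ennpowr (distribution_fun M (h i) s) \<theta> * ennreal (\<alpha> i powr (1 - \<theta>))) \<le>
           ennreal (s powr (q - 1)) * (ennpowr (distribution_fun M f s) \<theta> * ennreal (A powr (1 - \<theta>)))"
        by (rule mult_left_mono) simp
      then show ?thesis using True by (simp add: sum_distrib_left mult_ac)
    qed simp
  qed
  also have "\<dots> = ennreal (A powr (1 - \<theta>)) * tail (l / 2) f"
    unfolding lorentz_tail_def \<theta>_def[symmetric] by (rule nn_integral_cmult) measurable
  finally have *: "ennreal (l powr q / 2 * A) \<le> ennreal (A powr (1 - \<theta>)) * tail (l / 2) f" .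
  have "ennreal (2 * A powr (\<theta> - 1)) * ennreal (l powr q / 2 * A)
      \<le> ennreal (2 * A powr (\<theta> - 1)) * (ennreal (A powr (1 - \<theta>)) * tail (l / 2) f)"
    by (rule mult_left_mono[OF *]) simp
  also have "\<dots> = ennreal (2 * (A powr (\<theta> - 1) * A powr (1 - \<theta>))) * tail (l / 2) f"
    using A by (simp add: mult.assoc[symmetric] flip: ennreal_mult)
  also have "2 * (A powr (\<theta> - 1) * A powr (1 - \<theta>)) = 2" using A by (simp flip: powr_add)
  also have "ennreal (2 * A powr (\<theta> - 1)) * ennreal (l powr q / 2 * A) = ennreal (l powr q * A powr \<theta>)"
    using A by (simp add: powr_diff flip: ennreal_mult)
  finally show ?thesis
    unfolding sum_B using A by (simp add: ennpowr_ennreal \<theta>_def ennreal_mult)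
qed simp

end

section \<open>Length of curves and the arc length parametrization\<close>

definition polygon_length :: "(real \<Rightarrow> 'a::metric_space) \<Rightarrow> real list \<Rightarrow> ennreal" where
  "polygon_length \<gamma> ts = (\<Sum>i<length ts - 1. ennreal (dist (\<gamma> (ts ! i)) (\<gamma> (ts ! Suc i))))"

lemma polygon_length_simps [simp]:
  "polygon_length \<gamma> [] = 0" "polygon_length \<gamma> [x] = 0"
  "polygon_length \<gamma> (x # y # zs) = ennreal (dist (\<gamma> x) (\<gamma> y)) + polygon_length \<gamma> (y # zs)"
  by (simp_all add: polygon_length_def sum.lessThan_Suc_shift del: sum.lessThan_Suc sum_ennreal)

lemma curve_length_on_eq:
  "curve_length_on \<gamma> a b = (SUP ts \<in> {ts. sorted ts \<and> set ts \<subseteq> {a..b}}. polygon_length \<gamma> ts)"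
  by (simp add: curve_length_on_def polygon_length_def)

lemma polygon_length_le_curve_length_on:
  "sorted ts \<Longrightarrow> set ts \<subseteq> {a..b} \<Longrightarrow> polygon_length \<gamma> ts \<le> curve_length_on \<gamma> a b"
  unfolding curve_length_on_eq by (rule SUP_upper) auto

lemma ennreal_dist_triangle: "ennreal (dist x z) \<le> ennreal (dist x y) + ennreal (dist y z)"
  by (simp add: dist_triangle flip: ennreal_plus)

lemma polygon_length_insert: "polygon_length \<gamma> (us @ vs) \<le> polygon_length \<gamma> (us @ x # vs)"
proof (induction us rule: induct_list012)
  case 1
  then show ?case by (cases vs) auto
next
  case (2 u)
  show ?case
  proof (cases vs)
    case (Cons v vs')
    have "ennreal (dist (\<gamma> u) (\<gamma> v)) + polygon_length \<gamma> vs \<le>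
       (ennreal (dist (\<gamma> u) (\<gamma> x)) + ennreal (dist (\<gamma> x) (\<gamma> v))) + polygon_length \<gamma> vs"
      by (intro add_right_mono ennreal_dist_triangle)
    then show ?thesis using Cons by (simp add: add.assoc)
  qed auto
qed (auto intro: add_left_mono)

lemma polygon_length_append2:
  "polygon_length \<gamma> (us @ x # y # vs) = polygon_length \<gamma> (us @ [x]) + ennreal (dist (\<gamma> x) (\<gamma> y)) + polygon_length \<gamma> (y # vs)"
  by (induction us rule: induct_list012) (auto simp: add.assoc)

lemma polygon_length_append_ge: "polygon_length \<gamma> us + polygon_length \<gamma> vs \<le> polygon_length \<gamma> (us @ vs)"
proof (induction us rule: induct_list012)
  case (2 u)
  then show ?case by (cases vs) auto
qed (auto simp: add.assoc intro: add_left_mono)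

text \<open>
  Cut the partition at the gap \<open>(s, t)\<close> and insert both of its endpoints.  With \<open>s = t\<close> this yields
  additivity of length; with a short gap around a given parameter it yields continuity of the length
  function.
\<close>

lemma polygon_length_avoiding_le:
  assumes ts: "sorted ts" "set ts \<subseteq> {a..b}" and ab: "a \<le> s" "s \<le> t" "t \<le> b"
    and avoid: "\<And>x. x \<in> set ts \<Longrightarrow> x \<le> s \<or> t \<le> x"
  shows "polygon_length \<gamma> ts \<le> curve_length_on \<gamma> a s + ennreal (dist (\<gamma> s) (\<gamma> t)) + curve_length_on \<gamma> t b"
proof -
  define us where "us = filter (\<lambda>x. x \<le> s) ts"
  define vs where "vs = filter (\<lambda>x. \<not> x \<le> s) ts"
  have "ts = us @ vs"
    unfolding us_def vs_def using ts(1)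
  proof (induction ts)
    case (Cons x xs)
    show ?case
    proof (cases "x \<le> s")
      case False
      then have "\<forall>y\<in>set xs. \<not> y \<le> s" using Cons.prems by auto
      then have "filter (\<lambda>x. x \<le> s) xs = []" "filter (\<lambda>x. \<not> x \<le> s) xs = xs"
        by (auto simp: filter_empty_conv filter_id_conv)
      then show ?thesis using False by simp
    qed (use Cons in simp)
  qed simp
  moreover have u: "sorted (us @ [s])" "set (us @ [s]) \<subseteq> {a..s}"
    using ts ab by (auto simp: us_def sorted_append sorted_wrt_filter)
  moreover have v: "sorted (t # vs)" "set (t # vs) \<subseteq> {t..b}"
  proof -
    have "t \<le> x \<and> x \<le> b" if "x \<in> set vs" for x
      using that ts(2) avoid[of x] by (auto simp: vs_def)
    then show "sorted (t # vs)" "set (t # vs) \<subseteq> {t..b}"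
      using ts(1) ab by (auto simp: vs_def sorted_wrt_filter)
  qed
  ultimately have "polygon_length \<gamma> ts \<le> polygon_length \<gamma> (us @ s # t # vs)"
    using polygon_length_insert[of \<gamma> us vs s] polygon_length_insert[of \<gamma> "us @ [s]" vs t] by auto
  also have "\<dots> = polygon_length \<gamma> (us @ [s]) + ennreal (dist (\<gamma> s) (\<gamma> t)) + polygon_length \<gamma> (t # vs)"
    by (rule polygon_length_append2)
  also have "\<dots> \<le> curve_length_on \<gamma> a s + ennreal (dist (\<gamma> s) (\<gamma> t)) + curve_length_on \<gamma> t b"
    by (intro add_mono polygon_length_le_curve_length_on u v order_refl)
  finally show ?thesis .
qed

lemma curve_length_on_superadditive:
  assumes "a \<le> s" "s \<le> t" "t \<le> b"
  shows "curve_length_on \<gamma> a s + curve_length_on \<gamma> t b \<le> curve_length_on \<gamma> a b"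
proof -
  define T where "T a b = {ts. sorted ts \<and> set ts \<subseteq> {a..b::real}}" for a b
  have T: "T a b \<noteq> {}" for a b unfolding T_def by (auto intro: exI[of _ "[]"])
  have "polygon_length \<gamma> ts + polygon_length \<gamma> us \<le> curve_length_on \<gamma> a b" if "ts \<in> T a s" "us \<in> T t b" for ts us
  proof -
    have "polygon_length \<gamma> (ts @ us) \<le> curve_length_on \<gamma> a b"
      using that assms by (intro polygon_length_le_curve_length_on) (fastforce simp: T_def sorted_append)+
    then show ?thesis using polygon_length_append_ge[of \<gamma> ts us] by (rule order_trans[rotated])
  qed
  then have "(SUP ts\<in>T a s. polygon_length \<gamma> ts) + polygon_length \<gamma> us \<le> curve_length_on \<gamma> a b" if "us \<in> T t b" for us
    using that T by (subst ennreal_SUP_add_left[symmetric]) (auto intro!: SUP_least)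
  then have "(SUP ts\<in>T a s. polygon_length \<gamma> ts) + (SUP us\<in>T t b. polygon_length \<gamma> us) \<le> curve_length_on \<gamma> a b"
    using T by (subst ennreal_SUP_add_right) (auto intro!: SUP_least)
  then show ?thesis unfolding curve_length_on_eq[of _ a s] curve_length_on_eq[of _ t b] T_def .
qed

lemma curve_length_on_additive:
  assumes "a \<le> s" "s \<le> b"
  shows "curve_length_on \<gamma> a b = curve_length_on \<gamma> a s + curve_length_on \<gamma> s b"
proof (rule antisym)
  show "curve_length_on \<gamma> a b \<le> curve_length_on \<gamma> a s + curve_length_on \<gamma> s b"
    unfolding curve_length_on_eq[of _ a b]
    using assms polygon_length_avoiding_le[of _ a b s s \<gamma>] by (intro SUP_least) fastforce
qed (use assms curve_length_on_superadditive[of a s s b \<gamma>] in simp)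

lemma dist_le_curve_length_on:
  assumes "a \<le> b" shows "ennreal (dist (\<gamma> a) (\<gamma> b)) \<le> curve_length_on \<gamma> a b"
  using polygon_length_le_curve_length_on[of "[a, b]" a b \<gamma>] assms by simp

text \<open>
  The analogue of \<open>subpath\<close> for curves in a metric space.
\<close>

definition subcurve :: "real \<Rightarrow> real \<Rightarrow> (real \<Rightarrow> 'a) \<Rightarrow> real \<Rightarrow> 'a" where
  "subcurve u v \<gamma> t = \<gamma> ((v - u) * t + u)"

definition length_upto :: "(real \<Rightarrow> 'a::metric_space) \<Rightarrow> real \<Rightarrow> real" where
  "length_upto \<gamma> t = enn2real (curve_length_on \<gamma> 0 t)"

context
  fixes \<gamma> :: "real \<Rightarrow> 'a::metric_space"
  assumes rect: "rectifiable \<gamma>"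
begin

lemma curve_length_on_finite:
  assumes "0 \<le> s" "s \<le> t" "t \<le> 1" shows "curve_length_on \<gamma> s t < top"
proof -
  have "curve_length_on \<gamma> s t \<le> curve_length \<gamma>"
    using assms curve_length_on_additive[of 0 s 1 \<gamma>] curve_length_on_additive[of s t 1 \<gamma>]
    by (auto intro: order_trans[OF _ add_increasing[of "curve_length_on \<gamma> 0 s"]])
  then show ?thesis using rect unfolding rectifiable_def by (auto intro: le_less_trans)
qed

lemma curve_length_on_eq_diff:
  assumes "0 \<le> s" "s \<le> t" "t \<le> 1"
  shows "curve_length_on \<gamma> s t = ennreal (length_upto \<gamma> t - length_upto \<gamma> s)" "length_upto \<gamma> s \<le> length_upto \<gamma> t"
proof -
  have "curve_length_on \<gamma> 0 t = curve_length_on \<gamma> 0 s + curve_length_on \<gamma> s t"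
    using assms by (intro curve_length_on_additive) auto
  moreover have "curve_length_on \<gamma> 0 s < top" "curve_length_on \<gamma> s t < top"
    using assms by (auto intro: curve_length_on_finite)
  ultimately have *: "length_upto \<gamma> t = length_upto \<gamma> s + enn2real (curve_length_on \<gamma> s t)"
    unfolding length_upto_def by (simp add: enn2real_plus)
  then show "curve_length_on \<gamma> s t = ennreal (length_upto \<gamma> t - length_upto \<gamma> s)"
    using \<open>curve_length_on \<gamma> s t < top\<close> by simp
  show "length_upto \<gamma> s \<le> length_upto \<gamma> t" using * by simp
qed

lemma length_upto_0 [simp]: "length_upto \<gamma> 0 = 0"
proof -
  have "polygon_length \<gamma> ts = 0" if "set ts \<subseteq> {0..0}" for ts
    using that by (induction ts rule: induct_list012) auto
  then have "curve_length_on \<gamma> 0 0 \<le> 0"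
    unfolding curve_length_on_eq by (intro SUP_least) auto
  then show ?thesis by (simp add: length_upto_def)
qed

lemma length_upto_nonneg: "0 \<le> length_upto \<gamma> t" by (simp add: length_upto_def)

lemma dist_le_length_upto:
  assumes "0 \<le> s" "s \<le> t" "t \<le> 1"
  shows "dist (\<gamma> s) (\<gamma> t) \<le> length_upto \<gamma> t - length_upto \<gamma> s"
  using dist_le_curve_length_on[OF assms(2), of \<gamma>] curve_length_on_eq_diff[OF assms] by simp

text \<open>
  Take an inscribed polygon whose length is within \<open>e / 2\<close> of that of the curve.  A short interval
  \<open>(a, b)\<close> with one end at \<open>t\<close> contains none of its vertices, so the polygon is at most
  \<open>dist (\<gamma> a) (\<gamma> b) < e / 2\<close> longer than the curve over the complement of that interval; hence the length
  over the interval is below \<open>e\<close>.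
\<close>

lemma continuous_length_upto: "continuous_on {0..1} (length_upto \<gamma>)"
  unfolding continuous_on_iff
proof (intro ballI allI impI)
  fix t e :: real assume t: "t \<in> {0..1}" and e: "0 < e"
  have "curve_length \<gamma> < top" using rect by (simp add: rectifiable_def)
  have "\<exists>ts. sorted ts \<and> set ts \<subseteq> {0..1} \<and> length_upto \<gamma> 1 - e / 2 < enn2real (polygon_length \<gamma> ts)
     \<and> polygon_length \<gamma> ts < top"
  proof (cases "length_upto \<gamma> 1 - e / 2 < 0")
    case True
    then show ?thesis by (intro exI[of _ "[]"]) auto
  next
    case False
    then have "ennreal (length_upto \<gamma> 1 - e / 2) < ennreal (length_upto \<gamma> 1)"
      using e by (simp add: ennreal_less_iff)
    also have "\<dots> = curve_length \<gamma>" using \<open>curve_length \<gamma> < top\<close> by (simp add: length_upto_def)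
    finally obtain ts where ts: "sorted ts" "set ts \<subseteq> {0..1}" "ennreal (length_upto \<gamma> 1 - e / 2) < polygon_length \<gamma> ts"
      unfolding curve_length_on_eq less_SUP_iff by auto
    have "polygon_length \<gamma> ts < top"
      using polygon_length_le_curve_length_on[OF ts(1,2), of \<gamma>] \<open>curve_length \<gamma> < top\<close> by (rule le_less_trans)
    moreover from this have "polygon_length \<gamma> ts = ennreal (enn2real (polygon_length \<gamma> ts))" by simp
    ultimately show ?thesis using ts False by (metis ennreal_less_iff not_less)
  qed
  then obtain ts where ts: "sorted ts" "set ts \<subseteq> {0..1}" "length_upto \<gamma> 1 - e / 2 < enn2real (polygon_length \<gamma> ts)"
    "polygon_length \<gamma> ts < top" by blast
  have "continuous_on {0..1} \<gamma>" using rect by (simp add: rectifiable_def path_def)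
  then obtain d1 where d1: "0 < d1" "\<And>t'. t' \<in> {0..1} \<Longrightarrow> dist t' t < d1 \<Longrightarrow> dist (\<gamma> t') (\<gamma> t) < e / 2"
    using t e unfolding continuous_on_iff by (metis half_gt_zero)
  obtain d2 where d2: "0 < d2" "\<And>x. x \<in> set ts \<Longrightarrow> x \<noteq> t \<Longrightarrow> d2 \<le> dist t x"
    using finite_set_avoid[of "set ts" t] by auto
  show "\<exists>d>0. \<forall>t'\<in>{0..1}. dist t' t < d \<longrightarrow> dist (length_upto \<gamma> t') (length_upto \<gamma> t) < e"
  proof (intro exI[of _ "min d1 d2"] conjI ballI impI)
    show "0 < min d1 d2" using d1 d2 by simp
    fix t' assume t': "t' \<in> {0..1}" "dist t' t < min d1 d2"
    have dist: "dist (\<gamma> t') (\<gamma> t) < e / 2" using d1 t' by simp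
    define a where "a = min t t'" define b where "b = max t t'"
    have ab: "0 \<le> a" "a \<le> b" "b \<le> 1" using t t' by (auto simp: a_def b_def)
    have avoid: "x \<le> a \<or> b \<le> x" if "x \<in> set ts" for x
      using d2(2)[OF that] t'(2) unfolding a_def b_def dist_real_def by (smt (verit))
    have "dist (\<gamma> a) (\<gamma> b) < e / 2" using dist by (auto simp: a_def b_def min_def max_def dist_commute)
    moreover have "polygon_length \<gamma> ts \<le> curve_length_on \<gamma> 0 a + ennreal (dist (\<gamma> a) (\<gamma> b)) + curve_length_on \<gamma> b 1"
      by (rule polygon_length_avoiding_le[OF ts(1,2) ab avoid])
    then have "polygon_length \<gamma> ts \<le> ennreal (length_upto \<gamma> a + dist (\<gamma> a) (\<gamma> b) + (length_upto \<gamma> 1 - length_upto \<gamma> b))"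
      using ab curve_length_on_eq_diff[of 0 a] curve_length_on_eq_diff[of b 1] by (simp add: length_upto_nonneg)
    then have "enn2real (polygon_length \<gamma> ts) \<le> length_upto \<gamma> a + dist (\<gamma> a) (\<gamma> b) + (length_upto \<gamma> 1 - length_upto \<gamma> b)"
      using ab curve_length_on_eq_diff[of b 1] by (intro enn2real_leI) (auto simp: length_upto_nonneg)
    ultimately have "length_upto \<gamma> b - length_upto \<gamma> a < e" using ts(3) by simp
    then show "dist (length_upto \<gamma> t') (length_upto \<gamma> t) < e"
      using curve_length_on_eq_diff(2)[OF ab] by (auto simp: a_def b_def min_def max_def dist_real_def split: if_splits)
  qed
qed

lemma curve_length_eq: "enn2real (curve_length \<gamma>) = length_upto \<gamma> 1"
  by (simp add: length_upto_def)

lemma ex_length_upto_eq: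
  assumes "0 \<le> u" "u \<le> v" "v \<le> 1" "length_upto \<gamma> u \<le> s" "s \<le> length_upto \<gamma> v"
  shows "\<exists>t. u \<le> t \<and> t \<le> v \<and> length_upto \<gamma> t = s"
  using assms by (intro IVT' continuous_on_subset[OF continuous_length_upto]) auto

lemma length_upto_eq_imp_eq:
  assumes "s \<in> {0..1}" "t \<in> {0..1}" "length_upto \<gamma> s = length_upto \<gamma> t"
  shows "\<gamma> s = \<gamma> t"
proof -
  have "dist (\<gamma> s) (\<gamma> t) \<le> 0"
  proof (cases "s \<le> t")
    case True
    then show ?thesis using dist_le_length_upto[of s t] assms(1,2) unfolding assms(3) by simp
  next
    case False
    then show ?thesis using dist_le_length_upto[of t s] assms(1,2) unfolding assms(3) by (simp add: dist_commute)
  qed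
  then show ?thesis by simp
qed

lemma arc_length_param_length_upto:
  assumes "t \<in> {0..1}" shows "arc_length_param \<gamma> (length_upto \<gamma> t) = \<gamma> t"
proof -
  let ?P = "\<lambda>t'. t' \<in> {0..1} \<and> curve_length_on \<gamma> 0 t' = ennreal (length_upto \<gamma> t)"
  have "?P t" using assms curve_length_on_eq_diff[of 0 t] by simp
  define e where "e = Eps ?P"
  have P: "?P e" unfolding e_def using \<open>?P t\<close> by (rule someI)
  then have "length_upto \<gamma> e = length_upto \<gamma> t"
    by (simp add: length_upto_def[of \<gamma> e] length_upto_nonneg)
  moreover have "e \<in> {0..1}" using P by (rule conjunct1)
  ultimately have "\<gamma> e = \<gamma> t" using assms by (intro length_upto_eq_imp_eq)
  then show ?thesis unfolding arc_length_param_def e_def .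
qed

lemma dist_arc_length_param_le:
  assumes "0 \<le> s" "s \<le> s'" "s' \<le> length_upto \<gamma> 1"
  shows "dist (arc_length_param \<gamma> s) (arc_length_param \<gamma> s') \<le> s' - s"
proof -
  obtain t' where t': "0 \<le> t'" "t' \<le> 1" "length_upto \<gamma> t' = s'" using ex_length_upto_eq[of 0 1 s'] assms by auto
  then obtain t where t: "0 \<le> t" "t \<le> t'" "length_upto \<gamma> t = s" using ex_length_upto_eq[of 0 t' s] assms by auto
  have "arc_length_param \<gamma> (length_upto \<gamma> t) = \<gamma> t" "arc_length_param \<gamma> (length_upto \<gamma> t') = \<gamma> t'"
    using t t' by (auto intro!: arc_length_param_length_upto)
  then show ?thesis
    using dist_le_length_upto[OF t(1,2) t'(2)] by (simp only: t(3) t'(3))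
qed

text \<open>
  Outside \<open>[0, length]\<close> the parametrization is an arbitrary choice, hence the clamped argument.  On
  that interval it is 1-Lipschitz.
\<close>

lemma arc_length_param_measurable:
  "(\<lambda>s. arc_length_param \<gamma> (max 0 (min s (length_upto \<gamma> 1)))) \<in> borel_measurable borel" (is "?f \<in> _")
proof (rule borel_measurable_continuous_onI)
  have le: "dist (?f s) (?f t) \<le> t - s" if "s \<le> t" for s t
  proof -
    let ?c = "\<lambda>s. max 0 (min s (length_upto \<gamma> 1))"
    have "dist (?f s) (?f t) \<le> ?c t - ?c s"
      using that length_upto_nonneg[of 1] by (intro dist_arc_length_param_le) auto
    also have "\<dots> \<le> t - s" using that by simp
    finally show ?thesis .
  qed
  have "dist (?f s) (?f t) \<le> dist s t" for s t
  proof (cases "s \<le> t")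
    case True
    then show ?thesis using le[of s t] by (simp add: dist_real_def)
  next
    case False
    then show ?thesis using le[of t s] by (simp add: dist_real_def dist_commute)
  qed
  then show "continuous_on UNIV ?f"
    unfolding continuous_on_iff by (intro ballI allI impI exI) (auto elim: le_less_trans[rotated])
qed

lemma nn_integral_arc_length_param_clamp:
  assumes "A \<subseteq> {0..length_upto \<gamma> 1}"
  shows "(\<integral>\<^sup>+s\<in>A. \<rho> (arc_length_param \<gamma> s) \<partial>lborel)
      = (\<integral>\<^sup>+s\<in>A. \<rho> (arc_length_param \<gamma> (max 0 (min s (length_upto \<gamma> 1)))) \<partial>lborel)"
proof (intro nn_integral_cong)
  fix s
  have "max 0 (min s (length_upto \<gamma> 1)) = s" if "s \<in> A" using that assms by auto
  then show "\<rho> (arc_length_param \<gamma> s) * indicator A s =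
      \<rho> (arc_length_param \<gamma> (max 0 (min s (length_upto \<gamma> 1)))) * indicator A s"
    by (cases "s \<in> A") simp_all
qed

lemma rectifiable_subcurve:
  assumes "0 \<le> u" "u < v" "v \<le> 1"
  shows "curve_length_on (subcurve u v \<gamma>) c d = curve_length_on \<gamma> ((v - u) * c + u) ((v - u) * d + u)"
    "rectifiable (subcurve u v \<gamma>)"
proof -
  define \<phi> where "\<phi> x = (v - u) * x + u" for x
  have pl: "polygon_length (subcurve u v \<gamma>) ts = polygon_length \<gamma> (map \<phi> ts)" for ts
    by (simp add: polygon_length_def subcurve_def \<phi>_def)
  have le: "\<phi> x \<le> \<phi> y \<longleftrightarrow> x \<le> y" for x y using assms by (auto simp: \<phi>_def mult_le_cancel_left)
  have inv: "\<phi> ((y - u) / (v - u)) = y" for y using assms by (simp add: \<phi>_def)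
  have *: "{us. sorted us \<and> set us \<subseteq> {\<phi> c..\<phi> d}} = map \<phi> ` {ts. sorted ts \<and> set ts \<subseteq> {c..d}}" for c d
  proof (intro equalityI subsetI)
    fix us assume us: "us \<in> {us. sorted us \<and> set us \<subseteq> {\<phi> c..\<phi> d}}"
    define ts where "ts = map (\<lambda>y. (y - u) / (v - u)) us"
    have "us = map \<phi> ts" by (simp add: ts_def inv o_def map_idI)
    moreover from this have "sorted ts" "set ts \<subseteq> {c..d}" using us by (auto simp: sorted_map le)
    ultimately show "us \<in> map \<phi> ` {ts. sorted ts \<and> set ts \<subseteq> {c..d}}" by blast
  next
    fix us assume "us \<in> map \<phi> ` {ts. sorted ts \<and> set ts \<subseteq> {c..d}}"
    then obtain ts where ts: "us = map \<phi> ts" "sorted ts" "set ts \<subseteq> {c..d}" by blast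
    have "\<phi> c \<le> \<phi> x \<and> \<phi> x \<le> \<phi> d" if "x \<in> set ts" for x
      using that ts(3) unfolding le by auto
    then show "us \<in> {us. sorted us \<and> set us \<subseteq> {\<phi> c..\<phi> d}}"
      using ts by (auto simp: sorted_map le)
  qed
  show L: "curve_length_on (subcurve u v \<gamma>) c d = curve_length_on \<gamma> ((v - u) * c + u) ((v - u) * d + u)" for c d
    unfolding curve_length_on_eq \<phi>_def[symmetric] * image_image pl ..
  have "path (subcurve u v \<gamma>)"
    unfolding path_def subcurve_def
  proof (rule continuous_on_compose2[of "{0..1}" \<gamma>])
    have "(v - u) * t + u \<le> v" if "0 \<le> t" "t \<le> 1" for t
    proof -
      have "(v - u) * t \<le> v - u" using that assms by (intro mult_left_le) auto
      then show ?thesis by linarith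
    qed
    then show "(\<lambda>x. (v - u) * x + u) ` {0..1} \<subseteq> {0..1}" using assms by fastforce
  qed (use rect in \<open>auto simp: rectifiable_def path_def intro!: continuous_intros\<close>)
  then show "rectifiable (subcurve u v \<gamma>)"
    unfolding rectifiable_def L using assms curve_length_on_finite[of u v] by simp
qed

text \<open>
  The arc length parametrization of a subcurve is a translate of that of the whole curve.
\<close>

lemma curve_integral_subcurve:
  assumes \<rho> [measurable]: "\<rho> \<in> borel_measurable borel" and uv: "0 \<le> u" "u < v" "v \<le> 1"
  shows "curve_integral (subcurve u v \<gamma>) \<rho> = (\<integral>\<^sup>+s\<in>{length_upto \<gamma> u..length_upto \<gamma> v}. \<rho> (arc_length_param \<gamma> s) \<partial>lborel)"
proof -
  let ?l = "length_upto \<gamma>"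
  have luv: "?l u \<le> ?l v" "?l v \<le> ?l 1" using curve_length_on_eq_diff uv by auto
  have len: "enn2real (curve_length (subcurve u v \<gamma>)) = ?l v - ?l u"
    using rectifiable_subcurve(1)[OF uv, of 0 1] curve_length_on_eq_diff[of u v] uv by simp
  have param: "arc_length_param (subcurve u v \<gamma>) s = arc_length_param \<gamma> (?l u + 1 * s)" if s: "0 \<le> s" "s \<le> ?l v - ?l u" for s
  proof -
    let ?P = "\<lambda>t. t \<in> {0..1} \<and> curve_length_on (subcurve u v \<gamma>) 0 t = ennreal s"
    obtain x where x: "u \<le> x" "x \<le> v" "?l x = ?l u + s" using ex_length_upto_eq[of u v "?l u + s"] s uv by auto
    have "?P ((x - u) / (v - u))"
      using rectifiable_subcurve(1)[OF uv, of 0 "(x - u) / (v - u)"] uv x curve_length_on_eq_diff[of u x] by simp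
    define e where "e = Eps ?P"
    have P: "?P e" unfolding e_def using \<open>?P ((x - u) / (v - u))\<close> by (rule someI)
    define y where "y = (v - u) * e + u"
    have "0 \<le> (v - u) * e" "(v - u) * e \<le> v - u" using P uv by (auto intro: mult_left_le)
    then have y: "u \<le> y" "y \<le> v" by (auto simp: y_def)
    have "curve_length_on \<gamma> u y = ennreal s"
      using P rectifiable_subcurve(1)[OF uv, of 0 e] by (simp add: y_def)
    then have "?l y = ?l u + s" using curve_length_on_eq_diff[of u y] y uv s by simp
    moreover have "arc_length_param (subcurve u v \<gamma>) s = \<gamma> y"
      unfolding arc_length_param_def e_def[symmetric] by (simp add: subcurve_def y_def)
    ultimately show ?thesis using arc_length_param_length_upto[of y] y uv by simp
  qed
  note [measurable] = arc_length_param_measurable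
  have "(\<integral>\<^sup>+s\<in>{?l u..?l v}. \<rho> (arc_length_param \<gamma> s) \<partial>lborel)
    = (\<integral>\<^sup>+s\<in>{?l u..?l v}. \<rho> (arc_length_param \<gamma> (max 0 (min s (?l 1)))) \<partial>lborel)"
    using luv length_upto_nonneg[of u] by (intro nn_integral_arc_length_param_clamp) auto
  also have "\<dots> = (\<integral>\<^sup>+s. \<rho> (arc_length_param \<gamma> (max 0 (min (?l u + 1 * s) (?l 1)))) * indicator {?l u..?l v} (?l u + 1 * s) \<partial>lborel)"
    by (subst nn_integral_real_affine[where c = 1 and t = "?l u"]) auto
  also have "\<dots> = (\<integral>\<^sup>+s\<in>{0..?l v - ?l u}. \<rho> (arc_length_param (subcurve u v \<gamma>) s) \<partial>lborel)"
  proof (intro nn_integral_cong)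
    fix s
    show "\<rho> (arc_length_param \<gamma> (max 0 (min (?l u + 1 * s) (?l 1)))) * indicator {?l u..?l v} (?l u + 1 * s)
       = \<rho> (arc_length_param (subcurve u v \<gamma>) s) * indicator {0..?l v - ?l u} s"
    proof (cases "s \<in> {0..?l v - ?l u}")
      case True
      then have "max 0 (min (?l u + 1 * s) (?l 1)) = ?l u + 1 * s" using luv length_upto_nonneg[of u] by auto
      then show ?thesis using True param[of s] by simp
    qed auto
  qed
  finally show ?thesis unfolding curve_integral_def len by simp
qed

lemma curve_integral_eq:
  "curve_integral \<gamma> \<rho> = (\<integral>\<^sup>+s\<in>{0..length_upto \<gamma> 1}. \<rho> (arc_length_param \<gamma> s) \<partial>lborel)"
  unfolding curve_integral_def curve_length_eq ..

end

section \<open>Increments along a curve, restricted to the complement of a zero set\<close>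

text \<open>
  If the increments of \<open>v\<close> are dominated by integrals of \<open>G\<close>, then \<open>v\<close> is continuous, so its zeros
  form a compact set.  Only the pieces before the first and after the last zero contribute to
  \<open>v 0 - v l\<close>, and there \<open>v \<noteq> 0\<close> up to two points.  No differentiation is involved.
\<close>

lemma nn_integral_increment_bound_off_zeros:
  fixes v :: "real \<Rightarrow> real" and G H :: "real \<Rightarrow> ennreal"
  assumes G [measurable]: "G \<in> borel_measurable borel" and l: "0 \<le> l"
    and fin: "(\<integral>\<^sup>+s\<in>{0..l}. G s \<partial>lborel) < \<infinity>"
    and inc: "\<And>s t. 0 \<le> s \<Longrightarrow> s \<le> t \<Longrightarrow> t \<le> l \<Longrightarrow> ennreal \<bar>v s - v t\<bar> \<le> (\<integral>\<^sup>+x\<in>{s..t}. G x \<partial>lborel)"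
    and H: "\<And>s. 0 \<le> s \<Longrightarrow> s \<le> l \<Longrightarrow> v s \<noteq> 0 \<Longrightarrow> G s \<le> H s"
  shows "ennreal \<bar>v 0 - v l\<bar> \<le> (\<integral>\<^sup>+s\<in>{0..l}. H s \<partial>lborel)"
proof -
  define R where "R x = enn2real (G x * indicator {0..l} x)" for x
  have [measurable]: "R \<in> borel_measurable borel" unfolding R_def by measurable
  have R0: "0 \<le> R x" for x by (simp add: R_def)
  have AEfin: "AE x in lborel. G x * indicator {0..l} x \<noteq> \<infinity>"
    using fin by (intro nn_integral_PInf_AE) auto
  then have AER: "AE x in lborel. ennreal (R x) = G x * indicator {0..l} x"
    by eventually_elim (simp add: R_def less_top)
  have Rint: "integrable lborel R"
  proof (rule integrableI_nonneg)
    have "(\<integral>\<^sup>+x. ennreal (R x) \<partial>lborel) = (\<integral>\<^sup>+s\<in>{0..l}. G s \<partial>lborel)"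
      by (rule nn_integral_cong_AE[OF AER])
    then show "(\<integral>\<^sup>+x. ennreal (R x) \<partial>lborel) < \<infinity>" using fin by simp
  qed (use R0 in auto)
  have set_int: "set_integrable lborel A R" if "A \<in> sets borel" for A
    unfolding set_integrable_def using Rint that by (intro integrable_mult_indicator) auto
  define I where "I t = integral {0..t} R" for t
  have R_on: "R integrable_on {a..b}" for a b
    using set_borel_integral_eq_integral(1)[OF set_int[of "{a..b}"]] by simp
  have contI: "continuous_on {0..l} I"
    unfolding I_def by (rule indefinite_integral_continuous_1[OF R_on])
  have nnI: "(\<integral>\<^sup>+x\<in>{s..t}. G x \<partial>lborel) = ennreal (I t - I s)" if st: "0 \<le> s" "s \<le> t" "t \<le> l" for s t
  proof -
    have "(\<integral>\<^sup>+x\<in>{s..t}. G x \<partial>lborel) = (\<integral>\<^sup>+x. ennreal (R x * indicator {s..t} x) \<partial>lborel)"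
    proof (rule nn_integral_cong_AE)
      show "AE x in lborel. G x * indicator {s..t} x = ennreal (R x * indicator {s..t} x)"
        using AER
      proof eventually_elim
        fix x assume x: "ennreal (R x) = G x * indicator {0..l} x"
        show "G x * indicator {s..t} x = ennreal (R x * indicator {s..t} x)"
          using x st by (cases "x \<in> {s..t}") simp_all
      qed
    qed
    also have "\<dots> = ennreal (\<integral>x. R x * indicator {s..t} x \<partial>lborel)"
      using set_int[of "{s..t}"] R0
      by (intro nn_integral_eq_integral) (auto simp: set_integrable_def mult.commute)
    also have "(\<integral>x. R x * indicator {s..t} x \<partial>lborel) = integral {s..t} R"
      using set_borel_integral_eq_integral(2)[OF set_int[of "{s..t}"]]
      by (simp add: set_lebesgue_integral_def mult.commute)
    also have "integral {s..t} R = I t - I s"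
      using Henstock_Kurzweil_Integration.integral_combine[OF st(1,2) R_on] by (simp add: I_def)
    finally show ?thesis .
  qed
  have Imono: "I s \<le> I t" if "0 \<le> s" "s \<le> t" for s t
    unfolding I_def using that R0 R_on by (intro integral_subset_le) auto
  have vI: "\<bar>v s - v t\<bar> \<le> \<bar>I s - I t\<bar>" if "s \<in> {0..l}" "t \<in> {0..l}" for s t
  proof (cases "s \<le> t")
    case True
    then show ?thesis using inc[of s t] nnI[of s t] Imono[of s t] that by (simp add: abs_minus_commute)
  next
    case False
    then show ?thesis using inc[of t s] nnI[of t s] Imono[of t s] that by (simp add: abs_minus_commute)
  qed
  have contv: "continuous_on {0..l} v"
    unfolding continuous_on_iff
  proof (intro ballI allI impI)
    fix t e :: real assume "t \<in> {0..l}" "0 < e"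
    then obtain d where d: "0 < d" "\<And>s. s \<in> {0..l} \<Longrightarrow> dist s t < d \<Longrightarrow> dist (I s) (I t) < e"
      using contI unfolding continuous_on_iff by meson
    show "\<exists>d>0. \<forall>s\<in>{0..l}. dist s t < d \<longrightarrow> dist (v s) (v t) < e"
      using d vI \<open>t \<in> {0..l}\<close> unfolding dist_real_def by (meson le_less_trans)
  qed
  define Z where "Z = {s \<in> {0..l}. v s = 0}"
  show ?thesis
  proof (cases "Z = {}")
    case True
    then have "v s \<noteq> 0" if "0 \<le> s" "s \<le> l" for s using that by (auto simp: Z_def)
    have "ennreal \<bar>v 0 - v l\<bar> \<le> (\<integral>\<^sup>+x\<in>{0..l}. G x \<partial>lborel)" using inc[of 0 l] l by simp
    also have "\<dots> \<le> (\<integral>\<^sup>+s\<in>{0..l}. H s \<partial>lborel)"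
    proof (rule nn_integral_mono)
      fix s show "G s * indicator {0..l} s \<le> H s * indicator {0..l} s"
        using H[of s] True by (cases "s \<in> {0..l}") (auto simp: Z_def)
    qed
    finally show ?thesis .
  next
    case False
    have "closed Z"
      unfolding Z_def by (rule continuous_closed_preimage_constant[OF contv]) simp
    moreover have "bounded Z" unfolding Z_def by (rule bounded_subset[of "{0..l}"]) auto
    ultimately have "compact Z" by (simp add: compact_eq_bounded_closed)
    obtain t1 where t1: "t1 \<in> Z" "\<And>t. t \<in> Z \<Longrightarrow> t1 \<le> t"
      using compact_attains_inf[OF \<open>compact Z\<close> False] by auto
    obtain t2 where t2: "t2 \<in> Z" "\<And>t. t \<in> Z \<Longrightarrow> t \<le> t2"
      using compact_attains_sup[OF \<open>compact Z\<close> False] by auto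
    have z: "v t1 = 0" "v t2 = 0" "0 \<le> t1" "t1 \<le> t2" "t2 \<le> l" using t1 t2 by (auto simp: Z_def)
    have "\<bar>v 0 - v l\<bar> \<le> \<bar>v 0 - v t1\<bar> + \<bar>v t2 - v l\<bar>" using z by simp
    then have "ennreal \<bar>v 0 - v l\<bar> \<le> ennreal \<bar>v 0 - v t1\<bar> + ennreal \<bar>v t2 - v l\<bar>"
      by (simp flip: ennreal_plus)
    also have "\<dots> \<le> (\<integral>\<^sup>+x\<in>{0..t1}. G x \<partial>lborel) + (\<integral>\<^sup>+x\<in>{t2..l}. G x \<partial>lborel)"
      using inc[of 0 t1] inc[of t2 l] z by (intro add_mono) auto
    also have "\<dots> = (\<integral>\<^sup>+x. G x * indicator {0..t1} x + G x * indicator {t2..l} x \<partial>lborel)"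
      by (rule nn_integral_add[symmetric]) auto
    also have "\<dots> \<le> (\<integral>\<^sup>+s\<in>{0..l}. H s \<partial>lborel)"
    proof (rule nn_integral_mono_AE)
      have "AE x in lborel. x \<noteq> t1 \<and> x \<noteq> t2" using AE_lborel_singleton by auto
      then show "AE x in lborel. G x * indicator {0..t1} x + G x * indicator {t2..l} x \<le> H x * indicator {0..l} x"
      proof eventually_elim
        fix x assume x: "x \<noteq> t1 \<and> x \<noteq> t2"
        have "v x \<noteq> 0" if "0 \<le> x \<and> x < t1 \<or> t2 < x \<and> x \<le> l"
          using that t1(2)[of x] t2(2)[of x] z by (auto simp: Z_def)
        then have "G x \<le> H x" if "0 \<le> x \<and> x < t1 \<or> t2 < x \<and> x \<le> l"
          using that H[of x] z by auto
        then show "G x * indicator {0..t1} x + G x * indicator {t2..l} x \<le> H x * indicator {0..l} x"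
          using x z by (auto simp: indicator_def)
      qed
    qed
    finally show ?thesis .
  qed
qed

lemma curve_integral_subcurve_le:
  assumes "rectifiable \<gamma>" "\<rho> \<in> borel_measurable borel" "0 \<le> u" "u < v" "v \<le> 1"
  shows "curve_integral (subcurve u v \<gamma>) \<rho> \<le> curve_integral \<gamma> \<rho>"
  unfolding curve_integral_subcurve[OF assms] curve_integral_eq[OF assms(1)]
  using assms curve_length_on_eq_diff(2)[OF assms(1), of v 1] length_upto_nonneg[OF assms(1), of u]
  by (intro nn_integral_mono) (auto simp: indicator_def)

lemma curve_integral_as_measurable:
  assumes "rectifiable \<gamma>"
  shows "curve_integral \<gamma> \<rho> = (\<integral>\<^sup>+s\<in>{0..length_upto \<gamma> 1}. \<rho> (arc_length_param \<gamma> (max 0 (min s (length_upto \<gamma> 1)))) \<partial>lborel)"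
  unfolding curve_integral_eq[OF assms] by (rule nn_integral_arc_length_param_clamp[OF assms]) simp

lemma curve_integral_add:
  assumes r: "rectifiable \<gamma>" and [measurable]: "\<rho>1 \<in> borel_measurable borel" "\<rho>2 \<in> borel_measurable borel"
  shows "curve_integral \<gamma> (\<lambda>x. \<rho>1 x + \<rho>2 x) = curve_integral \<gamma> \<rho>1 + curve_integral \<gamma> \<rho>2"
proof -
  note [measurable] = arc_length_param_measurable[OF r]
  show ?thesis
    unfolding curve_integral_as_measurable[OF r] distrib_right
    by (rule nn_integral_add) measurable
qed

lemma curve_integral_cmult:
  assumes r: "rectifiable \<gamma>" and [measurable]: "\<rho> \<in> borel_measurable borel"
  shows "curve_integral \<gamma> (\<lambda>x. c * \<rho> x) = c * curve_integral \<gamma> \<rho>"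
proof -
  note [measurable] = arc_length_param_measurable[OF r]
  show ?thesis
    unfolding curve_integral_as_measurable[OF r] mult.assoc
    by (rule nn_integral_cmult) measurable
qed

lemma curve_integral_const_ge:
  assumes r: "rectifiable \<gamma>" and "0 \<le> L"
  shows "ennreal (L * dist (\<gamma> 0) (\<gamma> 1)) \<le> curve_integral \<gamma> (\<lambda>x. ennreal L)"
proof -
  have "curve_integral \<gamma> (\<lambda>x. ennreal L) = ennreal L * ennreal (length_upto \<gamma> 1)"
    unfolding curve_integral_eq[OF r] using length_upto_nonneg[OF r, of 1] by (simp add: nn_integral_cmult_indicator)
  moreover have "dist (\<gamma> 0) (\<gamma> 1) \<le> length_upto \<gamma> 1"
    using dist_le_length_upto[OF r, of 0 1] r by simp
  ultimately show ?thesis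
    using assms length_upto_nonneg[OF r, of 1] by (simp add: ennreal_leI mult_left_mono flip: ennreal_mult)
qed

text \<open>
  Apply \<open>nn_integral_increment_bound_off_zeros\<close> to \<open>w\<close> composed with the arc length parametrization.
\<close>

lemma upper_gradient_on_curve_off_zeros:
  fixes w :: "'a::metric_space \<Rightarrow> real"
  assumes r: "rectifiable \<gamma>" and G [measurable]: "G \<in> borel_measurable borel"
    and fin: "curve_integral \<gamma> G < \<infinity>"
    and inc: "\<And>a b. 0 \<le> a \<Longrightarrow> a < b \<Longrightarrow> b \<le> 1 \<Longrightarrow> ennreal \<bar>w (\<gamma> a) - w (\<gamma> b)\<bar> \<le> curve_integral (subcurve a b \<gamma>) G"
    and H: "\<And>t. 0 \<le> t \<Longrightarrow> t \<le> 1 \<Longrightarrow> w (\<gamma> t) \<noteq> 0 \<Longrightarrow> G (\<gamma> t) \<le> H (\<gamma> t)"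
  shows "ennreal \<bar>w (\<gamma> 0) - w (\<gamma> 1)\<bar> \<le> curve_integral \<gamma> H"
proof -
  define l where "l = length_upto \<gamma> 1"
  define c where "c s = arc_length_param \<gamma> (max 0 (min s l))" for s
  have [measurable]: "c \<in> borel_measurable borel" unfolding c_def l_def by (rule arc_length_param_measurable[OF r])
  have c: "c (length_upto \<gamma> t) = \<gamma> t" if "0 \<le> t" "t \<le> 1" for t
  proof -
    have "max 0 (min (length_upto \<gamma> t) l) = length_upto \<gamma> t"
      using curve_length_on_eq_diff(2)[OF r, of t 1] that length_upto_nonneg[OF r, of t] by (simp add: l_def)
    then show ?thesis unfolding c_def using arc_length_param_length_upto[OF r, of t] that by simp
  qed
  have l0: "0 \<le> l" unfolding l_def by (rule length_upto_nonneg[OF r])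
  have "ennreal \<bar>w (c 0) - w (c l)\<bar> \<le> (\<integral>\<^sup>+s\<in>{0..l}. H (c s) \<partial>lborel)"
  proof (rule nn_integral_increment_bound_off_zeros[where v = "\<lambda>s. w (c s)" and G = "\<lambda>s. G (c s)"])
    show "(\<lambda>s. G (c s)) \<in> borel_measurable borel" by measurable
    show "(\<integral>\<^sup>+ s\<in>{0..l}. G (c s) \<partial>lborel) < \<infinity>"
      using fin unfolding curve_integral_as_measurable[OF r] c_def l_def .
  next
    fix s t assume st: "0 \<le> s" "s \<le> t" "t \<le> l"
    obtain b where b: "0 \<le> b" "b \<le> 1" "length_upto \<gamma> b = t"
      using ex_length_upto_eq[OF r, of 0 1 t] st r by (auto simp: l_def)
    obtain a where a: "0 \<le> a" "a \<le> b" "length_upto \<gamma> a = s"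
      using ex_length_upto_eq[OF r, of 0 b s] st r b by auto
    have "c s = \<gamma> a" "c t = \<gamma> b" using c[of a] c[of b] a b by auto
    show "ennreal \<bar>w (c s) - w (c t)\<bar> \<le> (\<integral>\<^sup>+ x\<in>{s..t}. G (c x) \<partial>lborel)"
    proof (cases "a = b")
      case False
      then have "ennreal \<bar>w (\<gamma> a) - w (\<gamma> b)\<bar> \<le> curve_integral (subcurve a b \<gamma>) G" using inc a b by auto
      also have "\<dots> = (\<integral>\<^sup>+ x\<in>{s..t}. G (arc_length_param \<gamma> x) \<partial>lborel)"
        using curve_integral_subcurve[OF r G, of a b] False a b by simp
      also have "\<dots> = (\<integral>\<^sup>+ x\<in>{s..t}. G (c x) \<partial>lborel)"
        unfolding c_def l_def using st by (intro nn_integral_arc_length_param_clamp[OF r]) (auto simp: l_def)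
      finally show ?thesis using \<open>c s = \<gamma> a\<close> \<open>c t = \<gamma> b\<close> by simp
    qed (use \<open>c s = \<gamma> a\<close> \<open>c t = \<gamma> b\<close> in simp)
  next
    fix s assume s: "0 \<le> s" "s \<le> l" "w (c s) \<noteq> 0"
    obtain b where b: "0 \<le> b" "b \<le> 1" "length_upto \<gamma> b = s"
      using ex_length_upto_eq[OF r, of 0 1 s] s r by (auto simp: l_def)
    then have "c s = \<gamma> b" using c[of b] by auto
    then show "G (c s) \<le> H (c s)" using H[of b] b s by auto
  qed (fact l0)
  moreover have "c 0 = \<gamma> 0" "c l = \<gamma> 1" using c[of 0] c[of 1] r by (auto simp: l_def)
  ultimately show ?thesis unfolding curve_integral_as_measurable[OF r] c_def l_def by simp
qed

section \<open>Families of modulus zero and weak upper gradients\<close>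

lemma (in lorentz) in_lorentz_space_iff:
  assumes "f \<in> borel_measurable M"
  shows "f \<in> lorentz_space M p q \<longleftrightarrow> tail 0 f < \<infinity>"
proof -
  have "0 < q" using q by simp
  then show ?thesis
    using assms p unfolding lorentz_space_def by (auto simp: lorentz_norm_eq ennreal_mult_less_top)
qed

text \<open>
  Densities and upper gradients take values in \<open>[0, \<infinity>]\<close> rather than in the extended reals.
\<close>

definition lorentz_energy :: "'a measure \<Rightarrow> real \<Rightarrow> real \<Rightarrow> ('a \<Rightarrow> ennreal) \<Rightarrow> ennreal" where
  "lorentz_energy M p q g = lorentz_tail M p q 0 (\<lambda>x. enn2ereal (g x))"

locale lorentz_metric = lorentz M p q for M :: "'a::metric_space measure" and p q :: real +
  assumes sets_M: "sets borel \<subseteq> sets M" and space_M: "space M = UNIV"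
begin

abbreviation energy :: "('a \<Rightarrow> ennreal) \<Rightarrow> ennreal" where
  "energy \<equiv> lorentz_energy M p q"

lemma measurable_M: "f \<in> borel_measurable borel \<Longrightarrow> f \<in> borel_measurable M"
  by (rule borel_measurable_subalgebra[OF sets_M]) (simp_all add: space_M)

lemma enn2ereal_measurable_M: "g \<in> borel_measurable borel \<Longrightarrow> (\<lambda>x. enn2ereal (g x)) \<in> borel_measurable M"
  by (rule measurable_M) measurable

lemma lorentz_energy_add_le:
  assumes "g \<in> borel_measurable borel" "h \<in> borel_measurable borel"
  shows "energy (\<lambda>x. g x + h x) \<le> ennreal (2 powr q) * (energy g + energy h)"
  unfolding lorentz_energy_def
  by (rule lorentz_tail_add_le[where a = 0, simplified])
     (auto simp: plus_ennreal.rep_eq intro!: enn2ereal_measurable_M distribution_fun_add_le assms)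

lemma distribution_fun_cmult:
  assumes "0 < c"
  shows "distribution_fun M (\<lambda>x. enn2ereal (ennreal c * g x)) s = distribution_fun M (\<lambda>x. enn2ereal (g x)) (s / c)"
proof -
  have "ereal s < enn2ereal (ennreal c * g x) \<longleftrightarrow> ereal (s / c) < enn2ereal (g x)" for x
    using assms by (cases "g x") (auto simp: ennreal_mult_top field_simps simp flip: ennreal_mult)
  then show ?thesis unfolding distribution_fun_def by simp
qed

lemma lorentz_tail_cmult:
  assumes "g \<in> borel_measurable borel" "0 < c" "0 \<le> a"
  shows "tail (c * a) (\<lambda>x. enn2ereal (ennreal c * g x)) \<le> ennreal (c powr q) * tail a (\<lambda>x. enn2ereal (g x))"
  using assms by (intro lorentz_tail_cmult_le enn2ereal_measurable_M) (auto simp: distribution_fun_cmult)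

lemma lorentz_energy_cmult:
  assumes "g \<in> borel_measurable borel" "0 < c"
  shows "energy (\<lambda>x. ennreal c * g x) \<le> ennreal (c powr q) * energy g"
  unfolding lorentz_energy_def using lorentz_tail_cmult[of g c 0] assms by simp

lemma in_weak_upper_gradients_iff:
  "g \<in> weak_upper_gradients M p q u \<longleftrightarrow> weak_upper_gradient M p q u g \<and> energy g < \<infinity>"
  unfolding weak_upper_gradients_def lorentz_energy_def
  using in_lorentz_space_iff enn2ereal_measurable_M by (auto simp: weak_upper_gradient_def)

lemma lorentz_norm_powr_eq:
  assumes "g \<in> borel_measurable borel"
  shows "ennpowr (lorentz_norm M p q (\<lambda>x. enn2ereal (g x))) a = ennpowr (ennreal p * energy g) (a / q)"
  using p q lorentz_norm_eq[OF enn2ereal_measurable_M[OF assms], of p q]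
  by (simp add: ennpowr_ennpowr lorentz_energy_def)

text \<open>
  Lets all statements about null families be checked by exhibiting admissible densities of small
  energy.
\<close>

lemma Mod_eq_0_iff:
  "Mod M p q \<Gamma> = 0 \<longleftrightarrow> (\<forall>e>0. \<exists>\<rho>\<in>admissible \<Gamma>. energy \<rho> < e)"
proof
  assume Mod: "Mod M p q \<Gamma> = 0"
  show "\<forall>e>0. \<exists>\<rho>\<in>admissible \<Gamma>. energy \<rho> < e"
  proof (intro allI impI)
    fix e :: ennreal assume e: "0 < e"
    define e' where "e' = ennpowr (ennreal p * min e 1) (p / q)"
    have "0 < e'" using e p by (auto simp: e'_def zero_less_iff_neq_zero min_def)
    then have "Mod M p q \<Gamma> < e'" using Mod by simp
    then obtain \<rho> where \<rho>: "\<rho> \<in> admissible \<Gamma>" "ennpowr (lorentz_norm M p q (\<lambda>x. enn2ereal (\<rho> x))) p < e'"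
      unfolding Mod_def by (auto simp: INF_less_iff)
    have [measurable]: "\<rho> \<in> borel_measurable borel" using \<rho>(1) by (simp add: admissible_def)
    have "\<not> e \<le> energy \<rho>"
    proof
      assume "e \<le> energy \<rho>"
      then have "e' \<le> ennpowr (ennreal p * energy \<rho>) (p / q)"
        unfolding e'_def using p q by (intro ennpowr_mono mult_left_mono) (auto intro: min.coboundedI1)
      then show False using \<rho>(2) lorentz_norm_powr_eq[of \<rho> p] by simp
    qed
    then show "\<exists>\<rho>\<in>admissible \<Gamma>. energy \<rho> < e" using \<rho>(1) by (auto simp: not_le)
  qed
next
  assume *: "\<forall>e>0. \<exists>\<rho>\<in>admissible \<Gamma>. energy \<rho> < e"
  show "Mod M p q \<Gamma> = 0"
  proof (rule ccontr)
    assume "Mod M p q \<Gamma> \<noteq> 0"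
    define e where "e = ennreal (1 / p) * ennpowr (Mod M p q \<Gamma>) (q / p)"
    have "0 < e" using p \<open>Mod M p q \<Gamma> \<noteq> 0\<close> by (auto simp: e_def zero_less_iff_neq_zero)
    then obtain \<rho> where \<rho>: "\<rho> \<in> admissible \<Gamma>" "energy \<rho> < e" using * by blast
    have [measurable]: "\<rho> \<in> borel_measurable borel" using \<rho>(1) by (simp add: admissible_def)
    have "ennreal p * energy \<rho> < ennreal p * e"
      using \<rho>(2) p by (intro ennreal_mult_strict_left_mono) auto
    also have "ennreal p * e = ennpowr (Mod M p q \<Gamma>) (q / p)"
      unfolding e_def using p by (simp add: mult.assoc[symmetric] flip: ennreal_mult)
    finally have "ennpowr (ennreal p * energy \<rho>) (p / q) < ennpowr (ennpowr (Mod M p q \<Gamma>) (q / p)) (p / q)"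
      using p q by (intro ennpowr_strict_mono) auto
    then have "ennpowr (lorentz_norm M p q (\<lambda>x. enn2ereal (\<rho> x))) p < Mod M p q \<Gamma>"
      using p q by (simp add: lorentz_norm_powr_eq ennpowr_ennpowr)
    moreover have "Mod M p q \<Gamma> \<le> ennpowr (lorentz_norm M p q (\<lambda>x. enn2ereal (\<rho> x))) p"
      unfolding Mod_def using \<rho>(1) by (rule INF_lower)
    ultimately show False by simp
  qed
qed

text \<open>
  Off this family, an upper gradient inequality that is valid off \<open>\<Gamma>\<close> holds on all subcurves
  simultaneously, with finite right-hand sides.
\<close>

definition exceptional_curves :: "(real \<Rightarrow> 'a) set \<Rightarrow> ('a \<Rightarrow> ennreal) \<Rightarrow> (real \<Rightarrow> 'a) set" where
  "exceptional_curves \<Gamma> g = {\<gamma> \<in> Gamma_rect. curve_integral \<gamma> g = \<infinity> \<or>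
     (\<exists>a b. 0 \<le> a \<and> a < b \<and> b \<le> 1 \<and> subcurve a b \<gamma> \<in> \<Gamma>)}"

text \<open>
  If \<open>\<rho>\<close> is admissible for \<open>\<Gamma>\<close>, then \<open>\<rho> + c g\<close> is admissible for the enlarged family for every \<open>c > 0\<close>:
  a curve having a subcurve in \<open>\<Gamma>\<close> already has \<open>\<rho>\<close>-length at least 1, and \<open>c g\<close> has infinite integral over the other
  curves.  Letting the energy of \<open>\<rho>\<close> and \<open>c\<close> tend to 0 gives the claim.
\<close>

lemma Mod_exceptional_curves:
  assumes \<Gamma>: "Mod M p q \<Gamma> = 0" and g [measurable]: "g \<in> borel_measurable borel" and fin: "energy g < \<infinity>"
  shows "Mod M p q (exceptional_curves \<Gamma> g) = 0"
  unfolding Mod_eq_0_iff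
proof (intro allI impI)
  fix e :: ennreal assume e: "0 < e"
  define K where "K = enn2real (energy g)"
  have K: "energy g = ennreal K" "0 \<le> K" using fin by (auto simp: K_def)
  obtain e1 where e1: "0 < e1" "ennreal e1 < e"
  proof (cases e)
    case (real x)
    then show ?thesis using that[of "x / 2"] e by (simp add: ennreal_less_iff)
  qed (use that[of 1] in simp)
  \<comment> \<open>The quasi-triangle inequality costs the factor \<open>2 powr q\<close>.\<close>
  define d where "d = e1 / (2 * 2 powr q)"
  have d: "0 < d" using e1 by (simp add: d_def)
  obtain \<rho> where \<rho>: "\<rho> \<in> admissible \<Gamma>" "energy \<rho> < ennreal d"
    using \<Gamma> d unfolding Mod_eq_0_iff by (metis ennreal_less_zero_iff)
  have [measurable]: "\<rho> \<in> borel_measurable borel" using \<rho>(1) by (simp add: admissible_def)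
  \<comment> \<open>Chosen so that \<open>c * g\<close> has energy at most \<open>d\<close>.\<close>
  define c where "c = (d / (K + 1)) powr (1 / q)"
  have c: "0 < c" "c powr q * K \<le> d"
  proof -
    show "0 < c" using d K by (simp add: c_def)
    have "c powr q * K = d * (K / (K + 1))" using d K q by (simp add: c_def powr_powr)
    also have "\<dots> \<le> d * 1" using d K by (intro mult_left_mono) auto
    finally show "c powr q * K \<le> d" by simp
  qed
  have "energy (\<lambda>x. \<rho> x + ennreal c * g x)
    \<le> ennreal (2 powr q) * (energy \<rho> + energy (\<lambda>x. ennreal c * g x))"
    by (rule lorentz_energy_add_le) measurable
  also have "energy (\<lambda>x. ennreal c * g x) \<le> ennreal (c powr q) * ennreal K"
    using lorentz_energy_cmult[OF g c(1)] K by simp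
  also have "\<dots> \<le> ennreal d" using c K by (simp add: ennreal_leI flip: ennreal_mult)
  also have "ennreal (2 powr q) * (energy \<rho> + ennreal d) \<le> ennreal (2 powr q) * (ennreal d + ennreal d)"
    using \<rho>(2) by (intro mult_left_mono add_right_mono) auto
  also have "\<dots> = ennreal (2 powr q * (d + d))" using d by (simp flip: ennreal_mult ennreal_plus)
  also have "2 powr q * (d + d) = e1" by (simp add: d_def field_simps)
  finally have "energy (\<lambda>x. \<rho> x + ennreal c * g x) < e"
    using e1 by (auto simp: add_left_mono mult_left_mono)
  moreover have "(\<lambda>x. \<rho> x + ennreal c * g x) \<in> admissible (exceptional_curves \<Gamma> g)"
    unfolding admissible_def
  proof (intro CollectI conjI ballI)
    fix \<gamma> assume \<gamma>: "\<gamma> \<in> exceptional_curves \<Gamma> g"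
    then have r: "rectifiable \<gamma>" by (auto simp: exceptional_curves_def Gamma_rect_def)
    have eq: "curve_integral \<gamma> (\<lambda>x. \<rho> x + ennreal c * g x) = curve_integral \<gamma> \<rho> + ennreal c * curve_integral \<gamma> g"
      using r by (subst curve_integral_add) (auto simp: curve_integral_cmult)
    consider "curve_integral \<gamma> g = \<infinity>" | a b where "0 \<le> a" "a < b" "b \<le> 1" "subcurve a b \<gamma> \<in> \<Gamma>"
      using \<gamma> by (auto simp: exceptional_curves_def)
    then show "1 \<le> curve_integral \<gamma> (\<lambda>x. \<rho> x + ennreal c * g x)"
    proof cases
      case 1
      then show ?thesis unfolding eq using c by (simp add: ennreal_mult_top)
    next
      case 2
      have "1 \<le> curve_integral (subcurve a b \<gamma>) \<rho>" using 2 \<rho>(1) by (auto simp: admissible_def)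
      also have "\<dots> \<le> curve_integral \<gamma> \<rho>" using 2 r by (intro curve_integral_subcurve_le) auto
      finally show ?thesis unfolding eq by (simp add: add_increasing2)
    qed
  qed measurable
  ultimately show "\<exists>\<rho>\<in>admissible (exceptional_curves \<Gamma> g). energy \<rho> < e" by blast
qed

end

text \<open>
  Finiteness of \<open>u\<close> along the curve: a point of a nonconstant curve is an endpoint of some subcurve
  with distinct endpoints, and on that subcurve \<open>g\<close> has finite integral.
\<close>

lemma curve_increment_bound_off_exceptional:
  assumes ug: "\<forall>\<gamma>\<in>Gamma_rect - \<Gamma>. upper_gradient_on_curve u g \<gamma>" and g: "g \<in> borel_measurable borel"
    and \<gamma>: "\<gamma> \<in> Gamma_rect" "curve_integral \<gamma> g < \<infinity>"
    and sub: "\<forall>a b. 0 \<le> a \<and> a < b \<and> b \<le> 1 \<longrightarrow> subcurve a b \<gamma> \<notin> \<Gamma>"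
  shows "\<And>t. t \<in> {0..1} \<Longrightarrow> u (\<gamma> t) = ereal (real_of_ereal (u (\<gamma> t)))"
    and "\<And>a b. 0 \<le> a \<Longrightarrow> a < b \<Longrightarrow> b \<le> 1 \<Longrightarrow>
      ennreal \<bar>real_of_ereal (u (\<gamma> a)) - real_of_ereal (u (\<gamma> b))\<bar> \<le> curve_integral (subcurve a b \<gamma>) g"
proof -
  have r: "rectifiable \<gamma>" using \<gamma> by (simp add: Gamma_rect_def)
  have ends: "subcurve a b \<gamma> 0 = \<gamma> a" "subcurve a b \<gamma> 1 = \<gamma> b" for a b by (auto simp: subcurve_def)
  have sub_ug: "\<bar>u (\<gamma> a)\<bar> \<noteq> \<infinity> \<and> \<bar>u (\<gamma> b)\<bar> \<noteq> \<infinity> \<and> e2ennreal \<bar>u (\<gamma> a) - u (\<gamma> b)\<bar> \<le> curve_integral (subcurve a b \<gamma>) g"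
    if ab: "0 \<le> a" "a < b" "b \<le> 1" and ne: "\<gamma> a \<noteq> \<gamma> b" for a b
  proof -
    have "\<not> subcurve a b \<gamma> constant_on {0..1}"
    proof
      assume "subcurve a b \<gamma> constant_on {0..1}"
      then have "subcurve a b \<gamma> 0 = subcurve a b \<gamma> 1" unfolding constant_on_def by fastforce
      then show False using ne ends by simp
    qed
    then have "subcurve a b \<gamma> \<in> Gamma_rect - \<Gamma>"
      using rectifiable_subcurve(2)[OF r ab] sub ab by (simp add: Gamma_rect_def)
    then have *: "upper_gradient_on_curve u g (subcurve a b \<gamma>)" using ug by blast
    have "curve_integral (subcurve a b \<gamma>) g < \<infinity>"
      using curve_integral_subcurve_le[OF r g ab] \<gamma>(2) by (rule le_less_trans)
    then show ?thesis
      using * unfolding upper_gradient_on_curve_def pathstart_def pathfinish_def ends by (auto split: if_splits)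
  qed
  show fin: "u (\<gamma> t) = ereal (real_of_ereal (u (\<gamma> t)))" if t: "t \<in> {0..1}" for t
  proof -
    have "\<exists>t'\<in>{0..1}. \<gamma> t' \<noteq> \<gamma> t"
      using \<gamma>(1) unfolding Gamma_rect_def constant_on_def by blast
    then obtain t' where t': "t' \<in> {0..1}" "\<gamma> t' \<noteq> \<gamma> t" by blast
    then consider "t < t'" | "t' < t" by (metis less_linear)
    then have "\<bar>u (\<gamma> t)\<bar> \<noteq> \<infinity>"
      using sub_ug[of t t'] sub_ug[of t' t] t t' by cases auto
    then show ?thesis by (simp add: ereal_real')
  qed
  show "ennreal \<bar>real_of_ereal (u (\<gamma> a)) - real_of_ereal (u (\<gamma> b))\<bar> \<le> curve_integral (subcurve a b \<gamma>) g"
    if ab: "0 \<le> a" "a < b" "b \<le> 1" for a b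
  proof (cases "\<gamma> a = \<gamma> b")
    case False
    have "e2ennreal \<bar>u (\<gamma> a) - u (\<gamma> b)\<bar> \<le> curve_integral (subcurve a b \<gamma>) g" using sub_ug[OF ab False] by simp
    moreover have "\<bar>u (\<gamma> a) - u (\<gamma> b)\<bar> = ereal \<bar>real_of_ereal (u (\<gamma> a)) - real_of_ereal (u (\<gamma> b))\<bar>"
      using ab by (subst (1 2) fin) auto
    ultimately show ?thesis by (simp add: e2ennreal_ereal)
  qed simp
qed

text \<open>
  Along an unexceptional curve the increments of \<open>u - f\<close> are dominated by integrals of \<open>g + L\<close>, and
  \<open>E\<close> is the set where \<open>u - f\<close> does not vanish.  The function \<open>f = u - (u - f)\<close> inherits a gradient that,
  unlike the constant \<open>L\<close>, belongs to the Lorentz space when \<open>E\<close> has finite measure.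
\<close>

lemma (in lorentz_metric) weak_upper_gradients_lipschitz_approximation:
  fixes f :: "'a \<Rightarrow> real"
  assumes ug: "weak_upper_gradient M p q u g" and fin: "energy g < \<infinity>"
    and f: "L-lipschitz_on UNIV f" and u [measurable]: "u \<in> borel_measurable borel"
  defines "E \<equiv> {x. u x \<noteq> ereal (f x)}"
  shows "weak_upper_gradient M p q (\<lambda>x. u x - ereal (f x)) (\<lambda>x. (g x + ennreal L) * indicator E x)"
    and "weak_upper_gradient M p q (\<lambda>x. ereal (f x)) (\<lambda>x. g x + (g x + ennreal L) * indicator E x)"
proof -
  have [measurable]: "f \<in> borel_measurable borel"
    using f lipschitz_on_continuous_on borel_measurable_continuous_onI by blast
  have g [measurable]: "g \<in> borel_measurable borel" using ug by (simp add: weak_upper_gradient_def)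
  have [measurable]: "E \<in> sets borel" unfolding E_def by measurable
  have L: "0 \<le> L" using f by (rule lipschitz_on_nonneg)
  obtain \<Gamma> where \<Gamma>: "Mod M p q \<Gamma> = 0" "\<forall>\<gamma>\<in>Gamma_rect - \<Gamma>. upper_gradient_on_curve u g \<gamma>"
    using ug by (auto simp: weak_upper_gradient_def almost_every_curve_def)
  have Mod0: "Mod M p q (exceptional_curves \<Gamma> g) = 0" by (rule Mod_exceptional_curves[OF \<Gamma>(1) g fin])
  have main: "\<bar>u (\<gamma> 0)\<bar> \<noteq> \<infinity> \<and> \<bar>u (\<gamma> 1)\<bar> \<noteq> \<infinity> \<and>
      e2ennreal \<bar>(u (\<gamma> 0) - ereal (f (\<gamma> 0))) - (u (\<gamma> 1) - ereal (f (\<gamma> 1)))\<bar> \<le> curve_integral \<gamma> (\<lambda>x. (g x + ennreal L) * indicator E x)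
    \<and> e2ennreal \<bar>ereal (f (\<gamma> 0)) - ereal (f (\<gamma> 1))\<bar> \<le> curve_integral \<gamma> (\<lambda>x. g x + (g x + ennreal L) * indicator E x)"
    if "\<gamma> \<in> Gamma_rect - exceptional_curves \<Gamma> g" for \<gamma>
  proof -
    have \<gamma>: "\<gamma> \<in> Gamma_rect" "curve_integral \<gamma> g < \<infinity>"
      "\<forall>a b. 0 \<le> a \<and> a < b \<and> b \<le> 1 \<longrightarrow> subcurve a b \<gamma> \<notin> \<Gamma>"
      using that by (auto simp: exceptional_curves_def less_top)
    have r: "rectifiable \<gamma>" using \<gamma> by (simp add: Gamma_rect_def)
    define U where "U x = real_of_ereal (u x)" for x
    note bound = curve_increment_bound_off_exceptional[OF \<Gamma>(2) g \<gamma>, folded U_def]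
    have inc: "ennreal \<bar>(U (\<gamma> a) - f (\<gamma> a)) - (U (\<gamma> b) - f (\<gamma> b))\<bar> \<le> curve_integral (subcurve a b \<gamma>) (\<lambda>x. g x + ennreal L)"
      if ab: "0 \<le> a" "a < b" "b \<le> 1" for a b
    proof -
      have rs: "rectifiable (subcurve a b \<gamma>)" by (rule rectifiable_subcurve(2)[OF r ab])
      have "\<bar>f (\<gamma> a) - f (\<gamma> b)\<bar> \<le> L * dist (\<gamma> a) (\<gamma> b)"
        using lipschitz_onD[OF f, of "\<gamma> a" "\<gamma> b"] by (simp add: dist_real_def)
      then have "ennreal \<bar>f (\<gamma> a) - f (\<gamma> b)\<bar> \<le> curve_integral (subcurve a b \<gamma>) (\<lambda>x. ennreal L)"
        using curve_integral_const_ge[OF rs L] by (auto simp: subcurve_def intro: order_trans[OF ennreal_leI])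
      moreover have "ennreal \<bar>U (\<gamma> a) - U (\<gamma> b)\<bar> \<le> curve_integral (subcurve a b \<gamma>) g" by (rule bound(2)[OF ab])
      moreover have "ennreal \<bar>(U (\<gamma> a) - f (\<gamma> a)) - (U (\<gamma> b) - f (\<gamma> b))\<bar> \<le> ennreal \<bar>U (\<gamma> a) - U (\<gamma> b)\<bar> + ennreal \<bar>f (\<gamma> a) - f (\<gamma> b)\<bar>"
        by (simp flip: ennreal_plus)
      ultimately show ?thesis
        using rs by (subst curve_integral_add) (auto intro: order_trans add_mono)
    qed
    have "curve_integral \<gamma> (\<lambda>x. ennreal L) < \<infinity>"
      unfolding curve_integral_eq[OF r] using length_upto_nonneg[OF r, of 1]
      by (simp add: nn_integral_cmult_indicator ennreal_mult_less_top)
    then have fin': "curve_integral \<gamma> (\<lambda>x. g x + ennreal L) < \<infinity>"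
      using r \<gamma>(2) by (subst curve_integral_add) auto
    have w: "ennreal \<bar>(U (\<gamma> 0) - f (\<gamma> 0)) - (U (\<gamma> 1) - f (\<gamma> 1))\<bar> \<le> curve_integral \<gamma> (\<lambda>x. (g x + ennreal L) * indicator E x)"
    proof (rule upper_gradient_on_curve_off_zeros[OF r _ fin' inc])
      fix t :: real assume t: "0 \<le> t" "t \<le> 1" "U (\<gamma> t) - f (\<gamma> t) \<noteq> 0"
      have "u (\<gamma> t) = ereal (U (\<gamma> t))" using bound(1) t by auto
      then have "\<gamma> t \<in> E" using t by (simp add: E_def)
      then show "g (\<gamma> t) + ennreal L \<le> (g (\<gamma> t) + ennreal L) * indicator E (\<gamma> t)" by simp
    qed auto
    have "subcurve 0 1 \<gamma> = \<gamma>" by (simp add: subcurve_def fun_eq_iff)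
    then have "ennreal \<bar>U (\<gamma> 0) - U (\<gamma> 1)\<bar> \<le> curve_integral \<gamma> g" using bound(2)[of 0 1] by simp
    with w have "ennreal \<bar>U (\<gamma> 0) - U (\<gamma> 1)\<bar> + ennreal \<bar>(U (\<gamma> 0) - f (\<gamma> 0)) - (U (\<gamma> 1) - f (\<gamma> 1))\<bar>
       \<le> curve_integral \<gamma> (\<lambda>x. g x + (g x + ennreal L) * indicator E x)"
      using r by (subst curve_integral_add) (auto intro: add_mono)
    moreover have "ennreal \<bar>f (\<gamma> 0) - f (\<gamma> 1)\<bar> \<le> ennreal \<bar>U (\<gamma> 0) - U (\<gamma> 1)\<bar> + ennreal \<bar>(U (\<gamma> 0) - f (\<gamma> 0)) - (U (\<gamma> 1) - f (\<gamma> 1))\<bar>"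
      by (simp flip: ennreal_plus)
    ultimately have "ennreal \<bar>f (\<gamma> 0) - f (\<gamma> 1)\<bar> \<le> curve_integral \<gamma> (\<lambda>x. g x + (g x + ennreal L) * indicator E x)"
      by (rule order_trans[rotated])
    moreover have "u (\<gamma> 0) = ereal (U (\<gamma> 0))" "u (\<gamma> 1) = ereal (U (\<gamma> 1))" using bound(1)[of 0] bound(1)[of 1] by auto
    ultimately show ?thesis using w by (simp add: e2ennreal_ereal)
  qed
  have 0: "\<exists>\<Gamma>'\<subseteq>Gamma_rect. Mod M p q \<Gamma>' = 0 \<and> (\<forall>\<gamma>\<in>Gamma_rect - \<Gamma>'. P \<gamma>)"
    if "\<And>\<gamma>. \<gamma> \<in> Gamma_rect - exceptional_curves \<Gamma> g \<Longrightarrow> P \<gamma>" for P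
    using that Mod0 by (intro exI[of _ "exceptional_curves \<Gamma> g"]) (auto simp: exceptional_curves_def)
  show "weak_upper_gradient M p q (\<lambda>x. u x - ereal (f x)) (\<lambda>x. (g x + ennreal L) * indicator E x)"
    unfolding weak_upper_gradient_def almost_every_curve_def
  proof (intro conjI 0)
    fix \<gamma> assume "\<gamma> \<in> Gamma_rect - exceptional_curves \<Gamma> g"
    from main[OF this] show "upper_gradient_on_curve (\<lambda>x. u x - ereal (f x)) (\<lambda>x. (g x + ennreal L) * indicator E x) \<gamma>"
      unfolding upper_gradient_on_curve_def pathstart_def pathfinish_def
      by (auto simp: minus_ereal_def)
  qed measurable
  show "weak_upper_gradient M p q (\<lambda>x. ereal (f x)) (\<lambda>x. g x + (g x + ennreal L) * indicator E x)"
    unfolding weak_upper_gradient_def almost_every_curve_def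
  proof (intro conjI 0)
    fix \<gamma> assume "\<gamma> \<in> Gamma_rect - exceptional_curves \<Gamma> g"
    from main[OF this] show "upper_gradient_on_curve (\<lambda>x. ereal (f x)) (\<lambda>x. g x + (g x + ennreal L) * indicator E x) \<gamma>"
      unfolding upper_gradient_on_curve_def pathstart_def pathfinish_def by auto
  qed measurable
qed

definition truncate :: "real \<Rightarrow> ereal \<Rightarrow> real" where
  "truncate k x = real_of_ereal (max (ereal (- k)) (min (ereal k) x))"

lemma measurable_truncate [measurable]: "truncate k \<in> borel_measurable borel"
  unfolding truncate_def by measurable

lemma truncate_ereal: "truncate k (ereal r) = max (- k) (min k r)"
  by (simp add: truncate_def flip: ereal_min ereal_max)

lemma abs_truncate_le: "0 \<le> k \<Longrightarrow> \<bar>truncate k x\<bar> \<le> k"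
proof (cases x)
  case (real r)
  then show "0 \<le> k \<Longrightarrow> \<bar>truncate k x\<bar> \<le> k" by (simp add: truncate_ereal)
qed (auto simp: truncate_def)

lemma truncate_eq: "\<bar>x\<bar> \<le> ereal k \<Longrightarrow> ereal (truncate k x) = x"
  by (cases x) (auto simp: truncate_ereal)

text \<open>
  The Poincare inequality is about genuine upper gradients.  A truncated function oscillates by at
  most \<open>2 * k\<close>, so \<open>2 * k * \<rho>\<close> takes care of all exceptional curves at once, for any single \<open>\<rho>\<close> admissible
  for them.
\<close>

lemma upper_gradient_truncate:
  assumes ug: "\<forall>\<gamma>\<in>Gamma_rect - \<Gamma>. upper_gradient_on_curve u g \<gamma>" and \<rho>: "\<rho> \<in> admissible \<Gamma>"
    and g [measurable]: "g \<in> borel_measurable borel" and k: "0 \<le> k"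
  shows "upper_gradient (\<lambda>x. ereal (truncate k (u x))) (\<lambda>x. g x + ennreal (2 * k) * \<rho> x)"
  unfolding upper_gradient_def
proof (intro conjI allI impI)
  have [measurable]: "\<rho> \<in> borel_measurable borel" using \<rho> by (simp add: admissible_def)
  show "(\<lambda>x. g x + ennreal (2 * k) * \<rho> x) \<in> borel_measurable borel" by measurable
  fix \<gamma> :: "real \<Rightarrow> 'a" assume r: "rectifiable \<gamma>"
  let ?T = "\<lambda>x. truncate k (u x)"
  have eq: "curve_integral \<gamma> (\<lambda>x. g x + ennreal (2 * k) * \<rho> x) = curve_integral \<gamma> g + ennreal (2 * k) * curve_integral \<gamma> \<rho>"
    using r by (subst curve_integral_add) (auto simp: curve_integral_cmult)
  have "ennreal \<bar>?T (\<gamma> 0) - ?T (\<gamma> 1)\<bar> \<le> curve_integral \<gamma> g + ennreal (2 * k) * curve_integral \<gamma> \<rho>"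
  proof (cases "\<gamma> constant_on {0..1}")
    case True
    then have "\<gamma> 0 = \<gamma> 1" unfolding constant_on_def by fastforce
    then show ?thesis by simp
  next
    case False
    show ?thesis
    proof (cases "\<gamma> \<in> \<Gamma>")
      case True
      have "ennreal \<bar>?T (\<gamma> 0) - ?T (\<gamma> 1)\<bar> \<le> ennreal (2 * k) * 1"
        using abs_truncate_le[OF k, of "u (\<gamma> 0)"] abs_truncate_le[OF k, of "u (\<gamma> 1)"] by (auto intro!: ennreal_leI)
      also have "\<dots> \<le> ennreal (2 * k) * curve_integral \<gamma> \<rho>"
        using True \<rho> by (intro mult_left_mono) (auto simp: admissible_def)
      finally show ?thesis by (simp add: add_increasing)
    next
      assume "\<gamma> \<notin> \<Gamma>"
      then have *: "upper_gradient_on_curve u g \<gamma>" using ug False r by (auto simp: Gamma_rect_def)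
      have "ennreal \<bar>?T (\<gamma> 0) - ?T (\<gamma> 1)\<bar> \<le> curve_integral \<gamma> g"
      proof (cases "\<bar>u (\<gamma> 0)\<bar> \<noteq> \<infinity> \<and> \<bar>u (\<gamma> 1)\<bar> \<noteq> \<infinity>")
        case True
        then obtain a b where ab: "u (\<gamma> 0) = ereal a" "u (\<gamma> 1) = ereal b" by auto
        then have "ennreal \<bar>a - b\<bar> \<le> curve_integral \<gamma> g"
          using * by (simp add: upper_gradient_on_curve_def pathstart_def pathfinish_def e2ennreal_ereal)
        moreover have "\<bar>?T (\<gamma> 0) - ?T (\<gamma> 1)\<bar> \<le> \<bar>a - b\<bar>"
          unfolding ab truncate_ereal by (auto simp: max_def min_def)
        ultimately show ?thesis by (auto intro: order_trans[OF ennreal_leI])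
      next
        case False
        then have "curve_integral \<gamma> g = \<infinity>"
          using * by (auto simp: upper_gradient_on_curve_def pathstart_def pathfinish_def split: if_splits)
        then show ?thesis by simp
      qed
      then show ?thesis by (simp add: add_increasing2)
    qed
  qed
  then show "upper_gradient_on_curve (\<lambda>x. ereal (truncate k (u x))) (\<lambda>x. g x + ennreal (2 * k) * \<rho> x) \<gamma>"
    unfolding upper_gradient_on_curve_def eq pathstart_def pathfinish_def by (simp add: e2ennreal_ereal)
qed

section \<open>A covering lemma of Vitali type\<close>

text \<open>
  Zorn's lemma is applied to the disjoint subfamilies that are greedy in the sense that a ball
  meeting the subfamily meets a member of at least half its radius.  If balls were left over that
  meet no member of a maximal such family, one whose radius exceeds half the supremum of their radii
  could be added.
\<close>

lemma vitali_disjoint_selection: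
  fixes r :: "'a::metric_space \<Rightarrow> real"
  assumes r: "\<And>x. x \<in> K \<Longrightarrow> 0 < r x \<and> r x \<le> R"
  obtains C where "C \<subseteq> K" "disjoint_family_on (\<lambda>x. ball x (r x)) C" "K \<subseteq> (\<Union>x\<in>C. ball x (5 * r x))"
proof -
  define meet where "meet x y \<longleftrightarrow> ball x (r x) \<inter> ball y (r y) \<noteq> {}" for x y
  \<comment> \<open>The greedy disjoint subfamilies.\<close>
  define \<Omega> where "\<Omega> = {C. C \<subseteq> K \<and> disjoint_family_on (\<lambda>x. ball x (r x)) C \<and>
     (\<forall>x\<in>K. (\<exists>y\<in>C. meet x y) \<longrightarrow> (\<exists>y\<in>C. meet x y \<and> r x \<le> 2 * r y))}"
  have "\<exists>C\<in>\<Omega>. \<forall>X\<in>\<Omega>. C \<subseteq> X \<longrightarrow> X = C"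
  proof (rule subset_Zorn')
    fix \<C> assume chain: "subset.chain \<Omega> \<C>"
    then have sub: "\<C> \<subseteq> \<Omega>" and lin: "\<And>X Y. X \<in> \<C> \<Longrightarrow> Y \<in> \<C> \<Longrightarrow> X \<subseteq> Y \<or> Y \<subseteq> X"
      by (auto simp: subset.chain_def subset_chain_def)
    have "disjoint_family_on (\<lambda>x. ball x (r x)) (\<Union>\<C>)"
      unfolding disjoint_family_on_def
    proof (intro ballI impI)
      fix x y assume "x \<in> \<Union>\<C>" "y \<in> \<Union>\<C>" "x \<noteq> y"
      then obtain X where "X \<in> \<C>" "x \<in> X" "y \<in> X" using lin by blast
      then show "ball x (r x) \<inter> ball y (r y) = {}"
        using sub \<open>x \<noteq> y\<close> unfolding \<Omega>_def disjoint_family_on_def by blast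
    qed
    moreover have "\<Union>\<C> \<subseteq> K" using sub by (auto simp: \<Omega>_def)
    moreover have "\<exists>y\<in>\<Union>\<C>. meet x y \<and> r x \<le> 2 * r y" if "x \<in> K" "y \<in> \<Union>\<C>" "meet x y" for x y
    proof -
      obtain X where X: "X \<in> \<C>" "y \<in> X" using \<open>y \<in> \<Union>\<C>\<close> by blast
      then have "X \<in> \<Omega>" using sub by blast
      then have "\<exists>y\<in>X. meet x y \<and> r x \<le> 2 * r y" using X that unfolding \<Omega>_def by blast
      then show ?thesis using X by blast
    qed
    ultimately show "\<Union>\<C> \<in> \<Omega>" unfolding \<Omega>_def by blast
  qed
  then obtain C where C: "C \<in> \<Omega>" and max: "\<And>X. X \<in> \<Omega> \<Longrightarrow> C \<subseteq> X \<Longrightarrow> X = C" by blast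
  have CK: "C \<subseteq> K" and disj: "disjoint_family_on (\<lambda>x. ball x (r x)) C"
    and large: "\<And>x. x \<in> K \<Longrightarrow> \<exists>y\<in>C. meet x y \<Longrightarrow> \<exists>y\<in>C. meet x y \<and> r x \<le> 2 * r y"
    using C unfolding \<Omega>_def by blast+
  define S where "S = {x \<in> K. \<forall>y\<in>C. \<not> meet x y}"
  have meet_self: "meet x x" if "x \<in> K" for x using r[OF that] unfolding meet_def by (auto intro: exI[of _ x])
  have "S = {}"
  proof (rule ccontr)
    assume "S \<noteq> {}"
    have bdd: "bdd_above (r ` S)" using r by (auto simp: S_def bdd_above_def intro!: exI[of _ R])
    obtain s0 where s0: "s0 \<in> S" using \<open>S \<noteq> {}\<close> by blast
    have "0 < r s0" using r s0 by (auto simp: S_def)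
    also have "r s0 \<le> (SUP x\<in>S. r x)" using s0 bdd by (intro cSUP_upper)
    finally have "(SUP x\<in>S. r x) / 2 < (SUP x\<in>S. r x)" by simp
    then obtain z where z: "z \<in> S" "(SUP x\<in>S. r x) / 2 < r z"
      using less_cSUP_iff[OF \<open>S \<noteq> {}\<close> bdd] by blast
    have zbig: "r x \<le> 2 * r z" if "x \<in> S" for x
      using cSUP_upper[OF that bdd] z(2) by simp
    have "insert z C \<in> \<Omega>"
      unfolding \<Omega>_def
    proof (intro CollectI conjI ballI impI)
      show "insert z C \<subseteq> K" using z CK by (auto simp: S_def)
      show "disjoint_family_on (\<lambda>x. ball x (r x)) (insert z C)"
        using disj z unfolding disjoint_family_on_def S_def meet_def by blast
      fix x assume x: "x \<in> K" "\<exists>y\<in>insert z C. meet x y"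
      show "\<exists>y\<in>insert z C. meet x y \<and> r x \<le> 2 * r y"
      proof (cases "x \<in> S")
        case True
        then show ?thesis using x zbig by (auto simp: S_def)
      next
        case False
        then show ?thesis using large[of x] x by (auto simp: S_def)
      qed
    qed
    then have "insert z C = C" using max by blast
    then have "z \<in> C" by blast
    then show False using z meet_self by (auto simp: S_def)
  qed
  have "K \<subseteq> (\<Union>x\<in>C. ball x (5 * r x))"
  proof
    fix x assume x: "x \<in> K"
    then obtain y where y: "y \<in> C" "meet x y" "r x \<le> 2 * r y" using large \<open>S = {}\<close> by (auto simp: S_def)
    then obtain w where "dist x w < r x" "dist y w < r y" by (auto simp: meet_def)
    then have "dist y x < 5 * r y"
      using dist_triangle2[of y x w] y(3) r[of y] y(1) CK by (auto simp: dist_commute)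
    then show "x \<in> (\<Union>x\<in>C. ball x (5 * r x))" using y by auto
  qed
  then show ?thesis using that CK disj by blast
qed

text \<open>
  A disjoint family selected by Zorn's lemma has no obvious enumeration; countability comes from the
  finite total measure.
\<close>

lemma countable_if_finite_sums_bounded:
  fixes f :: "'i \<Rightarrow> ennreal"
  assumes pos: "\<And>i. i \<in> C \<Longrightarrow> 0 < f i" and b: "b < \<infinity>"
    and bound: "\<And>F. finite F \<Longrightarrow> F \<subseteq> C \<Longrightarrow> sum f F \<le> b"
  shows "countable C"
proof -
  define S where "S n = {i \<in> C. ennreal (1 / real (Suc n)) < f i}" for n
  have "finite (S n)" for n
  proof (rule ccontr)
    assume inf: "infinite (S n)"
    obtain m :: nat where m: "b < of_nat m" using b ennreal_Ex_less_of_nat by auto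
    obtain F where F: "finite F" "card F = m * Suc n" "F \<subseteq> S n"
      using infinite_arbitrarily_large[OF inf] by blast
    have "of_nat m = (\<Sum>i\<in>F. ennreal (1 / real (Suc n)))"
    proof -
      have "(\<Sum>i\<in>F. ennreal (1 / real (Suc n))) = ennreal (\<Sum>i\<in>F. 1 / real (Suc n))"
        by (rule sum_ennreal) simp
      also have "(\<Sum>i\<in>F. 1 / real (Suc n)) = real m"
        by (simp only: sum_constant F(2) of_nat_mult) (simp del: of_nat_Suc)
      finally show ?thesis by (simp add: ennreal_of_nat_eq_real_of_nat)
    qed
    also have "\<dots> \<le> sum f F" using F by (intro sum_mono) (auto simp: S_def less_imp_le)
    also have "\<dots> \<le> b" using F by (intro bound) (auto simp: S_def)
    finally show False using m by simp
  qed
  moreover have "C \<subseteq> (\<Union>n. S n)"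
  proof
    fix i assume i: "i \<in> C"
    obtain n where "ennreal (1 / real (Suc n)) < f i"
    proof (cases "f i")
      case (real x)
      then have "0 < x" using pos[OF i] by simp
      then obtain n where "1 / real (Suc n) < x" using nat_approx_posE by blast
      then show ?thesis using real that[of n] by (simp add: ennreal_less_iff)
    qed (use that in simp)
    then show "i \<in> (\<Union>n. S n)" using i by (auto simp: S_def)
  qed
  ultimately show ?thesis by (meson countable_UN countable_finite countable_subset uncountable_def countableI_type)
qed

text \<open>
  The second measure \<open>N\<close> is \<open>M\<close> itself when the size of the bad set is estimated, and a density with
  respect to \<open>M\<close> when a function is shown to vanish almost everywhere.
\<close>

lemma vitali_cover_measure_le:
  fixes M N :: "'a::metric_space measure" and r :: "'a \<Rightarrow> real"
  assumes borel: "sets borel \<subseteq> sets M" "sets N = sets M"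
    and r: "\<And>x. x \<in> K \<Longrightarrow> 0 < r x \<and> r x \<le> R"
    and pos: "\<And>x. x \<in> K \<Longrightarrow> 0 < emeasure M (ball x (r x))"
    and b: "b < \<infinity>"
    and bound: "\<And>F. finite F \<Longrightarrow> F \<subseteq> K \<Longrightarrow> disjoint_family_on (\<lambda>x. ball x (r x)) F \<Longrightarrow> (\<Sum>x\<in>F. emeasure M (ball x (r x))) \<le> b"
    and N: "\<And>x. x \<in> K \<Longrightarrow> emeasure N (ball x (5 * r x)) \<le> c * emeasure M (ball x (r x))"
  obtains W where "open W" "K \<subseteq> W" "emeasure N W \<le> c * b"
proof -
  obtain C where C: "C \<subseteq> K" "disjoint_family_on (\<lambda>x. ball x (r x)) C" "K \<subseteq> (\<Union>x\<in>C. ball x (5 * r x))"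
    using vitali_disjoint_selection[of K r R] r by blast
  have boundC: "(\<Sum>x\<in>F. emeasure M (ball x (r x))) \<le> b" if "finite F" "F \<subseteq> C" for F
    using that C(1) disjoint_family_on_mono[OF _ C(2)] by (intro bound) auto
  have "countable C" using boundC C(1) pos b by (intro countable_if_finite_sums_bounded[of C _ b]) auto
  \<comment> \<open>Finite unions exhaust the cover, so that finite subadditivity is enough.\<close>
  define W where "W n = (\<Union>x\<in>{x \<in> C. to_nat_on C x < n}. ball x (5 * r x))" for n
  have fin: "finite {x \<in> C. to_nat_on C x < n}" for n
    using inj_on_to_nat_on[OF \<open>countable C\<close>]
    by (intro inj_on_finite[of "to_nat_on C" _ "{..<n}"]) (auto intro: inj_on_subset)
  have "open (W n)" for n by (auto simp: W_def)
  then have Ws: "W n \<in> sets N" for n using borel by auto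
  have inN: "ball x s \<in> sets N" for x s using borel by auto
  have WN: "emeasure N (W n) \<le> c * b" for n
  proof -
    have "emeasure N (W n) \<le> (\<Sum>x\<in>{x \<in> C. to_nat_on C x < n}. emeasure N (ball x (5 * r x)))"
      unfolding W_def using fin inN by (intro emeasure_subadditive_finite) auto
    also have "\<dots> \<le> (\<Sum>x\<in>{x \<in> C. to_nat_on C x < n}. c * emeasure M (ball x (r x)))"
      using C(1) by (intro sum_mono N) auto
    also have "\<dots> \<le> c * b"
      unfolding sum_distrib_left[symmetric] using fin by (intro mult_left_mono boundC) auto
    finally show ?thesis .
  qed
  have "(SUP n. emeasure N (W n)) = emeasure N (\<Union>n. W n)"
  proof (rule SUP_emeasure_incseq)
    show "range W \<subseteq> sets N" using Ws by auto
    show "incseq W" unfolding incseq_def W_def by (auto 4 3 intro: less_le_trans)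
  qed
  then have "emeasure N (\<Union>n. W n) \<le> c * b" using WN by (metis SUP_least)
  moreover have "K \<subseteq> (\<Union>n. W n)" using C(3) by (fastforce simp: W_def)
  moreover have "open (\<Union>n. W n)" using \<open>\<And>n. open (W n)\<close> by auto
  ultimately show ?thesis using that by blast
qed

section \<open>Lipschitz behaviour on sets of small mean oscillation\<close>

text \<open>
  The sequences \<open>a j - 2 * c / 2 ^ j\<close> and \<open>a j + 2 * c / 2 ^ j\<close> enclose the limit from both sides
  monotonically.
\<close>

lemma dyadic_cauchy_limit:
  fixes a :: "nat \<Rightarrow> real"
  assumes step: "\<And>j. \<bar>a (Suc j) - a j\<bar> \<le> c / 2 ^ j" and k: "\<And>j. \<bar>a j\<bar> \<le> k"
  shows "\<exists>l. \<bar>l\<bar> \<le> k \<and> (\<forall>j. \<bar>a j - l\<bar> \<le> 2 * c / 2 ^ j)"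
proof -
  define lo up where "lo j = a j - 2 * c / 2 ^ j" and "up j = a j + 2 * c / 2 ^ j" for j
  have "2 * c / 2 ^ j - 2 * c / 2 ^ Suc j = c / 2 ^ j" for j by (simp add: field_simps)
  then have inc: "incseq lo" and dec: "decseq up"
    using step unfolding lo_def up_def by (smt (verit) incseq_SucI decseq_SucI)+
  have c: "0 \<le> c" using step[of 0] by simp
  have lo_up: "lo i \<le> up j" for i j
  proof -
    have "lo i \<le> lo (max i j)" using inc by (simp add: incseq_def)
    also have "\<dots> \<le> up (max i j)" using c by (simp add: lo_def up_def)
    also have "\<dots> \<le> up j" using dec by (simp add: decseq_def)
    finally show ?thesis .
  qed
  have bdd: "bdd_above (range lo)" using lo_up by (auto simp: bdd_above_def)
  define l where "l = (SUP i. lo i)"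
  have l: "lo j \<le> l" "l \<le> up j" for j
    unfolding l_def using bdd lo_up by (auto intro: cSUP_upper cSUP_least)
  define l' where "l' = max (- k) (min k l)"
  have "0 \<le> k" using k[of 0] by simp
  then have "\<bar>l'\<bar> \<le> k" by (auto simp: l'_def)
  moreover have "\<bar>a j - l'\<bar> \<le> 2 * c / 2 ^ j" for j
    using l[of j] k[of j] unfolding lo_def up_def l'_def by (auto simp: max_def min_def abs_le_iff)
  ultimately show ?thesis by blast
qed

text \<open>
  McShane's formula \<open>inf (g y + L * dist x y)\<close>, clamped to \<open>[- k, k]\<close>.
\<close>

lemma mcshane_extension:
  fixes g :: "'a::metric_space \<Rightarrow> real"
  assumes L: "0 \<le> L" and g: "\<And>x y. x \<in> A \<Longrightarrow> y \<in> A \<Longrightarrow> \<bar>g x - g y\<bar> \<le> L * dist x y"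
    and k: "\<And>x. x \<in> A \<Longrightarrow> \<bar>g x\<bar> \<le> k" "0 \<le> k"
  obtains f :: "'a \<Rightarrow> real" where "L-lipschitz_on UNIV f" "\<And>x. x \<in> A \<Longrightarrow> f x = g x" "\<And>x. \<bar>f x\<bar> \<le> k"
proof (cases "A = {}")
  case True
  then show ?thesis using that[of "\<lambda>_. 0"] L k by (auto simp: lipschitz_on_def)
next
  case False
  define h where "h x = (INF y\<in>A. g y + L * dist x y)" for x
  define f where "f x = max (- k) (min k (h x))" for x
  have bdd: "bdd_below ((\<lambda>y. g y + L * dist x y) ` A)" for x
  proof (rule bdd_belowI2[of _ "- k"])
    fix y assume "y \<in> A"
    then show "- k \<le> g y + L * dist x y" using k(1)[of y] L mult_nonneg_nonneg[OF L zero_le_dist[of x y]] by linarith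
  qed
  have le: "h x \<le> h x' + L * dist x x'" for x x'
  proof -
    have "h x - L * dist x x' \<le> g y + L * dist x' y" if "y \<in> A" for y
    proof -
      have "h x \<le> g y + L * dist x y" unfolding h_def using that bdd by (intro cINF_lower)
      also have "\<dots> \<le> g y + L * (dist x x' + dist x' y)" using L by (intro add_left_mono mult_left_mono dist_triangle)
      finally show ?thesis by (simp add: algebra_simps)
    qed
    then have "h x - L * dist x x' \<le> h x'" unfolding h_def[of x'] using False by (intro cINF_greatest)
    then show ?thesis by simp
  qed
  have "L-lipschitz_on UNIV f"
  proof (rule lipschitz_onI[OF _ L])
    fix x x'
    show "dist (f x) (f x') \<le> L * dist x x'"
      using le[of x x'] le[of x' x] L mult_nonneg_nonneg[OF L zero_le_dist[of x x']]
      unfolding f_def dist_real_def by (simp add: dist_commute max_def min_def abs_le_iff)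
  qed
  moreover have "f x = g x" if x: "x \<in> A" for x
  proof -
    have "h x \<le> g x" unfolding h_def using x bdd[of x] by (auto intro: cINF_lower2)
    moreover have "g x \<le> g y + L * dist x y" if "y \<in> A" for y using g[OF x that] by linarith
    then have "g x \<le> h x" unfolding h_def using False by (intro cINF_greatest) auto
    ultimately show ?thesis using k(1)[OF x] by (simp add: f_def)
  qed
  moreover have "\<bar>f x\<bar> \<le> k" for x using k(2) by (auto simp: f_def)
  ultimately show ?thesis using that by blast
qed

locale doubling_space =
  fixes M :: "'a::metric_space measure" and D :: real
  assumes borel_M: "sets borel \<subseteq> sets M" and space_UNIV: "space M = UNIV"
    and ball_pos: "\<And>x r. 0 < r \<Longrightarrow> 0 < emeasure M (ball x r)"
    and ball_finite: "\<And>x r. 0 < r \<Longrightarrow> emeasure M (ball x r) < \<infinity>"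
    and D: "1 \<le> D"
    and doubling: "\<And>x r. 0 < r \<Longrightarrow> emeasure M (ball x (2 * r)) \<le> ennreal D * emeasure M (ball x r)"
begin

lemma ball_in_sets [measurable]: "ball x r \<in> sets M"
  using borel_M by auto

lemma emeasure_ball: "0 < r \<Longrightarrow> emeasure M (ball x r) = ennreal (measure M (ball x r))"
  using ball_finite[of r x] by (intro emeasure_eq_ennreal_measure) auto

lemma measure_ball_pos: "0 < r \<Longrightarrow> 0 < measure M (ball x r)"
  using ball_pos[of r x] emeasure_ball[of r x] by simp

lemma doubling_measure_ball: "0 < r \<Longrightarrow> measure M (ball x (2 * r)) \<le> D * measure M (ball x r)"
  using doubling[of r x] D by (simp add: emeasure_ball flip: ennreal_mult)

text \<open>
  The factor 5 comes from the covering lemma; three doublings reach radius \<open>8 * r\<close>.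
\<close>

lemma doubling_iterate:
  assumes "0 < r" shows "emeasure M (ball x (5 * r)) \<le> ennreal (D ^ 3) * emeasure M (ball x r)"
proof -
  have "emeasure M (ball x (5 * r)) \<le> emeasure M (ball x (2 * (2 * (2 * r))))"
    using assms by (intro emeasure_mono) auto
  also have "\<dots> \<le> ennreal D * emeasure M (ball x (2 * (2 * r)))" using assms by (intro doubling) auto
  also have "\<dots> \<le> ennreal D * (ennreal D * emeasure M (ball x (2 * r)))" using assms by (intro mult_left_mono doubling) auto
  also have "\<dots> \<le> ennreal D * (ennreal D * (ennreal D * emeasure M (ball x r)))" using assms by (intro mult_left_mono doubling) auto
  also have "\<dots> = ennreal (D ^ 3) * emeasure M (ball x r)"
    using D by (simp add: power3_eq_cube ennreal_mult mult.assoc)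
  finally show ?thesis .
qed

definition ball_average :: "('a \<Rightarrow> real) \<Rightarrow> 'a \<Rightarrow> real \<Rightarrow> real" where
  "ball_average v x r = (LINT y:ball x r|M. v y) / measure M (ball x r)"

context
  fixes v :: "'a \<Rightarrow> real" and k :: real
  assumes v [measurable]: "v \<in> borel_measurable M" and vk: "\<And>x. \<bar>v x\<bar> \<le> k"
begin

lemma ball_integrable:
  assumes "0 < r" and w: "w \<in> borel_measurable M" and b: "\<And>x. \<bar>w x\<bar> \<le> (b::real)"
  shows "set_integrable M (ball x r) w"
  unfolding set_integrable_def
proof (rule integrableI_bounded_set_indicator[where B = b])
  show "emeasure M (ball x r) < \<infinity>" by (rule ball_finite[OF assms(1)])
qed (use w b in auto)

lemma k_nonneg: "0 \<le> k" using vk[of undefined] by linarith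

lemma ball_average_diff_le:
  assumes r: "0 < r" and s: "0 < s" and sub: "ball y s \<subseteq> ball x r"
  shows "\<bar>ball_average v y s - c\<bar> * measure M (ball y s) \<le> (LINT z:ball x r|M. \<bar>v z - c\<bar>)"
proof -
  have iv: "set_integrable M (ball z t) v" if "0 < t" for z t using ball_integrable[OF that v vk] .
  have ia: "set_integrable M (ball z t) (\<lambda>x. \<bar>v x - c\<bar>)" if "0 < t" for z t
    using vk by (intro ball_integrable[OF that, of _ "k + \<bar>c\<bar>"]) (auto intro: order_trans[OF abs_triangle_ineq4])
  have ic: "set_integrable M (ball z t) (\<lambda>x. c)" if "0 < t" for z t
    by (intro ball_integrable[OF that, of _ "\<bar>c\<bar>"]) auto
  have "(LINT z:ball y s|M. c) = c * measure M (ball y s)"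
    using ball_finite[OF s] by (simp add: set_integral_const less_top)
  then have "(ball_average v y s - c) * measure M (ball y s) = (LINT z:ball y s|M. v z - c)"
    using measure_ball_pos[OF s, of y] set_integral_diff(2)[OF iv[OF s, of y] ic[OF s, of y]]
    by (simp add: ball_average_def algebra_simps)
  then have "\<bar>ball_average v y s - c\<bar> * measure M (ball y s) = \<bar>LINT z:ball y s|M. v z - c\<bar>"
    using measure_ball_pos[OF s, of y] by (metis abs_mult abs_of_pos)
  also have "\<dots> \<le> (LINT z:ball y s|M. \<bar>v z - c\<bar>)"
    using set_integral_norm_bound[OF set_integral_diff(1)[OF iv[OF s, of y] ic[OF s, of y]]] by simp
  also have "\<dots> \<le> (LINT z:ball x r|M. \<bar>v z - c\<bar>)"
    unfolding set_lebesgue_integral_def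
    using ia[OF s, of y] ia[OF r, of x] sub
    by (intro integral_mono) (auto simp: set_integrable_def indicator_def)
  finally show ?thesis .
qed

lemma abs_ball_average_le:
  assumes s: "0 < s" shows "\<bar>ball_average v y s\<bar> \<le> k"
proof -
  have "\<bar>ball_average v y s - 0\<bar> * measure M (ball y s) \<le> (LINT z:ball y s|M. \<bar>v z - 0\<bar>)"
    by (rule ball_average_diff_le[OF s s order_refl])
  also have "\<dots> \<le> (LINT z:ball y s|M. k)"
    using ball_integrable[OF s, of "\<lambda>z. \<bar>v z - 0\<bar>" k y] ball_integrable[OF s, of "\<lambda>z. k" k y] vk k_nonneg
    by (intro set_integral_mono) auto
  also have "\<dots> = k * measure M (ball y s)" using ball_finite[OF s] by (simp add: set_integral_const less_top)
  finally show ?thesis using measure_ball_pos[OF s, of y] by simp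
qed

text \<open>
  Consecutive dyadic averages at a point of \<open>A\<close> differ by at most a multiple of \<open>K / 2 ^ j\<close>, hence converge, to
  \<open>g\<close> say.  Averages at the scale of the distance of two points are both comparable with the average
  over a ball containing both balls, which makes \<open>g\<close> Lipschitz at distances below 1; at larger
  distances the bound \<open>k\<close> suffices, whence the two terms of the maximum.

  For the extension \<open>f\<close> of \<open>g\<close>, the integral of \<open>\<bar>v - f\<bar>\<close> over a ball of radius \<open>1 / 2 ^ j\<close> centred in \<open>A\<close> is
  at most a multiple of \<open>1 / 2 ^ j\<close> times the measure of the ball.  Covering a bounded part of \<open>A\<close> by such
  balls with controlled total measure and letting \<open>j\<close> grow shows that this integral over \<open>A\<close> is zero.
\<close>

proposition lipschitz_on_small_oscillation_set:
  assumes A: "A \<in> sets M" and K: "0 \<le> K"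
    and osc: "\<And>x r. x \<in> A \<Longrightarrow> 0 < r \<Longrightarrow> r \<le> 4 \<Longrightarrow>
      (LINT z:ball x r|M. \<bar>v z - ball_average v x r\<bar>) \<le> K * r * measure M (ball x r)"
  obtains f where "(max (16 * D\<^sup>2 * K) (2 * k))-lipschitz_on UNIV f" "\<And>x. \<bar>f x\<bar> \<le> k" "AE x in M. x \<in> A \<longrightarrow> v x = f x"
proof -
  define L where "L = max (16 * D\<^sup>2 * K) (2 * k)"
  define a where "a j x = ball_average v x (1 / 2 ^ j)" for j :: nat and x
  have compare: "\<bar>ball_average v y s - ball_average v x r\<bar> \<le> \<kappa> * K * r"
    if "x \<in> A" "0 < r" "r \<le> 4" "0 < s" "ball y s \<subseteq> ball x r" "measure M (ball x r) \<le> \<kappa> * measure M (ball y s)" for x y r s \<kappa>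
  proof -
    have "\<bar>ball_average v y s - ball_average v x r\<bar> * measure M (ball y s) \<le> K * r * measure M (ball x r)"
      using ball_average_diff_le[OF that(2,4,5), of "ball_average v x r"] osc[OF that(1-3)] by linarith
    also have "\<dots> \<le> K * r * (\<kappa> * measure M (ball y s))" using that K by (intro mult_left_mono) auto
    finally show ?thesis using measure_ball_pos[OF that(4), of y] by (simp add: mult_ac)
  qed
  have step: "\<bar>a (Suc j) x - a j x\<bar> \<le> (D * K) / 2 ^ j" if x: "x \<in> A" for j x
  proof -
    have "\<bar>a (Suc j) x - a j x\<bar> \<le> D * K * (1 / 2 ^ j)"
      unfolding a_def
    proof (rule compare[OF x])
      show "measure M (ball x (1 / 2 ^ j)) \<le> D * measure M (ball x (1 / 2 ^ Suc j))"
        using doubling_measure_ball[of "1 / 2 ^ Suc j" x] by simp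
      have "(1::real) \<le> 2 ^ j" by simp
      then have "1 / 2 ^ j \<le> (1::real)" by (simp add: divide_le_eq_1)
      then show "1 / 2 ^ j \<le> (4::real)" by linarith
    qed (auto simp: field_simps)
    then show ?thesis by simp
  qed
  have "\<forall>x\<in>A. \<exists>l. \<bar>l\<bar> \<le> k \<and> (\<forall>j. \<bar>a j x - l\<bar> \<le> 2 * (D * K) / 2 ^ j)"
    using step by (intro ballI dyadic_cauchy_limit) (auto simp: a_def intro: abs_ball_average_le)
  then obtain g where gk: "\<And>x. x \<in> A \<Longrightarrow> \<bar>g x\<bar> \<le> k" and ga: "\<And>x j. x \<in> A \<Longrightarrow> \<bar>a j x - g x\<bar> \<le> 2 * (D * K) / 2 ^ j"
    by metis
  have g_lip: "\<bar>g x - g y\<bar> \<le> L * dist x y" if xy: "x \<in> A" "y \<in> A" for x y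
  proof -
    consider "dist x y = 0" | "1 \<le> dist x y" | "0 < dist x y" "dist x y < 1" using zero_le_dist[of x y] by linarith
    then show ?thesis
    proof cases
      case 2
      have "\<bar>g x - g y\<bar> \<le> 2 * k" using gk[OF xy(1)] gk[OF xy(2)] by linarith
      also have "\<dots> \<le> L * 1" by (simp add: L_def)
      also have "\<dots> \<le> L * dist x y" using 2 k_nonneg by (intro mult_left_mono) (auto simp: L_def)
      finally show ?thesis .
    next
      case 3
      \<comment> \<open>The scale with \<open>dist x y < R \<le> 2 * dist x y\<close>.\<close>
      define P where "P j \<longleftrightarrow> 1 / 2 ^ j \<le> dist x y" for j :: nat
      have "\<exists>j. P j"
        using real_arch_pow_inv[OF 3(1), of "1/2"] unfolding P_def by (auto simp: power_one_over intro: less_imp_le)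
      then obtain j0 where j0: "P j0" "\<And>i. i < j0 \<Longrightarrow> \<not> P i" by (metis LeastI_ex not_less_Least)
      have "j0 \<noteq> 0" using j0(1) 3 by (auto simp: P_def intro: ccontr)
      then obtain j where j: "j0 = Suc j" using not0_implies_Suc by blast
      define R where "R = (1::real) / 2 ^ j"
      have R: "0 < R" "dist x y < R" "R \<le> 2 * dist x y" "R \<le> 1"
        using j0(1) j0(2)[of j] unfolding P_def R_def j by (auto simp: field_simps)
      have "ball x R \<subseteq> ball x (2 * R)" using R by auto
      then have 1: "\<bar>a j x - ball_average v x (2 * R)\<bar> \<le> D * K * (2 * R)"
        unfolding a_def R_def[symmetric] using R doubling_measure_ball[of R x] by (intro compare[OF xy(1)]) auto
      have sub: "ball y R \<subseteq> ball x (2 * R)" "ball x (2 * R) \<subseteq> ball y (2 * (2 * R))"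
        using R(2) dist_triangle[of x _ y] dist_triangle[of y _ x] by (auto simp: dist_commute subset_iff) (smt (verit) dist_commute dist_triangle)+
      have "measure M (ball x (2 * R)) \<le> measure M (ball y (2 * (2 * R)))"
        using sub(2) ball_finite[of "2 * (2 * R)" y] R by (intro measure_mono_fmeasurable fmeasurableI) auto
      also have "\<dots> \<le> D * (D * measure M (ball y R))"
        using doubling_measure_ball[of "2 * R" y] doubling_measure_ball[of R y] R D by (auto intro: order_trans mult_left_mono)
      finally have 2: "\<bar>a j y - ball_average v x (2 * R)\<bar> \<le> D\<^sup>2 * K * (2 * R)"
        unfolding a_def R_def[symmetric] using R sub(1) by (intro compare[OF xy(1)]) (auto simp: power2_eq_square mult.assoc)
      have 3: "\<bar>a j z - g z\<bar> \<le> 2 * (D * K * R)" if "z \<in> A" for z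
        using ga[OF that, of j] by (simp add: R_def)
      have "\<bar>g x - g y\<bar> \<le> 6 * (D * K * R) + 2 * (D\<^sup>2 * K * R)"
        using 1 2 3[OF xy(1)] 3[OF xy(2)] by linarith
      also have "\<dots> \<le> 6 * (D\<^sup>2 * K * R) + 2 * (D\<^sup>2 * K * R)"
      proof -
        have "D * (K * R) \<le> D\<^sup>2 * (K * R)"
          using D K R by (intro mult_right_mono) (auto simp: power2_eq_square)
        then show ?thesis by (simp add: mult_ac)
      qed
      also have "\<dots> \<le> 8 * (D\<^sup>2 * K) * (2 * dist x y)"
      proof -
        have "(D\<^sup>2 * K) * R \<le> (D\<^sup>2 * K) * (2 * dist x y)" using R K by (intro mult_left_mono) auto
        then have "8 * ((D\<^sup>2 * K) * R) \<le> 8 * ((D\<^sup>2 * K) * (2 * dist x y))" by (rule mult_left_mono) simp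
        then show ?thesis by (simp add: mult.assoc)
      qed
      also have "\<dots> = (16 * D\<^sup>2 * K) * dist x y" by simp
      also have "\<dots> \<le> L * dist x y" by (intro mult_right_mono) (auto simp: L_def)
      finally show ?thesis .
    qed auto
  qed
  have L0: "0 \<le> L" using k_nonneg by (simp add: L_def)
  obtain f where f: "L-lipschitz_on UNIV f" "\<And>x. x \<in> A \<Longrightarrow> f x = g x" "\<And>x. \<bar>f x\<bar> \<le> k"
    using mcshane_extension[of L A g k] L0 g_lip gk k_nonneg by metis
  have fM [measurable]: "f \<in> borel_measurable M"
  proof -
    have "f \<in> borel_measurable borel"
      using f(1) lipschitz_on_continuous_on borel_measurable_continuous_onI by blast
    then show ?thesis by (rule borel_measurable_subalgebra[OF borel_M, rotated]) (simp add: space_UNIV)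
  qed
  define N where "N = density M (\<lambda>z. ennreal \<bar>v z - f z\<bar>)"
  have setsN: "sets N = sets M" by (simp add: N_def)
  \<comment> \<open>Oscillation about the average, distance of the average to \<open>g x\<close>, oscillation of \<open>f\<close>.\<close>
  define c where "c = K + 2 * (D * K) + L"
  have c0: "0 \<le> c" using K D L0 by (simp add: c_def)
  have N_ball: "emeasure N (ball x (1 / 2 ^ j)) \<le> ennreal (c / 2 ^ j) * emeasure M (ball x (1 / 2 ^ j))" if x: "x \<in> A" for x j
  proof -
    define R where "R = (1::real) / 2 ^ j"
    have R: "0 < R" "R \<le> 4"
    proof -
      have "(1::real) \<le> 2 ^ j" by simp
      then have "R \<le> (1::real)" by (simp add: divide_le_eq_1 R_def)
      then show "R \<le> 4" by linarith
    qed (simp add: R_def)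
    define h where "h z = \<bar>v z - a j x\<bar> + (2 * (D * K) + L) * R" for z
    have [measurable]: "h \<in> borel_measurable M" unfolding h_def by measurable
    have i1: "set_integrable M (ball x R) (\<lambda>z. \<bar>v z - a j x\<bar>)"
      using vk by (intro ball_integrable[OF R(1), of _ "k + \<bar>a j x\<bar>"]) (auto intro: order_trans[OF abs_triangle_ineq4])
    have i2: "set_integrable M (ball x R) (\<lambda>z. (2 * (D * K) + L) * R)"
      by (intro ball_integrable[OF R(1), of _ "\<bar>(2 * (D * K) + L) * R\<bar>"]) auto
    have "emeasure N (ball x R) = (\<integral>\<^sup>+z. ennreal \<bar>v z - f z\<bar> * indicator (ball x R) z \<partial>M)"
      unfolding N_def by (rule emeasure_density) auto
    also have "\<dots> \<le> (\<integral>\<^sup>+z. ennreal (indicator (ball x R) z * h z) \<partial>M)"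
    proof (rule nn_integral_mono)
      fix z
      have "\<bar>v z - f z\<bar> \<le> h z" if "z \<in> ball x R"
      proof -
        have "\<bar>f x - f z\<bar> \<le> L * dist x z" using lipschitz_onD[OF f(1), of x z] by (simp add: dist_real_def)
        also have "\<dots> \<le> L * R" using that L0 by (intro mult_left_mono) auto
        finally have "\<bar>g x - f z\<bar> \<le> L * R" using f(2)[OF x] by simp
        moreover have "\<bar>a j x - g x\<bar> \<le> 2 * (D * K) * R" using ga[OF x, of j] by (simp add: R_def)
        ultimately show ?thesis unfolding h_def distrib_right by linarith
      qed
      then show "ennreal \<bar>v z - f z\<bar> * indicator (ball x R) z \<le> ennreal (indicator (ball x R) z * h z)"
        by (auto simp: indicator_def intro: ennreal_leI)
    qed
    also have "\<dots> = ennreal (LINT z:ball x R|M. h z)"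
      unfolding set_lebesgue_integral_def real_scaleR_def
    proof (rule nn_integral_eq_integral)
      show "integrable M (\<lambda>z. indicator (ball x R) z * h z)"
        using set_integral_add(1)[OF i1 i2] unfolding set_integrable_def h_def by simp
      have "0 \<le> h z" for z using K D L0 R by (simp add: h_def)
      then show "AE z in M. 0 \<le> indicator (ball x R) z * h z" by simp
    qed
    also have "(LINT z:ball x R|M. h z) = (LINT z:ball x R|M. \<bar>v z - a j x\<bar>) + (2 * (D * K) + L) * R * measure M (ball x R)"
      unfolding h_def using set_integral_add(2)[OF i1 i2] ball_finite[OF R(1)] by (simp add: set_integral_const less_top)
    also have "\<dots> \<le> c * R * measure M (ball x R)"
      using osc[OF x R] unfolding a_def R_def[symmetric] c_def by (simp add: distrib_right)
    also have "ennreal (c * R * measure M (ball x R)) = ennreal (c / 2 ^ j) * emeasure M (ball x R)"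
      unfolding emeasure_ball[OF R(1)] using c0 by (subst ennreal_mult[symmetric]) (auto simp: R_def)
    finally show ?thesis unfolding R_def by (simp add: ennreal_leI)
  qed
  \<comment> \<open>Radius \<open>1 / 2 ^ j / 5\<close> makes the enlarged balls those of \<open>N_ball\<close>.\<close>
  have null: "emeasure N (A \<inter> ball x0 n) = 0" if n: "0 < n" for x0 n
  proof (rule ccontr)
    assume neq: "emeasure N (A \<inter> ball x0 n) \<noteq> 0"
    define b where "b = emeasure M (ball x0 (n + 1))"
    have b: "b < \<infinity>" unfolding b_def using n by (intro ball_finite) simp
    have le: "emeasure N (A \<inter> ball x0 n) \<le> ennreal (c / 2 ^ j * D ^ 3) * b" for j
    proof -
      have scale: "0 < 1 / 2 ^ j / (5::real)" "1 / 2 ^ j / (5::real) \<le> 1"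
      proof -
        have "(1::real) \<le> 2 ^ j" by simp
        then have "(1::real) \<le> 5 * 2 ^ j" by linarith
        then show "1 / 2 ^ j / (5::real) \<le> 1" by (simp add: field_simps)
      qed simp
      obtain W where W: "open W" "A \<inter> ball x0 n \<subseteq> W" "emeasure N W \<le> ennreal (c / 2 ^ j * D ^ 3) * b"
      proof (rule vitali_cover_measure_le[OF borel_M setsN, of "A \<inter> ball x0 n" "\<lambda>_. 1 / 2 ^ j / 5" 1 b "ennreal (c / 2 ^ j * D ^ 3)"])
        fix F assume F: "finite F" "F \<subseteq> A \<inter> ball x0 n" "disjoint_family_on (\<lambda>x. ball x (1 / 2 ^ j / 5)) F"
        have "(\<Sum>x\<in>F. emeasure M (ball x (1 / 2 ^ j / 5))) = emeasure M (\<Union>x\<in>F. ball x (1 / 2 ^ j / 5))"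
          using F by (intro sum_emeasure) auto
        also have "\<dots> \<le> b"
          unfolding b_def
        proof (intro emeasure_mono UN_least subsetI)
          fix x z assume "x \<in> F" and z: "z \<in> ball x (1 / 2 ^ j / 5)"
          then have "dist x0 x < n" using F(2) by auto
          moreover have "dist x z < 1" using z scale(2) unfolding mem_ball by (rule less_le_trans)
          ultimately
          show "z \<in> ball x0 (n + 1)" using dist_triangle[of x0 z x] by simp
        qed simp
        finally show "(\<Sum>x\<in>F. emeasure M (ball x (1 / 2 ^ j / 5))) \<le> b" .
      next
        fix x assume x: "x \<in> A \<inter> ball x0 n"
        have "emeasure N (ball x (5 * (1 / 2 ^ j / 5))) \<le> ennreal (c / 2 ^ j) * emeasure M (ball x (5 * (1 / 2 ^ j / 5)))"
          using N_ball[of x j] x by simp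
        also have "\<dots> \<le> ennreal (c / 2 ^ j) * (ennreal (D ^ 3) * emeasure M (ball x (1 / 2 ^ j / 5)))"
          by (intro mult_left_mono doubling_iterate scale) simp
        also have "\<dots> = ennreal (c / 2 ^ j * D ^ 3) * emeasure M (ball x (1 / 2 ^ j / 5))"
          unfolding mult.assoc[symmetric] using c0 D by (subst ennreal_mult) auto
        finally show "emeasure N (ball x (5 * (1 / 2 ^ j / 5))) \<le> ennreal (c / 2 ^ j * D ^ 3) * emeasure M (ball x (1 / 2 ^ j / 5))" .
      qed (use scale b ball_pos in auto)
      then have "emeasure N (A \<inter> ball x0 n) \<le> emeasure N W"
        using borel_M by (intro emeasure_mono) (auto simp: setsN)
      then show ?thesis using W(3) by simp
    qed
    define B where "B = c * D ^ 3 * enn2real b"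
    have B: "ennreal (c / 2 ^ j * D ^ 3) * b = ennreal (B / 2 ^ j)" for j
    proof -
      have "b = ennreal (enn2real b)" using b by simp
      then have "ennreal (c / 2 ^ j * D ^ 3) * b = ennreal (c / 2 ^ j * D ^ 3 * enn2real b)"
        using c0 D by (metis ennreal_mult'' enn2real_nonneg)
      then show ?thesis by (simp add: B_def)
    qed
    have fin: "emeasure N (A \<inter> ball x0 n) < top" using le[of 0] unfolding B by (auto intro: le_less_trans)
    define e where "e = enn2real (emeasure N (A \<inter> ball x0 n))"
    have e: "emeasure N (A \<inter> ball x0 n) = ennreal e" "0 < e"
      using fin neq by (auto simp: e_def enn2real_positive_iff less_top zero_less_iff_neq_zero)
    have B0: "0 \<le> B" using c0 D by (simp add: B_def)
    obtain j where "(1 / 2) ^ j < e / (B + 1)" using real_arch_pow_inv[of "e / (B + 1)" "1/2"] e B0 by auto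
    then have "(B + 1) / 2 ^ j < e" using B0 by (simp add: power_one_over field_simps)
    moreover have "B / 2 ^ j \<le> (B + 1) / 2 ^ j" by (intro divide_right_mono) auto
    moreover have "e \<le> B / 2 ^ j" using le[of j] B0 unfolding B e by simp
    ultimately show False by linarith
  qed
  \<comment> \<open>Balls about an arbitrary base point exhaust the space.\<close>
  have "AE x in M. x \<in> A \<inter> ball undefined (real (Suc n)) \<longrightarrow> v x = f x" for n
  proof -
    let ?S = "A \<inter> ball undefined (real (Suc n))"
    have S: "?S \<in> sets M" using A by auto
    have "emeasure N ?S = (\<integral>\<^sup>+z. ennreal \<bar>v z - f z\<bar> * indicator ?S z \<partial>M)"
      unfolding N_def by (rule emeasure_density[OF _ S]) measurable
    then have "(\<integral>\<^sup>+z. ennreal \<bar>v z - f z\<bar> * indicator ?S z \<partial>M) = 0"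
      using null[of "real (Suc n)" undefined] by (simp del: of_nat_Suc)
    then have "AE z in M. ennreal \<bar>v z - f z\<bar> * indicator ?S z = 0"
      using S by (subst (asm) nn_integral_0_iff_AE) auto
    then show ?thesis by eventually_elim (auto simp: indicator_def split: if_splits)
  qed
  then have "AE x in M. \<forall>n. x \<in> A \<inter> ball undefined (real (Suc n)) \<longrightarrow> v x = f x"
    unfolding AE_all_countable by (rule allI)
  then have "AE x in M. x \<in> A \<longrightarrow> v x = f x"
  proof eventually_elim
    fix x assume *: "\<forall>n. x \<in> A \<inter> ball undefined (real (Suc n)) \<longrightarrow> v x = f x"
    obtain n where "dist undefined x < real n" using reals_Archimedean2 by blast
    then have "dist undefined x < real (Suc n)" by simp
    then show "x \<in> A \<longrightarrow> v x = f x" using * by (auto simp del: of_nat_Suc)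
  qed
  then show ?thesis using that f(1,3) unfolding L_def by blast
qed

end
end

section \<open>Lipschitz approximation under the Poincare inequality\<close>

locale poincare_space = lorentz_metric M p q + doubling_space M D
  for M :: "'a::metric_space measure" and p q D :: real +
  fixes C \<sigma> :: real
  assumes C: "0 < C" and \<sigma>: "1 \<le> \<sigma>"
    and poincare: "\<And>x r u g. 0 < r \<Longrightarrow> locally_integrable M u \<Longrightarrow> upper_gradient u g \<Longrightarrow>
        (\<integral>\<^sup>+y\<in>ball x r. e2ennreal \<bar>u y - ereal (mean_value M u (ball x r))\<bar> \<partial>M) / emeasure M (ball x r)
        \<le> ennreal (C * r) * (lorentz_norm M p q (\<lambda>y. enn2ereal (g y * indicator (ball x (\<sigma> * r)) y))
               / ennpowr (emeasure M (ball x (\<sigma> * r))) (1 / p))"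
begin

text \<open>
  On a ball that is not bad at level \<open>l\<close>, the right-hand side of the Poincare inequality is at most a
  multiple of \<open>l * r\<close>.
\<close>

lemma oscillation_le:
  assumes v: "v \<in> borel_measurable borel" and vk: "\<And>x. \<bar>v x\<bar> \<le> k"
    and ug: "upper_gradient (\<lambda>x. ereal (v x)) g" and r: "0 < r" and l: "0 < l"
    and good: "energy (\<lambda>y. g y * indicator (ball x (\<sigma> * r)) y)
      \<le> ennreal (l powr q) * ennpowr (emeasure M (ball x (\<sigma> * r))) (q / p)"
  shows "(LINT z:ball x r|M. \<bar>v z - ball_average v x r\<bar>) \<le> (C * p powr (1 / q) * l) * r * measure M (ball x r)"
proof -
  have vM [measurable]: "v \<in> borel_measurable M" using v by (rule measurable_M)
  have g [measurable]: "g \<in> borel_measurable borel" using ug by (simp add: upper_gradient_def)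
  define K where "K = C * p powr (1 / q) * l"
  have K: "0 < K" using C p l by (simp add: K_def)
  let ?B = "ball x r" let ?S = "ball x (\<sigma> * r)"
  have \<sigma>r: "0 < \<sigma> * r" using \<sigma> r by simp
  define \<mu> where "\<mu> = measure M ?S"
  have \<mu>: "emeasure M ?S = ennreal \<mu>" "0 < \<mu>" using emeasure_ball[OF \<sigma>r] measure_ball_pos[OF \<sigma>r] by (auto simp: \<mu>_def)
  have "lorentz_norm M p q (\<lambda>y. enn2ereal (g y * indicator ?S y)) = ennpowr (ennreal p * energy (\<lambda>y. g y * indicator ?S y)) (1 / q)"
    unfolding lorentz_energy_def
  proof (rule lorentz_norm_eq)
    have "(\<lambda>y. g y * indicator ?S y) \<in> borel_measurable borel"
      using g by (intro borel_measurable_times_ennreal borel_measurable_indicator) auto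
    then show "(\<lambda>y. enn2ereal (g y * indicator ?S y)) \<in> borel_measurable M" by (rule enn2ereal_measurable_M)
  qed (use p q in auto)
  also have "\<dots> \<le> ennpowr (ennreal p * (ennreal (l powr q) * ennpowr (emeasure M ?S) (q / p))) (1 / q)"
    using q by (intro ennpowr_mono mult_left_mono good) auto
  also have "\<dots> = ennreal (p powr (1 / q) * l) * ennpowr (emeasure M ?S) (1 / p)"
    unfolding ennpowr_mult ennpowr_ennpowr using p q l
    by (simp add: ennpowr_ennreal powr_powr ennreal_mult mult.assoc)
  finally have "lorentz_norm M p q (\<lambda>y. enn2ereal (g y * indicator ?S y)) / ennpowr (emeasure M ?S) (1 / p) \<le> ennreal (p powr (1 / q) * l)"
    using \<mu> by (simp add: ennpowr_ennreal divide_le_posI_ennreal mult.commute)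
  then have "ennreal (C * r) * (lorentz_norm M p q (\<lambda>y. enn2ereal (g y * indicator ?S y)) / ennpowr (emeasure M ?S) (1 / p))
     \<le> ennreal (C * r) * ennreal (p powr (1 / q) * l)"
    by (rule mult_left_mono) simp
  also have "\<dots> = ennreal (K * r)" using C r l by (simp add: K_def mult_ac flip: ennreal_mult)
  finally have rhs: "ennreal (C * r) * (lorentz_norm M p q (\<lambda>y. enn2ereal (g y * indicator ?S y)) / ennpowr (emeasure M ?S) (1 / p)) \<le> ennreal (K * r)" .
  have k0: "0 \<le> k" using vk[of undefined] by linarith
  have "locally_integrable M (\<lambda>x. ereal (v x))"
    unfolding locally_integrable_def
  proof (intro conjI allI exI[of _ 1])
    fix x :: 'a
    have "(\<integral>\<^sup>+ y\<in>ball x 1. e2ennreal \<bar>ereal (v y)\<bar> \<partial>M) \<le> (\<integral>\<^sup>+ y\<in>ball x 1. ennreal k \<partial>M)"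
      using vk by (intro nn_integral_mono mult_right_mono) (auto simp: e2ennreal_ereal intro: ennreal_leI)
    also have "\<dots> < \<infinity>" using ball_finite[of 1 x] by (simp add: nn_integral_cmult_indicator ennreal_mult_less_top)
    finally show "(\<integral>\<^sup>+ y\<in>ball x 1. e2ennreal \<bar>ereal (v y)\<bar> \<partial>M) < \<infinity>" .
  qed auto
  from poincare[OF r this ug, of x] rhs
  have "(\<integral>\<^sup>+y\<in>?B. e2ennreal \<bar>ereal (v y) - ereal (mean_value M (\<lambda>x. ereal (v x)) ?B)\<bar> \<partial>M) / emeasure M ?B \<le> ennreal (K * r)"
    by (rule order_trans)
  moreover have "mean_value M (\<lambda>x. ereal (v x)) ?B = ball_average v x r"
    by (simp add: mean_value_def ball_average_def)
  ultimately have le: "(\<integral>\<^sup>+y\<in>?B. ennreal \<bar>v y - ball_average v x r\<bar> \<partial>M) / emeasure M ?B \<le> ennreal (K * r)"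
    by (simp add: e2ennreal_ereal)
  have "(\<integral>\<^sup>+y\<in>?B. ennreal \<bar>v y - ball_average v x r\<bar> \<partial>M) = ennreal (LINT z:?B|M. \<bar>v z - ball_average v x r\<bar>)"
  proof -
    have "set_integrable M ?B (\<lambda>z. \<bar>v z - ball_average v x r\<bar>)"
      using vk by (intro ball_integrable[OF vM vk r, of _ "k + \<bar>ball_average v x r\<bar>"]) (auto intro: order_trans[OF abs_triangle_ineq4])
    then have "integrable M (\<lambda>z. indicator ?B z * \<bar>v z - ball_average v x r\<bar>)" by (simp add: set_integrable_def)
    then have "(\<integral>\<^sup>+y. ennreal (indicator ?B y * \<bar>v y - ball_average v x r\<bar>) \<partial>M) = ennreal (LINT z:?B|M. \<bar>v z - ball_average v x r\<bar>)"
      unfolding set_lebesgue_integral_def real_scaleR_def by (intro nn_integral_eq_integral) auto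
    moreover have "(\<lambda>y. ennreal (indicator ?B y * \<bar>v y - ball_average v x r\<bar>)) = (\<lambda>y. ennreal \<bar>v y - ball_average v x r\<bar> * indicator ?B y)"
      by (auto simp: fun_eq_iff indicator_def)
    ultimately show ?thesis by simp
  qed
  with le have "ennreal ((LINT z:?B|M. \<bar>v z - ball_average v x r\<bar>) / measure M ?B) \<le> ennreal (K * r)"
    using measure_ball_pos[OF r, of x]
    by (simp add: emeasure_ball[OF r] divide_ennreal set_lebesgue_integral_def)
  then show ?thesis
    unfolding K_def[symmetric] using K r measure_ball_pos[OF r, of x] by (simp add: pos_divide_le_eq)
qed

text \<open>
  Each bad point gets one bad radius.  Disjoint bad balls have small total measure by
  \<open>weak_type_disjoint\<close>, and their enlargements cover.  The bound \<open>R\<close> on the radii is needed for the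
  covering lemma and harmless, because only small scales matter for Lipschitz continuity.
\<close>

lemma bad_balls_cover:
  assumes g [measurable]: "g \<in> borel_measurable borel" and l: "0 < l" and R: "0 < R"
    and fin: "tail (l / 2) (\<lambda>x. enn2ereal (g x)) < \<infinity>"
  obtains W where "open W"
    "\<And>x r. x \<notin> W \<Longrightarrow> 0 < r \<Longrightarrow> r \<le> R \<Longrightarrow> energy (\<lambda>y. g y * indicator (ball x r) y)
       \<le> ennreal (l powr q) * ennpowr (emeasure M (ball x r)) (q / p)"
    "ennreal (l powr q) * ennpowr (emeasure M W) (q / p) \<le> ennreal (2 * D ^ 3) * tail (l / 2) (\<lambda>x. enn2ereal (g x))"
proof -
  define T where "T = tail (l / 2) (\<lambda>x. enn2ereal (g x))"
  have gM [measurable]: "(\<lambda>x. enn2ereal (g x)) \<in> borel_measurable M" by (rule enn2ereal_measurable_M[OF g])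
  define bad where "bad x r \<longleftrightarrow> 0 < r \<and> r \<le> R \<and> \<not> energy (\<lambda>y. g y * indicator (ball x r) y)
       \<le> ennreal (l powr q) * ennpowr (emeasure M (ball x r)) (q / p)" for x r
  define r where "r x = (SOME r. bad x r)" for x
  define K where "K = {x. \<exists>r. bad x r}"
  have bad: "bad x (r x)" if "x \<in> K" for x using that unfolding K_def r_def by (auto intro: someI)
  \<comment> \<open>The number \<open>b\<close> solves \<open>l powr q * b powr (q / p) = 2 * T\<close>.\<close>
  define b where "b = ennpowr (ennreal (1 / l powr q) * (2 * T)) (p / q)"
  have b: "ennreal (l powr q) * ennpowr b (q / p) = 2 * T"
  proof -
    have "ennpowr b (q / p) = ennreal (1 / l powr q) * (2 * T)"
      unfolding b_def ennpowr_ennpowr using p q by simp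
    then show ?thesis using l by (simp add: mult.assoc[symmetric] flip: ennreal_mult)
  qed
  have bfin: "b < \<infinity>"
    using fin unfolding b_def T_def by (auto simp: ennreal_mult_less_top)
  obtain W where W: "open W" "K \<subseteq> W" "emeasure M W \<le> ennreal (D ^ 3) * b"
  proof (rule vitali_cover_measure_le[OF borel_M refl, of K r R b "ennreal (D ^ 3)"])
    fix F assume F: "finite F" "F \<subseteq> K" "disjoint_family_on (\<lambda>x. ball x (r x)) F"
    have pos: "0 < r x" if "x \<in> F" for x using bad[of x] F that by (auto simp: bad_def)
    have "ennreal (l powr q) * ennpowr (\<Sum>x\<in>F. emeasure M (ball x (r x))) (q / p) \<le> 2 * T"
      unfolding T_def
    proof (rule weak_type_disjoint[OF gM F(1,3)])
      fix x assume "x \<in> F"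
      have "(\<lambda>y. if y \<in> ball x (r x) then enn2ereal (g y) else 0) = (\<lambda>y. enn2ereal (g y * indicator (ball x (r x)) y))"
        by (auto simp: fun_eq_iff zero_ennreal.rep_eq)
      then show "ennreal (l powr q) * ennpowr (emeasure M (ball x (r x))) (q / p)
         \<le> tail 0 (\<lambda>y. if y \<in> ball x (r x) then enn2ereal (g y) else 0)"
        using bad[of x] F(2) \<open>x \<in> F\<close> unfolding bad_def lorentz_energy_def by (metis linear subsetD)
    qed (use pos ball_pos ball_finite l in auto)
    then have "ennreal (l powr q) * ennpowr (\<Sum>x\<in>F. emeasure M (ball x (r x))) (q / p) \<le> ennreal (l powr q) * ennpowr b (q / p)"
      unfolding b .
    then have "ennreal (1 / l powr q) * (ennreal (l powr q) * ennpowr (\<Sum>x\<in>F. emeasure M (ball x (r x))) (q / p))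
         \<le> ennreal (1 / l powr q) * (ennreal (l powr q) * ennpowr b (q / p))"
      by (rule mult_left_mono) simp
    then have "ennpowr (\<Sum>x\<in>F. emeasure M (ball x (r x))) (q / p) \<le> ennpowr b (q / p)"
      using l by (simp add: mult.assoc[symmetric] flip: ennreal_mult)
    then show "(\<Sum>x\<in>F. emeasure M (ball x (r x))) \<le> b"
      using ennpowr_strict_mono[of "q / p" b "\<Sum>x\<in>F. emeasure M (ball x (r x))"] p q by (meson divide_pos_pos leD leI less_le_trans zero_less_one)
  next
    fix x assume "x \<in> K"
    then show "emeasure M (ball x (5 * r x)) \<le> ennreal (D ^ 3) * emeasure M (ball x (r x))"
      using bad[of x] by (intro doubling_iterate) (auto simp: bad_def)
  qed (use bad bfin ball_pos in \<open>auto simp: bad_def\<close>)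
  have "ennreal (l powr q) * ennpowr (emeasure M W) (q / p) \<le> ennreal (l powr q) * ennpowr (ennreal (D ^ 3) * b) (q / p)"
    using W(3) p q by (intro mult_left_mono ennpowr_mono) auto
  also have "\<dots> = ennpowr (ennreal (D ^ 3)) (q / p) * (2 * T)"
    unfolding ennpowr_mult b[symmetric] by (simp only: mult_ac)
  also have "\<dots> \<le> ennreal (D ^ 3) * (2 * T)"
  proof (rule mult_right_mono)
    have "(D ^ 3) powr (q / p) \<le> (D ^ 3) powr 1"
      using D p q qp by (intro powr_mono) (auto simp: one_le_power)
    then show "ennpowr (ennreal (D ^ 3)) (q / p) \<le> ennreal (D ^ 3)"
      using D by (simp add: ennpowr_ennreal ennreal_leI)
  qed simp
  also have "\<dots> = ennreal (2 * D ^ 3) * T" using D by (simp add: ennreal_mult mult_ac)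
  finally have "ennreal (l powr q) * ennpowr (emeasure M W) (q / p) \<le> ennreal (2 * D ^ 3) * T" .
  then show ?thesis
    using that[OF W(1)] W(2) unfolding K_def bad_def T_def by blast
qed

text \<open>
  The set where \<open>u\<close> and \<open>f\<close> differ is contained, up to a null set, in the union of the set where
  truncation at \<open>l / 2\<close> changes \<open>u\<close> and of the bad set of \<open>g + l * \<rho>\<close>.  Both are controlled by tails
  beginning at \<open>l / 4\<close>: one factor 2 is lost in Chebyshev's inequality or in the weak type inequality, the
  other in truncating or in separating \<open>g\<close> from \<open>l * \<rho>\<close>.
\<close>

lemma lipschitz_approximation_at_height:
  assumes u [measurable]: "u \<in> borel_measurable borel" and g [measurable]: "g \<in> borel_measurable borel"
    and ug: "\<forall>\<gamma>\<in>Gamma_rect - \<Gamma>. upper_gradient_on_curve u g \<gamma>" and \<rho>: "\<rho> \<in> admissible \<Gamma>"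
    and l: "0 < l" and \<delta>: "0 \<le> \<delta>"
    and tail_g: "tail (l / 4) (\<lambda>x. enn2ereal (g x)) \<le> ennreal \<delta>"
    and tail_u: "tail (l / 4) u \<le> ennreal \<delta>"
    and energy_\<rho>: "energy \<rho> \<le> ennreal (\<delta> / l powr q)"
  obtains f where "(max (16 * D\<^sup>2 * (C * p powr (1 / q))) 1 * l)-lipschitz_on UNIV f" "\<And>x. \<bar>f x\<bar> \<le> l / 2"
    "ennreal (l powr q) * ennpowr (emeasure M {x. u x \<noteq> ereal (f x)}) (q / p) \<le> ennreal ((4 powr q + 4 * D ^ 3 * 2 powr q) * \<delta>)"
proof -
  have \<rho>M [measurable]: "\<rho> \<in> borel_measurable borel" using \<rho> by (simp add: admissible_def)
  define k where "k = l / 2"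
  have k: "0 \<le> k" "2 * k = l" using l by (auto simp: k_def)
  define g' where "g' x = g x + ennreal l * \<rho> x" for x
  have g' [measurable]: "g' \<in> borel_measurable borel" unfolding g'_def by measurable
  have uM [measurable]: "u \<in> borel_measurable M" by (rule measurable_M[OF u])
  define v where "v x = truncate k (u x)" for x
  have v [measurable]: "v \<in> borel_measurable borel" unfolding v_def by measurable
  have vk: "\<bar>v x\<bar> \<le> k" for x unfolding v_def by (rule abs_truncate_le[OF k(1)])
  have ug': "upper_gradient (\<lambda>x. ereal (v x)) g'"
    using upper_gradient_truncate[OF ug \<rho> g k(1)] unfolding v_def g'_def k(2) .
  have "tail (l / 4) (\<lambda>x. enn2ereal (ennreal l * \<rho> x)) \<le> energy (\<lambda>x. ennreal l * \<rho> x)"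
    unfolding lorentz_energy_def using l by (intro lorentz_tail_antimono) simp
  also have "\<dots> \<le> ennreal (l powr q) * ennreal (\<delta> / l powr q)"
    using lorentz_energy_cmult[OF \<rho>M l] energy_\<rho> by (meson mult_left_mono order_trans zero_le)
  also have "\<dots> = ennreal \<delta>" using l \<delta> by (simp flip: ennreal_mult)
  finally have tail_\<rho>: "tail (l / 4) (\<lambda>x. enn2ereal (ennreal l * \<rho> x)) \<le> ennreal \<delta>" .
  have "tail (2 * (l / 4)) (\<lambda>x. enn2ereal (g' x)) \<le>
     ennreal (2 powr q) * (tail (l / 4) (\<lambda>x. enn2ereal (g x)) + tail (l / 4) (\<lambda>x. enn2ereal (ennreal l * \<rho> x)))"
    by (rule lorentz_tail_add_le)
       (use l in \<open>auto simp: g'_def plus_ennreal.rep_eq intro!: enn2ereal_measurable_M distribution_fun_add_le\<close>)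
  also have "\<dots> \<le> ennreal (2 powr q) * (ennreal \<delta> + ennreal \<delta>)"
    by (intro mult_left_mono add_mono tail_g tail_\<rho>) simp
  also have "\<dots> = ennreal (2 powr q * (2 * \<delta>))" using \<delta> by (simp flip: ennreal_mult ennreal_plus)
  finally have tail_g': "tail (l / 2) (\<lambda>x. enn2ereal (g' x)) \<le> ennreal (2 powr q * (2 * \<delta>))" by simp
  then have fin: "tail (l / 2) (\<lambda>x. enn2ereal (g' x)) < \<infinity>" by (auto intro: le_less_trans)
  obtain W where W: "open W"
    "\<And>x r. x \<notin> W \<Longrightarrow> 0 < r \<Longrightarrow> r \<le> 4 * \<sigma> \<Longrightarrow> energy (\<lambda>y. g' y * indicator (ball x r) y)
       \<le> ennreal (l powr q) * ennpowr (emeasure M (ball x r)) (q / p)"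
    "ennreal (l powr q) * ennpowr (emeasure M W) (q / p) \<le> ennreal (2 * D ^ 3) * tail (l / 2) (\<lambda>x. enn2ereal (g' x))"
    using bad_balls_cover[OF g' l _ fin, of "4 * \<sigma>"] \<sigma> by auto
  have WM [measurable]: "W \<in> sets M" using W(1) borel_M by auto
  define K where "K = C * p powr (1 / q) * l"
  have K: "0 \<le> K" using C l by (simp add: K_def)
  obtain f where f: "(max (16 * D\<^sup>2 * K) (2 * k))-lipschitz_on UNIV f" "\<And>x. \<bar>f x\<bar> \<le> k" "AE x in M. x \<in> - W \<longrightarrow> v x = f x"
  proof (rule lipschitz_on_small_oscillation_set[of v k "- W" K])
    show "v \<in> borel_measurable M" by (rule measurable_M[OF v])
    show "- W \<in> sets M" using WM sets.compl_sets[OF WM] by (simp add: space_UNIV Compl_eq_Diff_UNIV)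
    fix x r assume x: "x \<in> - W" and r: "0 < r" "r \<le> (4::real)"
    have "energy (\<lambda>y. g' y * indicator (ball x (\<sigma> * r)) y)
       \<le> ennreal (l powr q) * ennpowr (emeasure M (ball x (\<sigma> * r))) (q / p)"
      using x r \<sigma> by (intro W(2)) auto
    from oscillation_le[OF v vk ug' r(1) l this]
    show "(LINT z:ball x r|M. \<bar>v z - ball_average v x r\<bar>) \<le> K * r * measure M (ball x r)"
      unfolding K_def .
  qed (use vk K in auto)
  have Lip: "max (16 * D\<^sup>2 * K) (2 * k) = max (16 * D\<^sup>2 * (C * p powr (1 / q))) 1 * l"
    unfolding k(2) K_def max_mult_distrib_right using l by (simp add: mult.assoc)
  have [measurable]: "f \<in> borel_measurable borel"
    using f(1) lipschitz_on_continuous_on borel_measurable_continuous_onI by blast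
  have "emeasure M {x. u x \<noteq> ereal (f x)} \<le> emeasure M ({x \<in> space M. ereal k < \<bar>u x\<bar>} \<union> W)"
  proof (rule emeasure_mono_AE)
    show "AE x in M. x \<in> {x. u x \<noteq> ereal (f x)} \<longrightarrow> x \<in> {x \<in> space M. ereal k < \<bar>u x\<bar>} \<union> W"
      using f(3)
    proof eventually_elim
      fix x assume x: "x \<in> - W \<longrightarrow> v x = f x"
      have "u x = ereal (f x)" if "x \<notin> W" "\<bar>u x\<bar> \<le> ereal k"
        using x that truncate_eq[OF that(2)] by (simp add: v_def)
      then show "x \<in> {x. u x \<noteq> ereal (f x)} \<longrightarrow> x \<in> {x \<in> space M. ereal k < \<bar>u x\<bar>} \<union> W"
        using not_le by (auto simp: space_UNIV)
    qed
    show "{x \<in> space M. ereal k < \<bar>u x\<bar>} \<union> W \<in> sets M" using uM WM by measurable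
  qed
  also have "\<dots> \<le> distribution_fun M u k + emeasure M W"
    unfolding distribution_fun_def by (intro emeasure_subadditive) measurable
  finally have "ennpowr (emeasure M {x. u x \<noteq> ereal (f x)}) (q / p) \<le> ennpowr (distribution_fun M u k + emeasure M W) (q / p)"
    using p q by (intro ennpowr_mono) auto
  also have "\<dots> \<le> ennpowr (distribution_fun M u k) (q / p) + ennpowr (emeasure M W) (q / p)"
    using p q qp by (intro ennpowr_add_le) auto
  finally have "ennreal (l powr q) * ennpowr (emeasure M {x. u x \<noteq> ereal (f x)}) (q / p)
     \<le> ennreal (l powr q) * ennpowr (distribution_fun M u k) (q / p) + ennreal (l powr q) * ennpowr (emeasure M W) (q / p)"
    unfolding distrib_left[symmetric] by (rule mult_left_mono) simp
  also have "\<dots> \<le> ennreal (4 powr q * \<delta>) + ennreal (4 * D ^ 3 * 2 powr q * \<delta>)"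
  proof (rule add_mono)
    have "ennreal (k powr q) * ennpowr (distribution_fun M u k) (q / p) \<le> ennreal (2 powr q) * tail (k / 2) u"
      using l by (intro distribution_fun_le_lorentz_tail[OF uM]) (simp add: k_def)
    also have "\<dots> \<le> ennreal (2 powr q) * ennreal \<delta>" using tail_u by (intro mult_left_mono) (auto simp: k_def)
    finally have "ennreal (2 powr q) * (ennreal (k powr q) * ennpowr (distribution_fun M u k) (q / p)) \<le> ennreal (2 powr q) * (ennreal (2 powr q) * ennreal \<delta>)"
      by (rule mult_left_mono) simp
    moreover have "2 powr q * k powr q = l powr q" using l by (simp add: k_def flip: powr_mult)
    moreover have "2 powr q * 2 powr q = 4 powr q" by (simp flip: powr_mult)
    ultimately show "ennreal (l powr q) * ennpowr (distribution_fun M u k) (q / p) \<le> ennreal (4 powr q * \<delta>)"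
      using \<delta> by (simp add: mult.assoc[symmetric] flip: ennreal_mult)
  next
    have "ennreal (l powr q) * ennpowr (emeasure M W) (q / p) \<le> ennreal (2 * D ^ 3) * ennreal (2 powr q * (2 * \<delta>))"
      using W(3) tail_g' by (meson mult_left_mono order_trans zero_le)
    also have "\<dots> = ennreal (4 * D ^ 3 * 2 powr q * \<delta>)" using D \<delta> by (simp add: mult_ac flip: ennreal_mult)
    finally show "ennreal (l powr q) * ennpowr (emeasure M W) (q / p) \<le> ennreal (4 * D ^ 3 * 2 powr q * \<delta>)" .
  qed
  also have "\<dots> = ennreal ((4 powr q + 4 * D ^ 3 * 2 powr q) * \<delta>)"
    using D \<delta> by (simp add: distrib_right flip: ennreal_plus)
  finally show ?thesis using that[of f] f Lip by (simp add: k_def)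
qed

text \<open>
  Choose \<open>l\<close> so large that the tails of \<open>u\<close> and \<open>g\<close> are below \<open>\<delta>\<close>, and then an admissible density for the
  exceptional curves whose multiple by \<open>l\<close> has energy below \<open>\<delta>\<close>.  Both \<open>u - f\<close> and its gradient vanish off
  \<open>E\<close>.  On \<open>E\<close>, values of \<open>\<bar>u - f\<bar>\<close> above \<open>l\<close> are at most \<open>2 * \<bar>u\<bar>\<close> and values of \<open>g + L\<close> above \<open>2 * L\<close> are at most
  \<open>2 * g\<close>, so \<open>lorentz_tail_split\<close> reduces the norms to the measure of \<open>E\<close> and to tails.
\<close>

proposition lipschitz_approximation:
  assumes u: "u \<in> newtonian_tilde M p q" and \<epsilon>: "0 < \<epsilon>"
  shows "\<exists>f :: 'a \<Rightarrow> real. (\<exists>L. L-lipschitz_on UNIV f) \<and> (\<lambda>x. ereal (f x)) \<in> newtonian_tilde M p q \<and>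
       newtonian_norm M p q (\<lambda>x. u x - ereal (f x)) < ennreal \<epsilon>"
proof -
  have uB [measurable]: "u \<in> borel_measurable borel" and uL: "u \<in> lorentz_space M p q"
    using u by (auto simp: newtonian_tilde_def)
  have uM: "u \<in> borel_measurable M" by (rule measurable_M[OF uB])
  have u_fin: "tail 0 u < \<infinity>" using uL in_lorentz_space_iff[OF uM] by simp
  obtain g where wug: "weak_upper_gradient M p q u g" and g_fin: "energy g < \<infinity>"
    using u in_weak_upper_gradients_iff by (auto simp: newtonian_tilde_def)
  have g [measurable]: "g \<in> borel_measurable borel" using wug by (simp add: weak_upper_gradient_def)
  have gM: "(\<lambda>x. enn2ereal (g x)) \<in> borel_measurable M" by (rule enn2ereal_measurable_M[OF g])
  obtain \<Gamma> where \<Gamma>: "Mod M p q \<Gamma> = 0" "\<forall>\<gamma>\<in>Gamma_rect - \<Gamma>. upper_gradient_on_curve u g \<gamma>"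
    using wug by (auto simp: weak_upper_gradient_def almost_every_curve_def)
  define c1 where "c1 = max (16 * D\<^sup>2 * (C * p powr (1 / q))) 1"
  define c2 where "c2 = 4 powr q + 4 * D ^ 3 * 2 powr q"
  define c3 where "c3 = (c2 + 2 powr q) + ((2 * c1) powr q * c2 + 2 powr q)"
  have c1: "1 \<le> c1" by (simp add: c1_def)
  have c2: "0 < c2" using D by (simp add: c2_def add_pos_nonneg)
  have c3: "0 < c3" using c1 c2 by (simp add: c3_def add_pos_pos)
  \<comment> \<open>The final estimate is \<open>p * c3 * \<delta>\<close>, to be compared with \<open>\<epsilon> powr q\<close>.\<close>
  define \<delta> where "\<delta> = \<epsilon> powr q / (2 * p * c3)"
  have \<delta>: "0 < \<delta>" using \<epsilon> p c3 by (simp add: \<delta>_def)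
  obtain a1 where a1: "\<And>a. a1 \<le> a \<Longrightarrow> tail a u < ennreal \<delta>"
    using lorentz_tail_eventually_small[OF uM u_fin, of "ennreal \<delta>"] \<delta> by auto
  obtain a2 where a2: "\<And>a. a2 \<le> a \<Longrightarrow> tail a (\<lambda>x. enn2ereal (g x)) < ennreal \<delta>"
    using lorentz_tail_eventually_small[OF gM, of "ennreal \<delta>"] g_fin \<delta> by (auto simp: lorentz_energy_def)
  define l where "l = 4 * max 1 (max a1 a2)"
  have l: "0 < l" "a1 \<le> l / 4" "a2 \<le> l / 4" by (auto simp: l_def)
  have "0 < ennreal (\<delta> / l powr q)" using \<delta> l by simp
  then obtain \<rho> where \<rho>: "\<rho> \<in> admissible \<Gamma>" "energy \<rho> < ennreal (\<delta> / l powr q)"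
    using \<Gamma>(1) unfolding Mod_eq_0_iff by blast
  define L where "L = c1 * l"
  have L: "l \<le> L" using c1 l by (simp add: L_def)
  obtain f where f: "L-lipschitz_on UNIV f" and fl: "\<And>x. \<bar>f x\<bar> \<le> l / 2"
    and E_small: "ennreal (l powr q) * ennpowr (emeasure M {x. u x \<noteq> ereal (f x)}) (q / p) \<le> ennreal (c2 * \<delta>)"
    using lipschitz_approximation_at_height[OF uB g \<Gamma>(2) \<rho>(1) l(1) less_imp_le[OF \<delta>]
        less_imp_le[OF a2[OF l(3)]] less_imp_le[OF a1[OF l(2)]] less_imp_le[OF \<rho>(2)],
        folded c1_def c2_def, folded L_def] by blast
  define E where "E = {x. u x \<noteq> ereal (f x)}"
  have [measurable]: "f \<in> borel_measurable borel"
    using f lipschitz_on_continuous_on borel_measurable_continuous_onI by blast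
  have EB [measurable]: "E \<in> sets borel" unfolding E_def by measurable
  then have EM: "E \<in> sets M" using sets_M by auto
  define w where "w x = u x - ereal (f x)" for x
  have wB [measurable]: "w \<in> borel_measurable borel" unfolding w_def by measurable
  have wM: "w \<in> borel_measurable M" by (rule measurable_M[OF wB])
  define G where "G x = (g x + ennreal L) * indicator E x" for x
  have G [measurable]: "G \<in> borel_measurable borel" unfolding G_def by measurable
  have GM: "(\<lambda>x. enn2ereal (G x)) \<in> borel_measurable M" by (rule enn2ereal_measurable_M[OF G])
  have w_off: "w x = 0" if "x \<notin> E" for x using that by (simp add: w_def E_def)
  have G_off: "G x = 0" if "x \<notin> E" for x using that by (simp add: G_def)
  have div_q: "x / q \<le> x" if "0 \<le> x" for x
    using divide_left_mono[OF q that] q by simp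
  have w_energy: "tail 0 w \<le> ennreal ((c2 + 2 powr q) * \<delta>)"
  proof -
    have "tail 0 w \<le> ennreal (l powr q / q) * ennpowr (emeasure M E) (q / p) + tail l w"
    proof (rule lorentz_tail_split[OF wM])
      fix s :: real assume "0 < s"
      then show "distribution_fun M w s \<le> emeasure M E"
        unfolding distribution_fun_def using w_off EM by (intro emeasure_mono) (auto intro: ccontr)
    qed (use l in simp)
    also have "ennreal (l powr q / q) * ennpowr (emeasure M E) (q / p) \<le> ennreal (l powr q) * ennpowr (emeasure M E) (q / p)"
      by (intro mult_right_mono ennreal_leI div_q) auto
    also have "\<dots> \<le> ennreal (c2 * \<delta>)" using E_small by (simp add: E_def)
    also have "tail l w \<le> ennreal (2 powr q) * ennreal \<delta>"
    proof -
      have "tail (2 * (l / 2)) w \<le> ennreal (2 powr q) * tail (l / 2) u"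
      proof (rule lorentz_tail_cmult_le[OF uM])
        fix s assume s: "2 * (l / 2) < s"
        have "ereal (s / 2) < \<bar>u x\<bar>" if "ereal s < \<bar>w x\<bar>" for x
        proof (cases "u x")
          case (real t)
          then have "s < \<bar>t - f x\<bar>" using that by (simp add: w_def)
          then have "s / 2 < \<bar>t\<bar>" using fl[of x] s by linarith
          then show ?thesis using real by simp
        qed auto
        then show "distribution_fun M w s \<le> distribution_fun M u (s / 2)"
          unfolding distribution_fun_def using uM by (intro emeasure_mono) auto
      qed (use l in auto)
      also have "\<dots> \<le> ennreal (2 powr q) * ennreal \<delta>"
        using a1[of "l / 2"] l by (intro mult_left_mono) (auto simp: less_imp_le)
      finally show ?thesis by simp
    qed
    finally show ?thesis
      using c2 \<delta> by (simp add: distrib_right add_left_mono add_right_mono flip: ennreal_mult ennreal_plus)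
  qed
  have G_energy: "energy G \<le> ennreal (((2 * c1) powr q * c2 + 2 powr q) * \<delta>)"
  proof -
    have "tail 0 (\<lambda>x. enn2ereal (G x))
       \<le> ennreal ((2 * L) powr q / q) * ennpowr (emeasure M E) (q / p) + tail (2 * L) (\<lambda>x. enn2ereal (G x))"
    proof (rule lorentz_tail_split[OF GM])
      fix s :: real assume "0 < s"
      then show "distribution_fun M (\<lambda>x. enn2ereal (G x)) s \<le> emeasure M E"
        unfolding distribution_fun_def using G_off EM
        by (intro emeasure_mono) (auto simp: zero_ennreal.rep_eq intro: ccontr)
    qed (use l L in simp)
    also have "ennreal ((2 * L) powr q / q) * ennpowr (emeasure M E) (q / p)
        \<le> ennreal ((2 * c1) powr q * l powr q) * ennpowr (emeasure M E) (q / p)"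
    proof (intro mult_right_mono ennreal_leI)
      have "(2 * L) powr q = (2 * c1) powr q * l powr q" using c1 l by (simp add: L_def mult.assoc flip: powr_mult)
      then show "(2 * L) powr q / q \<le> (2 * c1) powr q * l powr q"
        by (auto intro: order_trans[OF div_q])
    qed simp
    also have "\<dots> = ennreal ((2 * c1) powr q) * (ennreal (l powr q) * ennpowr (emeasure M E) (q / p))"
      by (simp add: ennreal_mult mult.assoc)
    also have "\<dots> \<le> ennreal ((2 * c1) powr q) * ennreal (c2 * \<delta>)"
      using E_small by (intro mult_left_mono) (simp_all add: E_def)
    also have "tail (2 * L) (\<lambda>x. enn2ereal (G x)) \<le> ennreal (2 powr q) * ennreal \<delta>"
    proof -
      have "tail (2 * L) (\<lambda>x. enn2ereal (G x)) \<le> ennreal (2 powr q) * tail L (\<lambda>x. enn2ereal (g x))"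
      proof (rule lorentz_tail_cmult_le[OF gM])
        fix s assume s: "2 * L < s"
        have "ereal (s / 2) < enn2ereal (g x)" if "ereal s < enn2ereal (G x)" for x
        proof -
          have "x \<in> E" using that G_off[of x] s l L by (cases "x \<in> E") (auto simp: zero_ennreal.rep_eq)
          then have "ereal s < enn2ereal (g x + ennreal L)" using that by (simp add: G_def)
          then show ?thesis using s l L by (cases "g x") (auto simp flip: ennreal_plus)
        qed
        then show "distribution_fun M (\<lambda>x. enn2ereal (G x)) s \<le> distribution_fun M (\<lambda>x. enn2ereal (g x)) (s / 2)"
          unfolding distribution_fun_def using gM by (intro emeasure_mono) auto
      qed (use l L in auto)
      also have "\<dots> \<le> ennreal (2 powr q) * ennreal \<delta>"
        using a2[of L] l L by (intro mult_left_mono) (auto simp: less_imp_le)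
      finally show ?thesis .
    qed
    finally show ?thesis
      using c1 c2 \<delta> unfolding lorentz_energy_def
      by (simp add: distrib_right mult.assoc add_left_mono add_right_mono flip: ennreal_mult ennreal_plus)
  qed
  note weak = weak_upper_gradients_lipschitz_approximation[OF wug g_fin f uB, folded E_def, folded w_def G_def]
  have G_weak: "G \<in> weak_upper_gradients M p q w"
    using weak(1) G_energy unfolding in_weak_upper_gradients_iff w_def by (auto intro: le_less_trans)
  have "energy (\<lambda>x. g x + G x) < \<infinity>"
    using G_energy g_fin by (intro le_less_trans[OF lorentz_energy_add_le]) (auto simp: ennreal_mult_less_top intro: le_less_trans)
  then have "(\<lambda>x. g x + G x) \<in> weak_upper_gradients M p q (\<lambda>x. ereal (f x))"
    using weak(2) by (simp add: in_weak_upper_gradients_iff)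
  moreover have "(\<lambda>x. ereal (f x)) \<in> lorentz_space M p q"
  proof -
    have fM: "(\<lambda>x. ereal (f x)) \<in> borel_measurable M" by (rule measurable_M) measurable
    have "\<bar>ereal (f x)\<bar> \<le> \<bar>u x\<bar> + \<bar>w x\<bar>" for x
      unfolding w_def by (cases "u x") auto
    then have "tail (2 * 0) (\<lambda>x. ereal (f x)) \<le> ennreal (2 powr q) * (tail 0 u + tail 0 w)"
      by (intro lorentz_tail_add_le uM wM distribution_fun_add_le) auto
    also have "\<dots> < \<infinity>" using u_fin w_energy by (auto simp: ennreal_mult_less_top intro: le_less_trans)
    finally show ?thesis using in_lorentz_space_iff[OF fM] by simp
  qed
  ultimately have f_newton: "(\<lambda>x. ereal (f x)) \<in> newtonian_tilde M p q"
    by (auto simp: newtonian_tilde_def)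
  have "newtonian_norm M p q w < ennreal \<epsilon>"
  proof -
    have "lorentz_norm M p q w = ennpowr (ennreal p * tail 0 w) (1 / q)"
      using p q by (intro lorentz_norm_eq wM) auto
    then have "ennpowr (lorentz_norm M p q w) q = ennreal p * tail 0 w"
      using q by (simp add: ennpowr_ennpowr)
    also have "\<dots> \<le> ennreal p * ennreal ((c2 + 2 powr q) * \<delta>)" by (intro mult_left_mono w_energy) simp
    finally have 1: "ennpowr (lorentz_norm M p q w) q \<le> ennreal p * ennreal ((c2 + 2 powr q) * \<delta>)" .
    have "(INF g \<in> weak_upper_gradients M p q w. ennpowr (lorentz_norm M p q (\<lambda>x. enn2ereal (g x))) q)
       \<le> ennpowr (lorentz_norm M p q (\<lambda>x. enn2ereal (G x))) q"
      by (rule INF_lower[OF G_weak])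
    also have "\<dots> = ennreal p * energy G" using q lorentz_norm_powr_eq[OF G, of q] by simp
    also have "\<dots> \<le> ennreal p * ennreal (((2 * c1) powr q * c2 + 2 powr q) * \<delta>)" by (intro mult_left_mono G_energy) simp
    finally have "ennpowr (lorentz_norm M p q w) q + (INF g \<in> weak_upper_gradients M p q w. ennpowr (lorentz_norm M p q (\<lambda>x. enn2ereal (g x))) q)
       \<le> ennreal p * ennreal ((c2 + 2 powr q) * \<delta>) + ennreal p * ennreal (((2 * c1) powr q * c2 + 2 powr q) * \<delta>)"
      using 1 by (rule add_mono[rotated])
    also have "\<dots> = ennreal (p * c3 * \<delta>)"
      using p c1 c2 \<delta> by (simp add: c3_def algebra_simps flip: ennreal_mult ennreal_plus)
    also have "\<dots> < ennreal (\<epsilon> powr q)"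
      using p c3 \<epsilon> by (simp add: \<delta>_def ennreal_less_iff field_simps)
    finally have "newtonian_norm M p q w < ennpowr (ennreal (\<epsilon> powr q)) (1 / q)"
      unfolding newtonian_norm_def using q by (intro ennpowr_strict_mono) auto
    also have "\<dots> = ennreal \<epsilon>" using q \<epsilon> by (simp add: ennpowr_ennreal powr_powr)
    finally show ?thesis .
  qed
  then show ?thesis using f f_newton unfolding w_def by blast
qed

end

theorem theorem6p9:
  fixes M :: "'a::complete_space measure" and p q :: real
  assumes "1 < p" and "1 \<le> q" and "q \<le> p"
    and "metric_measure_space M"
    and "doubling_measure M"
    and "weak_poincare M p q"
  shows "\<forall>U\<in>newtonian_space M p q. \<forall>u\<in>U. \<forall>\<epsilon>::real. \<epsilon> > 0 \<longrightarrow>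
    (\<exists>f :: 'a \<Rightarrow> real. (\<exists>L. L-lipschitz_on UNIV f) \<and>
       (\<lambda>x. ereal (f x)) \<in> newtonian_tilde M p q \<and>
       newtonian_norm M p q (\<lambda>x. u x - ereal (f x)) < ennreal \<epsilon>)"
proof (intro ballI allI impI)
  fix U u and \<epsilon> :: real
  assume "U \<in> newtonian_space M p q" "u \<in> U" "0 < \<epsilon>"
  then have u: "u \<in> newtonian_tilde M p q"
    by (auto simp: newtonian_space_def quotient_def newtonian_rel_def)
  obtain D where D: "1 \<le> D" "\<And>x r. 0 < r \<Longrightarrow> emeasure M (ball x (2 * r)) \<le> ennreal D * emeasure M (ball x r)"
    using assms(5) unfolding doubling_measure_def by blast
  obtain C \<sigma> where C: "0 < C" "1 \<le> \<sigma>" and poincare: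
    "\<And>x r u g. 0 < r \<Longrightarrow> locally_integrable M u \<and> upper_gradient u g \<Longrightarrow>
        (\<integral>\<^sup>+y\<in>ball x r. e2ennreal \<bar>u y - ereal (mean_value M u (ball x r))\<bar> \<partial>M) / emeasure M (ball x r)
        \<le> ennreal (C * r) * (lorentz_norm M p q (\<lambda>y. enn2ereal (g y * indicator (ball x (\<sigma> * r)) y))
               / ennpowr (emeasure M (ball x (\<sigma> * r))) (1 / p))"
    using assms(6) unfolding weak_poincare_def by blast
  have ball: "0 < emeasure M (ball x r) \<and> emeasure M (ball x r) < \<infinity>" if "0 < r" for x r
    using assms(4) that unfolding metric_measure_space_def by (metis bounded_ball centre_in_ball empty_iff open_ball)
  interpret poincare_space M p q D C \<sigma>
    by unfold_locales
       (use assms ball D C poincare in \<open>auto simp: metric_measure_space_def borel_regular_measure_def\<close>)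
  show "\<exists>f :: 'a \<Rightarrow> real. (\<exists>L. L-lipschitz_on UNIV f) \<and>
       (\<lambda>x. ereal (f x)) \<in> newtonian_tilde M p q \<and>
       newtonian_norm M p q (\<lambda>x. u x - ereal (f x)) < ennreal \<epsilon>"
    using u \<open>0 < \<epsilon>\<close> by (rule lipschitz_approximation)
qed

end
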